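(* Suppose that $\omega>\omega_0\ge 0$ and let $\tau>0$. Let $\phi_0\in\mathcal N_\omega$ and let $(\phi^n)_{n\ge0}$ be generated by the GFDN-BF scheme: $\phi^0=\phi_0$ and, for $n\ge 0$, $$\frac{\tilde\phi^{n+1}-\phi^n}{\tau}=\Delta\tilde\phi^{n+1}-\omega\tilde\phi^{n+1}-V\phi^n+|\phi^n|^{2\alpha}\phi^n\quad\text{on }\mathbb R^d,$$ $$\phi^{n+1}=\lambda_{n+1}\tilde\phi^{n+1},\qquad \lambda_{n+1}=\left(\frac{I_\omega^*(\tilde\phi^{n+1})}{\|\tilde\phi^{n+1}\|_{L^{2\alpha+2}}^{2\alpha+2}}\right)^{\frac1{2\alpha}}.$$ If $\phi_0\ge 0$, then $\phi^n\ge 0$ for all $n\ge 0$.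
   Context: Let $d\ge 1$ and $0<\alpha<\frac{2}{(d-2)_+}$, where $(d-2)_+=\max\{0,d-2\}$ (so $\alpha>0$ is arbitrary for $d\le 2$). All norms and spaces are over $\mathbb R^d$. Standing assumptions on the real-valued potential $V$: (i) $V\in L^q(\mathbb R^d)+L^\infty(\mathbb R^d)$ with $q=1$ if $d=1$, some $q>1$ if $d=2$, $q=d/2$ if $d\ge 3$; when $d=1$, $V$ may also be the sum of a bounded Borel measure and an $L^\infty$ function vanishing at infinity. (ii) $V$ vanishes at infinity: $|\{x\in\mathbb R^d:|V(x)|>a\}|<\infty$ for all $a>0$. (iii) $V$ is non-positive in the sense that $\int_{\mathbb R^d}V|\psi|^2\,dx\le 0$ for all $\psi\in H^1$. (If $V$ involves a measure, integrals against $V$ are understood accordingly, and $V\phi$ as an element of $H^{-1}$.) Definitions: $\omega_0=-\inf\{\int(|\nabla\phi|^2+V|\phi|^2)\,dx:\phi\in H^1,\ \|\phi\|_{L^2}=1\}$; $I_\omega^*(\phi)=\int\big(|\nabla\phi|^2+V|\phi|^2+\omega|\phi|^2\big)dx$; $I_\omega(\phi)=I_\omega^*(\phi)-\|\phi\|_{L^{2\alpha+2}}^{2\alpha+2}$; $\mathcal N_\omega=\{0\ne\phi\in H^1: I_\omega(\phi)=0\}$. The elliptic equation for $\tilde\phi^{n+1}$ is understood weakly, i.e. in $H^{-1}$, with $\tilde\phi^{n+1}\in H^1$. The scheme is well defined: each $\tilde\phi^{n+1}$ exists, is unique and nonzero, and the normalization step gives $\phi^{n+1}\in\mathcal N_\omega$.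 *)

theory Defs
  imports "HOL-Analysis.Analysis"
begin

text \<open>
  The space \<open>\<real>\<^sup>d\<close> is an arbitrary Euclidean space \<open>'a\<close> with \<open>d = DIM('a)\<close>.  Elements of function spaces
  are represented by complex-valued functions, identified when equal almost everywhere.
\<close>

definition Lp :: "real \<Rightarrow> ('a::euclidean_space \<Rightarrow> 'b::{banach,second_countable_topology}) set" where
  "Lp p = {f \<in> borel_measurable lebesgue. integrable lebesgue (\<lambda>x. norm (f x) powr p)}"

definition Linf :: "('a::euclidean_space \<Rightarrow> 'b::{banach,second_countable_topology}) set" where
  "Linf = {f \<in> borel_measurable lebesgue. \<exists>C. AE x in lebesgue. norm (f x) \<le> C}"

definition Lp_norm :: "real \<Rightarrow> ('a::euclidean_space \<Rightarrow> 'b::{banach,second_countable_topology}) \<Rightarrow> real" where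
  "Lp_norm p f = (\<integral>x. norm (f x) powr p \<partial>lebesgue) powr (1 / p)"


subsection \<open>The Sobolev space \<open>H\<^sup>1\<close>\<close>

abbreviation pderiv_at :: "'a::euclidean_space \<Rightarrow> ('a \<Rightarrow> real) \<Rightarrow> 'a \<Rightarrow> real" where
  "pderiv_at b f x \<equiv> frechet_derivative f (at x) b"

primrec Ck :: "nat \<Rightarrow> ('a::euclidean_space \<Rightarrow> real) \<Rightarrow> bool" where
  "Ck 0 f \<longleftrightarrow> continuous_on UNIV f"
| "Ck (Suc k) f \<longleftrightarrow> (\<forall>x. f differentiable (at x)) \<and> (\<forall>b\<in>Basis. Ck k (pderiv_at b f))"

definition test_functions :: "('a::euclidean_space \<Rightarrow> real) set" where
  "test_functions = {\<eta>. (\<forall>k. Ck k \<eta>) \<and> compact (closure {x. \<eta> x \<noteq> 0})}"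

definition has_weak_pderiv :: "('a::euclidean_space \<Rightarrow> complex) \<Rightarrow> 'a \<Rightarrow> ('a \<Rightarrow> complex) \<Rightarrow> bool" where
  "has_weak_pderiv f b g \<longleftrightarrow>
     (\<forall>\<eta>\<in>test_functions.
        (\<integral>x. pderiv_at b \<eta> x *\<^sub>R f x \<partial>lebesgue) = - (\<integral>x. \<eta> x *\<^sub>R g x \<partial>lebesgue))"

definition H1 :: "('a::euclidean_space \<Rightarrow> complex) set" where
  "H1 = {f \<in> Lp 2. \<forall>b\<in>Basis. \<exists>g\<in>Lp 2. has_weak_pderiv f b g}"

text \<open>A representative of the weak partial derivative, which is unique almost everywhere.\<close>

definition weak_pderiv :: "'a::euclidean_space \<Rightarrow> ('a \<Rightarrow> complex) \<Rightarrow> 'a \<Rightarrow> complex" where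
  "weak_pderiv b f = (SOME g. g \<in> Lp 2 \<and> has_weak_pderiv f b g)"


subsection \<open>Potentials\<close>

text \<open>
  A potential is either a function, or (only in dimension one) a bounded signed Borel measure plus
  a function.  The signed measure is given as the difference \<open>\<mu> - \<nu>\<close> of two finite measures; by the
  Jordan decomposition every bounded signed Borel measure has this form.
\<close>

datatype 'a potential =
    Function_Pot "'a \<Rightarrow> real"
  | Measure_Pot "'a measure" "'a measure" "'a \<Rightarrow> real"

text \<open>
  The continuous representative of a function that has one.  It is unique, and it makes the
  integral against a singular measure independent of the choice of representative.
\<close>

definition cont_rep :: "('a::euclidean_space \<Rightarrow> 'b::{banach,second_countable_topology}) \<Rightarrow> 'a \<Rightarrow> 'b" where
  "cont_rep f = (SOME g. continuous_on UNIV g \<and> (AE x in lebesgue. g x = f x))"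

text \<open>
  The integral of \<open>V f\<close>.  For measures it is used with \<open>d = 1\<close> and \<open>f\<close> a product of two elements of
  \<open>H\<^sup>1\<close> (up to conjugation), so that \<open>f\<close> does have a continuous representative.
\<close>

fun pot_integral ::
  "'a::euclidean_space potential \<Rightarrow> ('a \<Rightarrow> 'b::{banach,second_countable_topology}) \<Rightarrow> 'b" where
  "pot_integral (Function_Pot v) f = (\<integral>x. v x *\<^sub>R f x \<partial>lebesgue)"
| "pot_integral (Measure_Pot \<mu> \<nu> w) f =
     (\<integral>x. cont_rep f x \<partial>\<mu>) - (\<integral>x. cont_rep f x \<partial>\<nu>) + (\<integral>x. w x *\<^sub>R f x \<partial>lebesgue)"

definition vanishes_at_infinity :: "('a::euclidean_space \<Rightarrow> real) \<Rightarrow> bool" where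
  "vanishes_at_infinity v \<longleftrightarrow> (\<forall>a>0. emeasure lebesgue {x. \<bar>v x\<bar> > a} < \<infinity>)"

definition admissible_exponent :: "nat \<Rightarrow> real \<Rightarrow> bool" where
  "admissible_exponent d q \<longleftrightarrow>
     (if d = 1 then q = 1 else if d = 2 then q > 1 else q = real d / 2)"

fun admissible_class :: "'a::euclidean_space potential \<Rightarrow> bool" where
  "admissible_class (Function_Pot v) \<longleftrightarrow>
     (\<exists>q. admissible_exponent DIM('a) q \<and>
        (\<exists>f\<in>Lp q. \<exists>g\<in>Linf. v = (\<lambda>x. f x + g x))) \<and>
     vanishes_at_infinity v"
| "admissible_class (Measure_Pot \<mu> \<nu> w) \<longleftrightarrow>
     DIM('a) = 1 \<and>
     finite_measure \<mu> \<and> sets \<mu> = sets borel \<and>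
     finite_measure \<nu> \<and> sets \<nu> = sets borel \<and>
     w \<in> Linf \<and> vanishes_at_infinity w"

definition nonpositive_potential :: "'a::euclidean_space potential \<Rightarrow> bool" where
  "nonpositive_potential V \<longleftrightarrow> (\<forall>\<psi>\<in>H1. pot_integral V (\<lambda>x. (cmod (\<psi> x))\<^sup>2) \<le> 0)"

definition admissible_potential :: "'a::euclidean_space potential \<Rightarrow> bool" where
  "admissible_potential V \<longleftrightarrow> admissible_class V \<and> nonpositive_potential V"


subsection \<open>Action functional and Nehari manifold\<close>

definition kinetic :: "('a::euclidean_space \<Rightarrow> complex) \<Rightarrow> real" where
  "kinetic \<phi> = (\<integral>x. (\<Sum>b\<in>Basis. (cmod (weak_pderiv b \<phi> x))\<^sup>2) \<partial>lebesgue)"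

definition omega0 :: "'a::euclidean_space potential \<Rightarrow> real" where
  "omega0 V = - Inf {kinetic \<phi> + pot_integral V (\<lambda>x. (cmod (\<phi> x))\<^sup>2) | \<phi>. \<phi> \<in> H1 \<and> Lp_norm 2 \<phi> = 1}"

definition I_star :: "'a::euclidean_space potential \<Rightarrow> real \<Rightarrow> ('a \<Rightarrow> complex) \<Rightarrow> real" where
  "I_star V \<omega> \<phi> = kinetic \<phi> + pot_integral V (\<lambda>x. (cmod (\<phi> x))\<^sup>2)
     + \<omega> * (\<integral>x. (cmod (\<phi> x))\<^sup>2 \<partial>lebesgue)"

definition I_action :: "'a::euclidean_space potential \<Rightarrow> real \<Rightarrow> real \<Rightarrow> ('a \<Rightarrow> complex) \<Rightarrow> real" where
  "I_action V \<alpha> \<omega> \<phi> = I_star V \<omega> \<phi> - Lp_norm (2 * \<alpha> + 2) \<phi> powr (2 * \<alpha> + 2)"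

definition nehari :: "'a::euclidean_space potential \<Rightarrow> real \<Rightarrow> real \<Rightarrow> ('a \<Rightarrow> complex) set" where
  "nehari V \<alpha> \<omega> = {\<phi> \<in> H1. \<not> (AE x in lebesgue. \<phi> x = 0) \<and> I_action V \<alpha> \<omega> \<phi> = 0}"


subsection \<open>The GFDN-BF scheme\<close>

text \<open>
  \<open>u \<in> H\<^sup>1\<close> solves \<open>(u - \<phi>) / \<tau> = \<Delta> u - \<omega> u - V \<phi> + \<bar>\<phi>\<bar>\<^bsup>2\<alpha>\<^esup> \<phi>\<close> in \<open>H\<^sup>-\<^sup>1\<close>, i.e. both sides agree as
  continuous antilinear functionals on \<open>H\<^sup>1\<close>.
\<close>

definition BF_step ::
  "'a::euclidean_space potential \<Rightarrow> real \<Rightarrow> real \<Rightarrow> real \<Rightarrow> ('a \<Rightarrow> complex) \<Rightarrow> ('a \<Rightarrow> complex) \<Rightarrow> bool" where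
  "BF_step V \<alpha> \<omega> \<tau> \<phi> u \<longleftrightarrow> u \<in> H1 \<and>
     (\<forall>\<psi>\<in>H1.
        (\<integral>x. (u x - \<phi> x) / of_real \<tau> * cnj (\<psi> x) \<partial>lebesgue) =
          - (\<integral>x. (\<Sum>b\<in>Basis. weak_pderiv b u x * cnj (weak_pderiv b \<psi> x)) \<partial>lebesgue)
          - of_real \<omega> * (\<integral>x. u x * cnj (\<psi> x) \<partial>lebesgue)
          - pot_integral V (\<lambda>x. \<phi> x * cnj (\<psi> x))
          + (\<integral>x. of_real (cmod (\<phi> x) powr (2 * \<alpha>)) * \<phi> x * cnj (\<psi> x) \<partial>lebesgue))"

definition BF_lambda :: "'a::euclidean_space potential \<Rightarrow> real \<Rightarrow> real \<Rightarrow> ('a \<Rightarrow> complex) \<Rightarrow> real" where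
  "BF_lambda V \<alpha> \<omega> u =
     (I_star V \<omega> u / Lp_norm (2 * \<alpha> + 2) u powr (2 * \<alpha> + 2)) powr (1 / (2 * \<alpha>))"

definition GFDN_BF ::
  "'a::euclidean_space potential \<Rightarrow> real \<Rightarrow> real \<Rightarrow> real \<Rightarrow> ('a \<Rightarrow> complex)
     \<Rightarrow> (nat \<Rightarrow> 'a \<Rightarrow> complex) \<Rightarrow> (nat \<Rightarrow> 'a \<Rightarrow> complex) \<Rightarrow> bool" where
  "GFDN_BF V \<alpha> \<omega> \<tau> \<phi>0 \<phi> \<phi>t \<longleftrightarrow>
     (AE x in lebesgue. \<phi> 0 x = \<phi>0 x) \<and>
     (\<forall>n. BF_step V \<alpha> \<omega> \<tau> (\<phi> n) (\<phi>t (Suc n)) \<and>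
          (AE x in lebesgue. \<phi> (Suc n) x = of_real (BF_lambda V \<alpha> \<omega> (\<phi>t (Suc n))) * \<phi>t (Suc n) x))"

text \<open>The condition \<open>\<alpha> < 2 / (d - 2)\<^sub>+\<close> is void for \<open>d \<le> 2\<close>, whereas \<open>2 / 0 = 0\<close> in HOL.\<close>

definition subcritical :: "nat \<Rightarrow> real \<Rightarrow> bool" where
  "subcritical d \<alpha> \<longleftrightarrow> 0 < \<alpha> \<and> (d > 2 \<longrightarrow> \<alpha> < 2 / (real d - 2))"

definition nonneg_ae :: "('a::euclidean_space \<Rightarrow> complex) \<Rightarrow> bool" where
  "nonneg_ae \<phi> \<longleftrightarrow> (AE x in lebesgue. \<phi> x \<in> \<real>\<^sub>\<ge>\<^sub>0)"

end

theory Submission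
  imports Defs
begin

text \<open>
  If \<open>u\<close> is one step of the scheme started at \<open>p \<ge> 0\<close>, test the equation with
  \<open>\<psi> = - G(Re u) + \<i> Im u\<close>, where \<open>G\<close> is a \<open>C\<^sup>1\<close>, nonincreasing, 1-Lipschitz function that is positive
  exactly on the negative half-line.  Since \<open>Re \<psi> \<le> 0 \<le> p\<close>, the terms with \<open>p\<close> and with
  \<open>\<bar>p\<bar>\<^bsup>2\<alpha>\<^esup> p\<close> have nonpositive real part, and so has the potential term, because a potential that
  is nonpositive as a form on \<open>H\<^sup>1\<close> is a nonpositive measure.  The gradient term has a sign by
  monotonicity of \<open>G\<close>.  What remains is
  \<open>(1/\<tau> + \<omega>) \<integral>(- (Re u) G(Re u) + (Im u)\<^sup>2) \<le> 0\<close>, which forces \<open>Im u = 0\<close> and \<open>Re u \<ge> 0\<close>.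
  The normalising factor is a real power and hence nonnegative.
\<close>

subsection \<open>Smooth test functions\<close>

text \<open>The hypothesis on the potential speaks only of squares
  \<open>(cmod (\<psi> x))\<^sup>2\<close>, whereas the equation produces the mixed product of
  \<open>p\<close> and the test function. The square root of such a product need not have a
  square-integrable gradient, so the hypothesis cannot be applied to it. Hence the passage to a sign
  of the potential itself, extracted from real test functions. In dimension one the potential may
  charge Lebesgue null sets, so a sign known almost everywhere has to be upgraded to one that holds
  everywhere; this is the purpose of the continuous representatives of \<open>H1\<close> functions.
  The iterates are complex valued from the outset, so reality has to be proved together with the
  sign: the imaginary part enters the test function linearly and contributes a square to the pairing
  with \<open>u\<close>. The coefficient 1/\<tau> + \<omega> is positive because \<omega> exceeds
  \<open>omega0 V\<close>, which is nonnegative.\<close>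

lemma pderiv_at_eq:
  assumes "(f has_derivative f') (at x)"
  shows "pderiv_at b f x = f' b"
  using frechet_derivative_at[OF assms] by simp

lemma Ck_SucI:
  assumes "\<And>x. (f has_derivative f' x) (at x)" "\<And>b. b \<in> Basis \<Longrightarrow> Ck k (\<lambda>x. f' x b)"
  shows "Ck (Suc k) f"
proof -
  have "pderiv_at b f = (\<lambda>x. f' x b)" for b
    using pderiv_at_eq[OF assms(1)] by auto
  then show ?thesis using assms by (auto simp: differentiable_def)
qed

lemma Ck_has_derivative: "Ck (Suc k) f \<Longrightarrow> (f has_derivative frechet_derivative f (at x)) (at x)"
  by (simp add: frechet_derivative_works)

text \<open>The definition of \<open>Ck (Suc k)\<close> does not mention \<open>Ck k f\<close>. This
  nesting lets the product rule keep the undifferentiated factors at level \<open>k\<close>.\<close>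

lemma Ck_Suc_imp: "Ck (Suc k) f \<Longrightarrow> Ck k f"
proof (induction k arbitrary: f)
  case 0
  then show ?case
    by (auto simp: continuous_on_eq_continuous_at differentiable_imp_continuous_within)
next
  case (Suc k)
  then show ?case by fastforce
qed

lemma Ck_const: "Ck k (\<lambda>x. c)"
  by (induction k arbitrary: c) (auto intro!: Ck_SucI[where f' = "\<lambda>_ _. 0"])

lemma Ck_add: "Ck k f \<Longrightarrow> Ck k g \<Longrightarrow> Ck k (\<lambda>x. f x + g x)"
proof (induction k arbitrary: f g)
  case 0
  then show ?case by (auto intro: continuous_intros)
next
  case (Suc k)
  show ?case
    by (rule Ck_SucI[OF has_derivative_add[OF Ck_has_derivative[OF Suc.prems(1)] Ck_has_derivative[OF Suc.prems(2)]]])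
       (use Suc in auto)
qed

lemma Ck_mult: "Ck k f \<Longrightarrow> Ck k g \<Longrightarrow> Ck k (\<lambda>x. f x * g x)"
proof (induction k arbitrary: f g)
  case 0
  then show ?case by (auto intro: continuous_intros)
next
  case (Suc k)
  show ?case
    by (rule Ck_SucI[OF has_derivative_mult[OF Ck_has_derivative[OF Suc.prems(1)] Ck_has_derivative[OF Suc.prems(2)]]])
       (use Suc.prems Suc.prems[THEN Ck_Suc_imp] in \<open>auto intro!: Ck_add Suc.IH\<close>)
qed

lemma Ck_diff: "Ck k f \<Longrightarrow> Ck k g \<Longrightarrow> Ck k (\<lambda>x. f x - g x)"
  using Ck_add[OF _ Ck_mult[OF Ck_const], of k f g "- 1"] by simp

lemma Ck_prod: "(\<And>i. i \<in> I \<Longrightarrow> Ck k (f i)) \<Longrightarrow> Ck k (\<lambda>x. \<Prod>i\<in>I. f i x)"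
  by (induction I rule: infinite_finite_induct) (auto intro: Ck_const Ck_mult)

lemma Ck_translate: "Ck k f \<Longrightarrow> Ck k (\<lambda>x. f (x + c))"
proof (induction k arbitrary: f)
  case 0
  then show ?case by (auto intro!: continuous_on_compose2[of UNIV f] continuous_intros)
next
  case (Suc k)
  have "((\<lambda>x. f (x + c)) has_derivative frechet_derivative f (at (x + c))) (at x)" for x
    by (rule has_derivative_compose[OF _ Ck_has_derivative[OF Suc.prems]])
       (auto intro!: derivative_eq_intros)
  then show ?case
    by (rule Ck_SucI) (use Suc in auto)
qed

lemma pderiv_at_translate:
  assumes "Ck (Suc k) f"
  shows "pderiv_at b (\<lambda>x. f (x + c)) x = pderiv_at b f (x + c)"
  by (rule pderiv_at_eq, rule has_derivative_compose[OF _ Ck_has_derivative[OF assms]])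
     (auto intro!: derivative_eq_intros)

text \<open>
  The family is closed under differentiation up to linear combinations, so smoothness of
  \<open>flat 0\<close> follows by one induction over all \<open>n\<close> simultaneously.
\<close>

definition flat :: "nat \<Rightarrow> real \<Rightarrow> real" where
  "flat n t = (if t > 0 then exp (- 1 / t) / t ^ n else 0)"

text \<open>With s = 1/t the limit from the right becomes that of \<open>s ^ Suc n / exp s\<close>
  at infinity; on the left the quotient is identically 0. As \<open>flat n 0 = 0\<close>, this is
  the difference quotient at the point where the two branches meet.\<close>

lemma flat_quotient_tendsto_0: "((\<lambda>t. flat n t / t) \<longlongrightarrow> 0) (at 0)"
proof -
  have "((\<lambda>s::real. s ^ Suc n / exp s) \<longlongrightarrow> 0) at_top"
    by (rule tendsto_power_div_exp_0)
  then have "((\<lambda>t. inverse t ^ Suc n / exp (inverse t)) \<longlongrightarrow> 0) (at_right (0::real))"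
    by (rule filterlim_compose[OF _ filterlim_inverse_at_top_right])
  then have "((\<lambda>t. flat n t / t) \<longlongrightarrow> 0) (at_right 0)"
    by (rule Lim_transform_eventually)
       (auto simp: eventually_at_right_field flat_def exp_minus field_simps intro!: exI[of _ 1])
  moreover have "((\<lambda>t. flat n t / t) \<longlongrightarrow> 0) (at_left 0)"
    by (rule Lim_transform_eventually[OF tendsto_const])
       (auto simp: eventually_at_left_field flat_def intro!: exI[of _ "-1"])
  ultimately show ?thesis by (simp add: filterlim_split_at)
qed

lemma flat_has_derivative:
  "(flat n has_real_derivative (flat (n + 2) t - real n * flat (n + 1) t)) (at t)"
proof (cases t "0::real" rule: linorder_cases)
  case less
  have "((\<lambda>_. 0) has_real_derivative 0) (at t)" by simp
  then show ?thesis
    by (rule has_field_derivative_transform_within_open[where S = "{..<0}", THEN DERIV_cong])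
       (use less in \<open>auto simp: flat_def\<close>)
next
  case equal
  then show ?thesis
    using flat_quotient_tendsto_0[of n]
    by (simp add: has_field_derivative_iff flat_def[of _ 0] flat_def[of "Suc _"])
next
  case greater
  \<comment> \<open>Differentiating \<open>t ^ n\<close> produces the truncated exponent
    \<open>n - 1\<close>, which is why the computation splits on \<open>n\<close>.\<close>
  have "((\<lambda>t. exp (- 1 / t) / t ^ n) has_real_derivative
      (exp (- 1 / t) / t^(n+2) - real n * (exp (- 1 / t) / t^(n+1)))) (at t)"
    using greater
    by (auto intro!: derivative_eq_intros simp: divide_simps power2_eq_square)
       (cases n; simp add: algebra_simps)
  then have "((\<lambda>t. exp (- 1 / t) / t ^ n) has_real_derivative
      (flat (n + 2) t - real n * flat (n + 1) t)) (at t)"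
    using greater by (simp add: flat_def)
  then show ?thesis
    by (rule has_field_derivative_transform_within_open[where S = "{0<..}"])
       (use greater in \<open>auto simp: flat_def\<close>)
qed

lemma Ck_flat: "Ck k (\<lambda>x. flat n (x \<bullet> a + c))"
proof (induction k arbitrary: n)
  case 0
  have "continuous_on UNIV (flat n)"
    using flat_has_derivative[THEN DERIV_isCont] by (simp add: continuous_on_eq_continuous_at)
  then show ?case
    by (auto intro!: continuous_intros continuous_on_compose2[of UNIV "flat n"])
next
  case (Suc k)
  have "((\<lambda>x. flat n (x \<bullet> a + c)) has_derivative
      (\<lambda>h. (flat (n + 2) (x \<bullet> a + c) - real n * flat (n + 1) (x \<bullet> a + c)) * (h \<bullet> a))) (at x)" for x
    by (rule has_derivative_compose[OF _ flat_has_derivative[of n, unfolded has_field_derivative_def]])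
       (auto intro!: derivative_eq_intros)
  then show ?case
    by (rule Ck_SucI) (intro Ck_mult Ck_diff Ck_const Suc)
qed

text \<open>One smooth cutoff for each face of \<open>box l r\<close>. Since \<open>flat 0\<close>
  is positive exactly on the positive half-line and tends to 1 at infinity, for s > 0 the product is
  positive precisely on the open box, and it tends to 1 there as the scale \<open>s\<close>
  grows.\<close>

definition bump :: "real \<Rightarrow> 'a::euclidean_space \<Rightarrow> 'a \<Rightarrow> 'a \<Rightarrow> real" where
  "bump s l r x = (\<Prod>b\<in>Basis. flat 0 (s * (x \<bullet> b - l \<bullet> b)) * flat 0 (s * (r \<bullet> b - x \<bullet> b)))"

lemma Ck_bump: "Ck k (bump s l r)"
proof -
  have "Ck k (\<lambda>x. flat 0 (s * (x \<bullet> b - l \<bullet> b)) * flat 0 (s * (r \<bullet> b - x \<bullet> b)))" for b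
    using Ck_mult[OF Ck_flat[of k 0 "s *\<^sub>R b" "- s * (l \<bullet> b)"] Ck_flat[of k 0 "- s *\<^sub>R b" "s * (r \<bullet> b)"]]
    by (simp add: algebra_simps)
  then show ?thesis unfolding bump_def by (intro Ck_prod)
qed

lemma flat_0_bounds: "0 \<le> flat 0 t" "flat 0 t \<le> 1"
  by (auto simp: flat_def)

lemma bump_bounds: "0 \<le> bump s l r x" "bump s l r x \<le> 1"
  unfolding bump_def
  by (auto intro!: prod_nonneg prod_le_1 mult_nonneg_nonneg mult_le_one flat_0_bounds)

lemma bump_eq_0:
  assumes "s > 0" "x \<notin> box l r"
  shows "bump s l r x = 0"
proof -
  obtain b where "b \<in> Basis" "x \<bullet> b \<le> l \<bullet> b \<or> r \<bullet> b \<le> x \<bullet> b"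
    using assms(2) by (force simp: mem_box)
  then show ?thesis using assms(1)
    by (auto simp: bump_def flat_def zero_less_mult_iff intro!: prod_zero bexI[of _ b])
qed

lemma bump_tendsto_1:
  assumes "x \<in> box l r"
  shows "(\<lambda>n. bump (real (Suc n)) l r x) \<longlonglongrightarrow> 1"
proof -
  have *: "(\<lambda>n. flat 0 (real (Suc n) * t)) \<longlonglongrightarrow> 1" if "t > 0" for t :: real
  proof -
    have "(\<lambda>n. (- 1 / t) * inverse (real (Suc n))) \<longlonglongrightarrow> (- 1 / t) * 0"
      by (intro tendsto_intros LIMSEQ_inverse_real_of_nat)
    then have "(\<lambda>n. exp ((- 1 / t) * inverse (real (Suc n)))) \<longlonglongrightarrow> exp 0"
      by (intro tendsto_exp) simp
    moreover have "flat 0 (real (Suc n) * t) = exp ((- 1 / t) * inverse (real (Suc n)))" for n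
      using that by (simp add: flat_def divide_simps mult.commute del: of_nat_Suc) 
    ultimately show ?thesis by simp
  qed
  have "(\<lambda>n. bump (real (Suc n)) l r x) \<longlonglongrightarrow> (\<Prod>b\<in>(Basis::'a set). 1 * 1)"
    unfolding bump_def using assms
    by (intro tendsto_prod tendsto_mult *) (auto simp: mem_box)
  then show ?thesis by simp
qed

lemma test_functionI:
  assumes "\<And>k. Ck k \<eta>" "bounded {x. \<eta> x \<noteq> 0}"
  shows "\<eta> \<in> test_functions"
  using assms by (auto simp: test_functions_def compact_eq_bounded_closed bounded_closure)

text \<open>An open set is a countable union of boxes, and one minus the product of the factors
  \<open>1 - bump\<close> acts as a smooth union: it vanishes off all boxes, stays below 1 and
  dominates each single bump. The index \<open>n\<close> governs both the number of boxes and the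
  steepness of the bumps.\<close>

lemma test_functions_exhaust_open:
  fixes U :: "'a::euclidean_space set"
  assumes "open U" "bounded U"
  obtains \<eta> :: "nat \<Rightarrow> 'a \<Rightarrow> real" where
    "\<And>n. \<eta> n \<in> test_functions" "\<And>n x. 0 \<le> \<eta> n x \<and> \<eta> n x \<le> indicator U x"
    "\<And>x. (\<lambda>n. \<eta> n x) \<longlonglongrightarrow> indicator U x"
proof -
  obtain D where D: "countable D" "D \<subseteq> Pow U" "\<And>X. X \<in> D \<Longrightarrow> \<exists>a b. X = box a b" "\<Union>D = U"
    by (rule open_countable_Union_open_box[OF assms(1)]) (rule that)
  obtain l r where lr: "\<And>X. X \<in> D \<Longrightarrow> X = box (l X) (r X)"
    using D(3) by metis
  \<comment> \<open>Adding the empty set makes the countable family nonempty, so it is the range of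
    a sequence even if \<open>U\<close> is empty.\<close>
  define B where "B = from_nat_into (insert {} D)"
  have rB: "range B = insert {} D"
    unfolding B_def using D(1) by (intro range_from_nat_into) auto
  \<comment> \<open>The degenerate \<open>box 0 0\<close> represents the empty set, because the
    corners \<open>l\<close> and \<open>r\<close> are specified only for members of
    \<open>D\<close>.\<close>
  define L R :: "nat \<Rightarrow> 'a" where "L i = (if B i = {} then 0 else l (B i))" 
    and "R i = (if B i = {} then 0 else r (B i))" for i
  have B: "B i = box (L i) (R i)" for i
  proof (cases "B i = {}")
    case False
    then have "B i \<in> D" using rB by auto
    then show ?thesis using False lr by (auto simp: L_def R_def)
  qed (auto simp: L_def R_def)
  have UB: "(\<Union>i. box (L i) (R i)) = U"
    using rB D(4) unfolding B[symmetric] by auto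
  define \<eta> where "\<eta> n x = 1 - (\<Prod>i<n. 1 - bump (real (Suc n)) (L i) (R i) x)" for n x
  have bnd: "0 \<le> \<eta> n x \<and> \<eta> n x \<le> indicator U x" for n x
  proof (cases "x \<in> U")
    case True
    then show ?thesis using bump_bounds
      by (auto simp: \<eta>_def intro!: prod_nonneg prod_le_1)
  next
    case False
    then have "bump (real (Suc n)) (L i) (R i) x = 0" for i
      using UB by (intro bump_eq_0) auto
    then show ?thesis using False by (auto simp: \<eta>_def)
  qed
  show thesis
  proof (rule that)
    show "\<eta> n \<in> test_functions" for n
    proof (rule test_functionI)
      show "Ck k (\<eta> n)" for k
        unfolding \<eta>_def by (intro Ck_diff Ck_const Ck_prod Ck_bump)
      have "{x. \<eta> n x \<noteq> 0} \<subseteq> U"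
      proof
        fix x assume "x \<in> {x. \<eta> n x \<noteq> 0}"
        then show "x \<in> U" using bnd[of n x] by (cases "x \<in> U") auto
      qed
      then show "bounded {x. \<eta> n x \<noteq> 0}" using assms(2) bounded_subset by blast
    qed
    show "0 \<le> \<eta> n x \<and> \<eta> n x \<le> indicator U x" for n x by (rule bnd)
    show "(\<lambda>n. \<eta> n x) \<longlonglongrightarrow> indicator U x" for x
    proof (cases "x \<in> U")
      case False
      then have "\<eta> n x = 0" for n using bnd[of n x] by auto
      then show ?thesis using False by simp
    next
      case True
      then obtain j where j: "x \<in> box (L j) (R j)" using UB by auto
      \<comment> \<open>All factors of the product lie in [0, 1], so keeping only the j-th one
        bounds the product from above. That factor is present as soon as n > j.\<close>
      have "bump (real (Suc n)) (L j) (R j) x \<le> \<eta> n x" if "n > j" for n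
      proof -
        have "(\<Prod>i<n. 1 - bump (real (Suc n)) (L i) (R i) x)
            = (1 - bump (real (Suc n)) (L j) (R j) x) *
              (\<Prod>i\<in>{..<n}-{j}. 1 - bump (real (Suc n)) (L i) (R i) x)"
          using that by (intro prod.remove) auto
        also have "\<dots> \<le> (1 - bump (real (Suc n)) (L j) (R j) x) * 1"
          using bump_bounds by (intro mult_left_mono prod_le_1) auto
        finally show ?thesis by (simp add: \<eta>_def)
      qed
      then have "eventually (\<lambda>n. bump (real (Suc n)) (L j) (R j) x \<le> \<eta> n x) sequentially"
        by (auto intro: eventually_mono[OF eventually_gt_at_top[of j]])
      moreover have "eventually (\<lambda>n. \<eta> n x \<le> 1) sequentially"
        using bnd[of _ x] True by auto
      ultimately have "(\<lambda>n. \<eta> n x) \<longlonglongrightarrow> 1"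
        by (rule tendsto_sandwich[OF _ _ bump_tendsto_1[OF j] tendsto_const])
      then show ?thesis using True by simp
    qed
  qed
qed

subsection \<open>Nonpositivity on squares of test functions\<close>

lemma test_functions_mult:
  assumes "\<eta> \<in> test_functions" "\<And>k. Ck k \<psi>"
  shows "(\<lambda>x. \<eta> x * \<psi> x) \<in> test_functions"
proof (rule test_functionI)
  show "Ck k (\<lambda>x. \<eta> x * \<psi> x)" for k
    using assms by (intro Ck_mult) (auto simp: test_functions_def)
  have "bounded {x. \<eta> x \<noteq> 0}"
    using assms(1) bounded_subset[OF compact_imp_bounded closure_subset]
    by (auto simp: test_functions_def)
  then show "bounded {x. \<eta> x * \<psi> x \<noteq> 0}"
    by (rule bounded_subset) auto
qed

lemma test_functions_Ck: "\<eta> \<in> test_functions \<Longrightarrow> Ck k \<eta>"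
  by (simp add: test_functions_def)

lemma test_functions_square: "\<eta> \<in> test_functions \<Longrightarrow> (\<lambda>x. (\<eta> x)\<^sup>2) \<in> test_functions"
  unfolding power2_eq_square by (intro test_functions_mult test_functions_Ck)

lemma continuous_on_test_function: "\<eta> \<in> test_functions \<Longrightarrow> continuous_on UNIV \<eta>"
  using test_functions_Ck[of \<eta> 0] by simp

lemma borel_measurable_test_function [measurable_dest]:
  "\<eta> \<in> test_functions \<Longrightarrow> \<eta> \<in> borel_measurable borel"
  by (intro borel_measurable_continuous_onI continuous_on_test_function)

text \<open>The function is bounded on its compact support by continuity. Majorants of this shape
  reduce integrability against a test function to local integrability and serve as dominating
  functions throughout.\<close>

lemma test_function_bounded:
  assumes "\<eta> \<in> test_functions"
  obtains C R where "0 \<le> C" "0 \<le> R" "\<And>x. \<bar>\<eta> x\<bar> \<le> C * indicator (cball 0 R) x"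
proof -
  let ?K = "closure {x. \<eta> x \<noteq> 0}"
  have K: "compact ?K" using assms by (simp add: test_functions_def)
  then have "bounded (\<eta> ` ?K)"
    by (intro compact_imp_bounded compact_continuous_image
        continuous_on_subset[OF continuous_on_test_function[OF assms]]) auto
  then obtain C where C: "\<And>x. x \<in> ?K \<Longrightarrow> \<bar>\<eta> x\<bar> \<le> C" "0 < C"
    unfolding bounded_pos by (auto simp: image_iff)
  obtain R where R: "\<And>x. x \<in> ?K \<Longrightarrow> norm x \<le> R" "0 < R"
    using compact_imp_bounded[OF K] unfolding bounded_pos by blast
  have "\<bar>\<eta> x\<bar> \<le> C * indicator (cball 0 R) x" for x
  proof (cases "\<eta> x = 0")
    case False
    then have "x \<in> ?K" using closure_subset[of "{x. \<eta> x \<noteq> 0}"] by auto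
    then show ?thesis using C R by auto
  qed (use C in auto)
  then show thesis using that C(2) R(2) by (auto intro: less_imp_le)
qed

text \<open>Stated over \<open>lborel\<close>, since translations and product measures are handled
  there on Borel representatives. Closed balls about the origin suffice because every bounded set
  lies in one of them.\<close>

definition locally_integrable :: "('a::euclidean_space \<Rightarrow> 'b::{banach,second_countable_topology}) \<Rightarrow> bool" where
  "locally_integrable f \<longleftrightarrow> (\<forall>R. integrable lborel (\<lambda>x. indicator (cball 0 R) x *\<^sub>R f x))"

lemma locally_integrable_mult_bounded:
  fixes f :: "'a::euclidean_space \<Rightarrow> 'b::{banach,second_countable_topology}"
  assumes f: "locally_integrable f" and [measurable]: "f \<in> borel_measurable borel" "\<eta> \<in> borel_measurable borel"
    and b: "\<And>x. \<bar>\<eta> x\<bar> \<le> C * indicator (cball 0 R) x"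
  shows "integrable lborel (\<lambda>x. \<eta> x *\<^sub>R f x)"
proof (rule Bochner_Integration.integrable_bound)
  show "integrable lborel (\<lambda>x. C *\<^sub>R (indicator (cball 0 R) x *\<^sub>R f x))"
    using f unfolding locally_integrable_def by (intro integrable_scaleR_right) blast
  show "AE x in lborel. norm (\<eta> x *\<^sub>R f x) \<le> norm (C *\<^sub>R (indicator (cball 0 R) x *\<^sub>R f x))"
  proof (rule AE_I2)
    fix x
    have "\<bar>\<eta> x\<bar> \<le> \<bar>C * indicator (cball 0 R) x\<bar>"
      using b[of x] by linarith
    then have "\<bar>\<eta> x\<bar> * norm (f x) \<le> \<bar>C * indicator (cball 0 R) x\<bar> * norm (f x)"
      by (intro mult_right_mono) auto
    then show "norm (\<eta> x *\<^sub>R f x) \<le> norm (C *\<^sub>R (indicator (cball 0 R) x *\<^sub>R f x))"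
      by (simp only: norm_scaleR abs_mult mult.assoc)
  qed
qed auto

lemma locally_integrable_test:
  assumes "locally_integrable f" "f \<in> borel_measurable borel" "\<eta> \<in> test_functions"
  shows "integrable lborel (\<lambda>x. \<eta> x *\<^sub>R f x)"
proof -
  obtain C R where "\<And>x. \<bar>\<eta> x\<bar> \<le> C * indicator (cball 0 R) x"
    by (rule test_function_bounded[OF assms(3)]) (rule that)
  then show ?thesis
    using assms by (intro locally_integrable_mult_bounded borel_measurable_test_function)
qed

section \<open>From squares of test functions to Borel sets and nonnegative Borel functions\<close>

context
  fixes \<mu> \<nu> :: "'a::euclidean_space measure" and w :: "'a \<Rightarrow> real"
  assumes \<mu>: "finite_measure \<mu>" and sets_\<mu> [measurable_cong]: "sets \<mu> = sets borel"
    and \<nu>: "finite_measure \<nu>" and sets_\<nu> [measurable_cong]: "sets \<nu> = sets borel"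
    and w [measurable]: "w \<in> borel_measurable borel" and loc: "locally_integrable w"
    and le: "\<And>\<eta>. \<eta> \<in> test_functions \<Longrightarrow>
      (\<integral>x. (\<eta> x)\<^sup>2 \<partial>\<mu>) - (\<integral>x. (\<eta> x)\<^sup>2 \<partial>\<nu>) + (\<integral>x. w x * (\<eta> x)\<^sup>2 \<partial>lborel) \<le> 0"
begin

interpretation \<mu>: finite_measure \<mu> by (rule \<mu>)
interpretation \<nu>: finite_measure \<nu> by (rule \<nu>)

lemma integrable_indicator_bounded:
  assumes "bounded B" "B \<in> sets borel"
  shows "integrable lborel (\<lambda>x. indicator B x * w x)"
proof -
  obtain R where "B \<subseteq> cball 0 R" using bounded_subset_ballD[OF assms(1), of 0] ball_subset_cball by blast
  then have "\<bar>indicator B x :: real\<bar> \<le> 1 * indicator (cball 0 R) x" for x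
    by (auto simp: indicator_def)
  from locally_integrable_mult_bounded[OF loc w _ this] assms(2) show ?thesis by simp
qed

text \<open>Test functions that exhaust \<open>U\<close> converge to its indicator, and so do their
  squares; dominated convergence carries the hypothesis over. Boundedness of \<open>U\<close> makes
  \<open>w\<close> integrable on it. The positive and negative parts of \<open>w\<close> are put on
  opposite sides so that the inequality can later be extended to quantities that may be
  infinite.\<close>

lemma emeasure_le_open:
  assumes "open U" "bounded U"
  shows "emeasure \<mu> U + (\<integral>\<^sup>+x. indicator U x * ennreal (w x) \<partial>lborel)
    \<le> emeasure \<nu> U + (\<integral>\<^sup>+x. indicator U x * ennreal (- w x) \<partial>lborel)"
proof -
  have U [measurable]: "U \<in> sets borel" using assms by simp
  obtain \<eta> where \<eta>: "\<And>n. \<eta> n \<in> test_functions" "\<And>n x. 0 \<le> \<eta> n x \<and> \<eta> n x \<le> indicator U x"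
    "\<And>x. (\<lambda>n. \<eta> n x) \<longlonglongrightarrow> indicator U x"
    by (rule test_functions_exhaust_open[OF assms]) (rule that)
  note [measurable] = borel_measurable_test_function[OF \<eta>(1)]
  have lim: "(\<lambda>n. (\<eta> n x)\<^sup>2) \<longlonglongrightarrow> indicator U x" for x
    using tendsto_power[OF \<eta>(3)[of x], of 2] by (cases "x \<in> U") auto
  have bnd: "(\<eta> n x)\<^sup>2 \<le> indicator U x" for n x
    using \<eta>(2)[of n x] by (auto simp: indicator_def power_le_one split: if_splits)
  have fin: "(\<lambda>n. \<integral>x. (\<eta> n x)\<^sup>2 \<partial>M) \<longlonglongrightarrow> measure M U"
    if "finite_measure M" and [measurable_cong]: "sets M = sets borel" for M
  proof -
    interpret finite_measure M by fact
    have "(\<lambda>n. \<integral>x. (\<eta> n x)\<^sup>2 \<partial>M) \<longlonglongrightarrow> (\<integral>x. indicator U x \<partial>M)"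
    proof (rule integral_dominated_convergence[where w = "\<lambda>_. 1"])
      show "AE x in M. norm ((\<eta> n x)\<^sup>2) \<le> 1" for n
        using order_trans[OF bnd] by (auto simp: indicator_def)
    qed (use lim in auto)
    then show ?thesis using U that(2) by simp
  qed
  have "(\<lambda>n. \<integral>x. w x * (\<eta> n x)\<^sup>2 \<partial>lborel) \<longlonglongrightarrow> (\<integral>x. w x * indicator U x \<partial>lborel)"
  proof (rule integral_dominated_convergence[where w = "\<lambda>x. \<bar>indicator U x * w x\<bar>"])
    show "integrable lborel (\<lambda>x. \<bar>indicator U x * w x\<bar>)"
      using integrable_indicator_bounded[OF assms(2) U] by simp
    show "AE x in lborel. norm (w x * (\<eta> n x)\<^sup>2) \<le> \<bar>indicator U x * w x\<bar>" for n
      using bnd[of n] by (auto simp: abs_mult mult.commute intro!: mult_left_mono)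
  qed (use lim in \<open>auto intro!: tendsto_intros\<close>)
  then have "measure \<mu> U - measure \<nu> U + (\<integral>x. w x * indicator U x \<partial>lborel) \<le> 0"
    by (intro LIMSEQ_le_const2[OF tendsto_add[OF tendsto_diff[OF fin[OF \<mu> sets_\<mu>] fin[OF \<nu> sets_\<nu>]]]])
       (auto intro!: le \<eta>)
  moreover have int: "integrable lborel (\<lambda>x. w x * indicator U x)"
    using integrable_indicator_bounded[OF assms(2) U] by (simp add: mult.commute)
  have p: "(\<integral>\<^sup>+x. ennreal (w x * indicator U x) \<partial>lborel) = (\<integral>\<^sup>+x. indicator U x * ennreal (w x) \<partial>lborel)"
    "(\<integral>\<^sup>+x. ennreal (- (w x * indicator U x)) \<partial>lborel) = (\<integral>\<^sup>+x. indicator U x * ennreal (- w x) \<partial>lborel)"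
    by (intro nn_integral_cong; auto simp: indicator_def)+
  moreover define a where "a = enn2real (\<integral>\<^sup>+x. ennreal (w x * indicator U x) \<partial>lborel)"
  moreover define b where "b = enn2real (\<integral>\<^sup>+x. ennreal (- (w x * indicator U x)) \<partial>lborel)"
  ultimately have "measure \<mu> U + a \<le> measure \<nu> U + b"
    using real_lebesgue_integral_def[OF int] by simp
  moreover have "ennreal a = (\<integral>\<^sup>+x. indicator U x * ennreal (w x) \<partial>lborel)"
    "ennreal b = (\<integral>\<^sup>+x. indicator U x * ennreal (- w x) \<partial>lborel)" "0 \<le> a" "0 \<le> b"
    using int unfolding p[symmetric] a_def b_def by (auto simp: real_integrable_def less_top)
  ultimately show ?thesis
    by (simp add: \<mu>.emeasure_eq_measure \<nu>.emeasure_eq_measure ennreal_le_iff flip: \<open>ennreal a = _\<close> \<open>ennreal b = _\<close> ennreal_plus)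
qed

text \<open>Enlarging \<open>B\<close> to an open set only increases the left side, so outer
  regularity is applied just to the two measures on the right, at a cost of e/2 for each.\<close>

lemma emeasure_le_bounded:
  assumes B [measurable]: "B \<in> sets borel" and "bounded B"
  shows "emeasure \<mu> B + (\<integral>\<^sup>+x. indicator B x * ennreal (w x) \<partial>lborel)
    \<le> emeasure \<nu> B + (\<integral>\<^sup>+x. indicator B x * ennreal (- w x) \<partial>lborel)"
proof (rule ennreal_le_epsilon)
  fix e :: real assume "0 < e"
  obtain R where R: "B \<subseteq> ball 0 R" using bounded_subset_ballD[OF assms(2)] by blast
  have reg: "\<exists>U. open U \<and> B \<subseteq> U \<and> emeasure M U \<le> emeasure M B + ennreal (e/2)"
    if "finite_measure M" "sets M = sets borel" for M
  proof -
    interpret finite_measure M by fact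
    have "emeasure M B < emeasure M B + ennreal (e/2)"
      using \<open>0 < e\<close> by (simp add: emeasure_eq_measure ennreal_less_iff flip: ennreal_plus)
    then have "(INF U \<in> {U. B \<subseteq> U \<and> open U}. emeasure M U) < emeasure M B + ennreal (e/2)"
      using outer_regular[OF that(2) _ B] by simp
    then show ?thesis unfolding INF_less_iff by (auto intro: less_imp_le)
  qed
  \<comment> \<open>The negative part of \<open>w\<close> as a measure. The restriction to a ball
    makes it finite, which gives access to outer regularity.\<close>
  define M where "M = density lborel (\<lambda>x. indicator (ball 0 R) x * ennreal (- w x))"
  have M: "emeasure M A = (\<integral>\<^sup>+x. indicator (A \<inter> ball 0 R) x * ennreal (- w x) \<partial>lborel)" if "A \<in> sets borel" for A
    using that unfolding M_def
    by (subst emeasure_density) (auto simp: indicator_def intro!: nn_integral_cong)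
  have "finite_measure M"
  proof
    have "integrable lborel (\<lambda>x. indicator (ball 0 R) x * w x)"
      by (intro integrable_indicator_bounded) auto
    then have "(\<integral>\<^sup>+x. ennreal (- (indicator (ball 0 R) x * w x)) \<partial>lborel) \<noteq> \<infinity>"
      by (simp add: real_integrable_def)
    also have "(\<integral>\<^sup>+x. ennreal (- (indicator (ball 0 R) x * w x)) \<partial>lborel) =
        (\<integral>\<^sup>+x. indicator (ball 0 R) x * ennreal (- w x) \<partial>lborel)"
      by (intro nn_integral_cong) (auto simp: indicator_def)
    finally show "emeasure M (space M) \<noteq> \<infinity>"
      using M[of UNIV] by (simp add: M_def)
  qed
  then obtain U1 where U1: "open U1" "B \<subseteq> U1" "emeasure M U1 \<le> emeasure M B + ennreal (e/2)"
    using reg[of M] by (auto simp: M_def)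
  obtain U2 where U2: "open U2" "B \<subseteq> U2" "emeasure \<nu> U2 \<le> emeasure \<nu> B + ennreal (e/2)"
    using reg[OF \<nu> sets_\<nu>] by auto
  \<comment> \<open>Intersecting the two outer approximations serves both measures at once; the ball
    keeps \<open>U\<close> bounded.\<close>
  define U where "U = U1 \<inter> U2 \<inter> ball 0 R"
  have U: "open U" "bounded U" "B \<subseteq> U"
    using U1 U2 R by (auto simp: U_def intro: bounded_subset[OF bounded_ball])
  have "emeasure \<mu> B + (\<integral>\<^sup>+x. indicator B x * ennreal (w x) \<partial>lborel)
      \<le> emeasure \<mu> U + (\<integral>\<^sup>+x. indicator U x * ennreal (w x) \<partial>lborel)"
    using U(3) U(1) sets_\<mu>
    by (intro add_mono emeasure_mono nn_integral_mono mult_right_mono) (auto simp: indicator_def)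
  also have "\<dots> \<le> emeasure \<nu> U + (\<integral>\<^sup>+x. indicator U x * ennreal (- w x) \<partial>lborel)"
    by (rule emeasure_le_open[OF U(1,2)])
  also have "\<dots> \<le> emeasure \<nu> U2 + emeasure M U1"
    using U1 U2 sets_\<nu> unfolding U_def M[OF borel_open[OF U1(1)]]
    by (intro add_mono emeasure_mono nn_integral_mono mult_right_mono) (auto simp: indicator_def)
  also have "\<dots> \<le> (emeasure \<nu> B + ennreal (e/2)) + (emeasure M B + ennreal (e/2))"
    by (intro add_mono U1 U2)
  also have "\<dots> = emeasure \<nu> B + emeasure M B + (ennreal (e/2) + ennreal (e/2))"
    by (simp add: ac_simps)
  also have "emeasure M B = (\<integral>\<^sup>+x. indicator B x * ennreal (- w x) \<partial>lborel)"
    using R by (simp add: M Int_absorb2)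
  also have "ennreal (e/2) + ennreal (e/2) = ennreal e"
    using \<open>0 < e\<close> by (simp flip: ennreal_plus)
  finally show "emeasure \<mu> B + (\<integral>\<^sup>+x. indicator B x * ennreal (w x) \<partial>lborel)
    \<le> emeasure \<nu> B + (\<integral>\<^sup>+x. indicator B x * ennreal (- w x) \<partial>lborel) + ennreal e" .
qed

text \<open>Both sides are additive, positively homogeneous and continuous along increasing
  sequences in \<open>F\<close>, so the inequality for sets propagates by induction over nonnegative
  Borel functions. The factor \<open>indicator (ball 0 R)\<close> ensures that only bounded sets
  occur in the base case.\<close>

lemma nn_integral_le_bounded:
  assumes "F \<in> borel_measurable borel" and [measurable]: "ball (0::'a) R \<in> sets borel"
  shows "(\<integral>\<^sup>+x. F x * indicator (ball 0 R) x \<partial>\<mu>) + (\<integral>\<^sup>+x. F x * indicator (ball 0 R) x * ennreal (w x) \<partial>lborel)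
    \<le> (\<integral>\<^sup>+x. F x * indicator (ball 0 R) x \<partial>\<nu>) + (\<integral>\<^sup>+x. F x * indicator (ball 0 R) x * ennreal (- w x) \<partial>lborel)"
  using assms(1)
proof (induction F rule: borel_measurable_induct)
  case (cong f g)
  have "f = g" by (rule ext) (rule cong(3), simp)
  with cong(4) show ?case by (simp only:)
next
  case (set A)
  have *: "A \<inter> ball 0 R \<in> sets borel" "bounded (A \<inter> ball 0 R)"
    using set by (auto intro: bounded_subset[OF bounded_ball])
  have eq: "indicator A x * indicator (ball 0 R) x = (indicator (A \<inter> ball 0 R) x :: ennreal)" for x
    by (simp only: indicator_inter_arith)
  show ?case
    using emeasure_le_bounded[OF *] * sets_\<mu> sets_\<nu> by (simp only: eq nn_integral_indicator)
next
  case (mult u c)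
  have "(\<integral>\<^sup>+x. (c * u x) * g x \<partial>M) = c * (\<integral>\<^sup>+x. u x * g x \<partial>M)"
    if [measurable]: "g \<in> borel_measurable borel" and "sets M = sets borel" for M and g :: "'a \<Rightarrow> ennreal"
  proof -
    have "(\<lambda>x. u x * g x) \<in> borel_measurable M"
      unfolding measurable_cong_sets[OF that(2) refl] using mult(2) by measurable
    then show ?thesis by (simp add: nn_integral_cmult mult.assoc)
  qed
  then show ?case
    using mult_left_mono[OF mult.IH, of c] by (simp add: mult.assoc distrib_left sets_\<mu> sets_\<nu>)
next
  case (add u v)
  have "(\<integral>\<^sup>+x. (v x + u x) * g x \<partial>M) = (\<integral>\<^sup>+x. v x * g x \<partial>M) + (\<integral>\<^sup>+x. u x * g x \<partial>M)"
    if [measurable]: "g \<in> borel_measurable borel" and "sets M = sets borel" for M and g :: "'a \<Rightarrow> ennreal"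
  proof -
    have "(\<lambda>x. u x * g x) \<in> borel_measurable M" "(\<lambda>x. v x * g x) \<in> borel_measurable M"
      unfolding measurable_cong_sets[OF that(2) refl] using add(1,3) by measurable
    then show ?thesis by (simp add: nn_integral_add distrib_right)
  qed
  then show ?case
    using add_mono[OF add.IH] by (simp add: mult.assoc add_ac sets_\<mu> sets_\<nu>)
next
  case (seq U)
  note [measurable] = seq(1)
  have *: "(\<integral>\<^sup>+x. (SUP i. U i x) * g x \<partial>M) = (SUP i. \<integral>\<^sup>+x. U i x * g x \<partial>M)"
    if [measurable]: "g \<in> borel_measurable borel" and "sets M = sets borel" for M and g :: "'a \<Rightarrow> ennreal"
  proof -
    have m: "(\<lambda>x. U i x * g x) \<in> borel_measurable M" for i
      unfolding measurable_cong_sets[OF that(2) refl] by measurable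
    have "incseq (\<lambda>i x. U i x * g x)"
      using seq(3) by (auto simp: incseq_def le_fun_def intro!: mult_right_mono)
    from nn_integral_monotone_convergence_SUP[OF this m] show ?thesis
      by (simp only: SUP_mult_right_ennreal)
  qed
  have inc: "incseq (\<lambda>i. \<integral>\<^sup>+x. U i x * g x \<partial>M)" for M :: "'a measure" and g :: "'a \<Rightarrow> ennreal"
    using seq(3) by (auto simp: incseq_def le_fun_def intro!: mult_right_mono nn_integral_mono)
  have "(SUP i. \<integral>\<^sup>+x. U i x * g1 x \<partial>\<mu>) + (SUP i. \<integral>\<^sup>+x. U i x * g2 x \<partial>lborel)
      = (SUP i. (\<integral>\<^sup>+x. U i x * g1 x \<partial>\<mu>) + (\<integral>\<^sup>+x. U i x * g2 x \<partial>lborel))"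
    "(SUP i. \<integral>\<^sup>+x. U i x * g1 x \<partial>\<nu>) + (SUP i. \<integral>\<^sup>+x. U i x * g2 x \<partial>lborel)
      = (SUP i. (\<integral>\<^sup>+x. U i x * g1 x \<partial>\<nu>) + (\<integral>\<^sup>+x. U i x * g2 x \<partial>lborel))" for g1 g2
    by (intro ennreal_SUP_add[symmetric] inc)+
  note add_SUP = this
  have m: "(indicator (ball 0 R) :: 'a \<Rightarrow> ennreal) \<in> borel_measurable borel"
    "(\<lambda>x. indicator (ball 0 R) x * ennreal (w x)) \<in> borel_measurable borel"
    "(\<lambda>x. indicator (ball 0 R) x * ennreal (- w x)) \<in> borel_measurable borel"
    by measurable
  show ?case
    unfolding mult.assoc SUP_apply *[OF m(1) sets_\<mu>] *[OF m(1) sets_\<nu>]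
      *[OF m(2) sets_lborel] *[OF m(3) sets_lborel] add_SUP
    using seq.IH by (intro SUP_mono') (simp only: mult.assoc)
qed

text \<open>
  The hypothesis says that the signed measure \<open>\<mu> - \<nu> + w dx\<close> is nonpositive on squares of test
  functions; the conclusion is the same for arbitrary \<open>F \<ge> 0\<close>, written without subtraction
  because the terms may be infinite.
\<close>

lemma nn_integral_le_of_test_squares:
  assumes [measurable]: "F \<in> borel_measurable borel"
  shows "(\<integral>\<^sup>+x. F x \<partial>\<mu>) + (\<integral>\<^sup>+x. F x * ennreal (w x) \<partial>lborel)
    \<le> (\<integral>\<^sup>+x. F x \<partial>\<nu>) + (\<integral>\<^sup>+x. F x * ennreal (- w x) \<partial>lborel)"
proof -
  have [measurable]: "ball (0::'a) (real n) \<in> sets borel" for n by simp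
  have SUP: "(SUP n. indicator (ball 0 (real n)) x :: ennreal) = 1" for x :: 'a
  proof (rule antisym)
    obtain n where "norm x < real n" using reals_Archimedean2 by blast
    then have "(1::ennreal) = indicator (ball 0 (real n)) x" by simp
    then show "1 \<le> (SUP n. indicator (ball 0 (real n)) x :: ennreal)"
      by (metis SUP_upper UNIV_I)
  qed (auto intro!: SUP_least simp: indicator_def)
  have *: "(\<integral>\<^sup>+x. G x \<partial>M) = (SUP n. \<integral>\<^sup>+x. G x * indicator (ball 0 (real n)) x \<partial>M)"
    if [measurable]: "G \<in> borel_measurable borel" and "sets M = sets borel" for M and G :: "'a \<Rightarrow> ennreal"
  proof -
    have "incseq (\<lambda>n x. G x * indicator (ball 0 (real n)) x)"
      by (auto simp: incseq_def le_fun_def indicator_def)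
    moreover have "(\<lambda>x. G x * indicator (ball 0 (real i)) x) \<in> borel_measurable M" for i
      unfolding measurable_cong_sets[OF that(2) refl] by measurable
    ultimately have "(\<integral>\<^sup>+x. (SUP n. G x * indicator (ball 0 (real n)) x) \<partial>M) =
        (SUP n. \<integral>\<^sup>+x. G x * indicator (ball 0 (real n)) x \<partial>M)"
      by (rule nn_integral_monotone_convergence_SUP)
    then show ?thesis
      by (simp only: SUP_mult_left_ennreal[symmetric] SUP mult_1_right)
  qed
  have inc: "incseq (\<lambda>n. \<integral>\<^sup>+x. G x * indicator (ball 0 (real n)) x \<partial>M)" for M :: "'a measure" and G :: "'a \<Rightarrow> ennreal"
    by (auto simp: incseq_def indicator_def intro!: nn_integral_mono)
  have swap: "F x * ennreal c * indicator S x = F x * indicator S x * ennreal c" for x c S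
    by (simp add: ac_simps)
  have m: "(\<lambda>x. F x * ennreal (w x)) \<in> borel_measurable borel"
    "(\<lambda>x. F x * ennreal (- w x)) \<in> borel_measurable borel"
    by measurable
  show ?thesis
    unfolding *[OF assms sets_\<mu>] *[OF assms sets_\<nu>] *[OF m(1) sets_lborel] *[OF m(2) sets_lborel]
      ennreal_SUP_add[OF inc inc, symmetric]
    by (intro SUP_mono') (simp only: swap nn_integral_le_bounded assms borel_open open_ball)
qed

end

text \<open>Take both measures to be zero and \<open>F\<close> the indicator of the set where
  \<open>f\<close> is positive. The negative part of \<open>f\<close> vanishes on that set, so the
  comparison says that the integral of the positive part is 0.\<close>

lemma AE_nonpos_if_test_squares_nonpos:
  fixes f :: "'a::euclidean_space \<Rightarrow> real"
  assumes [measurable]: "f \<in> borel_measurable borel" and "locally_integrable f"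
    and le: "\<And>\<eta>. \<eta> \<in> test_functions \<Longrightarrow> (\<integral>x. f x * (\<eta> x)\<^sup>2 \<partial>lborel) \<le> 0"
  shows "AE x in lborel. f x \<le> 0"
proof -
  let ?F = "\<lambda>x. indicator {x. f x > 0} x :: ennreal"
  have fin: "finite_measure (null_measure borel :: 'a measure)" by (rule finite_measureI) simp
  have "integral\<^sup>N (null_measure borel) ?F + (\<integral>\<^sup>+x. ?F x * ennreal (f x) \<partial>lborel)
    \<le> integral\<^sup>N (null_measure borel) ?F + (\<integral>\<^sup>+x. ?F x * ennreal (- f x) \<partial>lborel)"
    by (rule nn_integral_le_of_test_squares[OF fin _ fin]) (use assms in auto)
  moreover have "integral\<^sup>N (null_measure borel :: 'a measure) ?F = 0"
    by (subst nn_integral_0_iff_AE) (auto simp: AE_iff_null null_sets_def)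
  moreover have "(\<integral>\<^sup>+x. ?F x * ennreal (- f x) \<partial>lborel) = (\<integral>\<^sup>+x. 0 \<partial>(lborel :: 'a measure))"
    by (intro nn_integral_cong) (auto simp: indicator_def ennreal_neg)
  ultimately have "(\<integral>\<^sup>+x. ?F x * ennreal (f x) \<partial>lborel) = 0" by simp
  then have "AE x in lborel. ?F x * ennreal (f x) = 0"
    by (subst (asm) nn_integral_0_iff_AE) auto
  then show ?thesis by eventually_elim (auto simp: indicator_def ennreal_eq_0_iff split: if_splits)
qed

text \<open>The fundamental lemma of the calculus of variations. Squares of test functions are again
  test functions, so both \<open>f\<close> and its negative satisfy the preceding criterion.\<close>

lemma AE_eq_0_if_test_integrals_eq_0_real:
  fixes f :: "'a::euclidean_space \<Rightarrow> real"
  assumes [measurable]: "f \<in> borel_measurable borel" and "locally_integrable f"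
    and eq: "\<And>\<eta>. \<eta> \<in> test_functions \<Longrightarrow> (\<integral>x. \<eta> x * f x \<partial>lborel) = 0"
  shows "AE x in lborel. f x = 0"
proof -
  have nonpos: "AE x in lborel. s * f x \<le> 0" for s :: real
  proof (rule AE_nonpos_if_test_squares_nonpos)
    have "integrable lborel (\<lambda>x. s *\<^sub>R (indicator (cball 0 R) x *\<^sub>R f x))" for R
      using assms(2) by (simp add: locally_integrable_def)
    then show "locally_integrable (\<lambda>x. s * f x)"
      by (simp add: locally_integrable_def ac_simps)
    fix \<eta> :: "'a \<Rightarrow> real" assume \<eta>: "\<eta> \<in> test_functions"
    have "(\<integral>x. s * f x * (\<eta> x)\<^sup>2 \<partial>lborel) = s * (\<integral>x. (\<eta> x)\<^sup>2 * f x \<partial>lborel)"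
      by (simp add: mult.assoc mult.commute[of "f _"])
    also have "\<dots> = 0" using eq[OF test_functions_square[OF \<eta>]] by simp
    finally show "(\<integral>x. s * f x * (\<eta> x)\<^sup>2 \<partial>lborel) \<le> 0" by simp
  qed simp
  from nonpos[of 1] nonpos[of "-1"] show ?thesis by eventually_elim simp
qed

lemma AE_eq_0_if_test_integrals_eq_0:
  fixes f :: "'a::euclidean_space \<Rightarrow> complex"
  assumes f [measurable]: "f \<in> borel_measurable borel" and loc: "locally_integrable f"
    and eq: "\<And>\<eta>. \<eta> \<in> test_functions \<Longrightarrow> (\<integral>x. \<eta> x *\<^sub>R f x \<partial>lborel) = 0"
  shows "AE x in lborel. f x = 0"
proof -
  have *: "AE x in lborel. T (f x) = 0" if T: "bounded_linear T" for T :: "complex \<Rightarrow> real"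
  proof (rule AE_eq_0_if_test_integrals_eq_0_real)
    interpret T: bounded_linear T by fact
    have [measurable]: "T \<in> borel_measurable borel"
      by (intro borel_measurable_continuous_onI) (simp add: T.continuous_on)
    show "(\<lambda>x. T (f x)) \<in> borel_measurable borel" by simp
    have "integrable lborel (\<lambda>x. T (indicator (cball 0 R) x *\<^sub>R f x))" for R
      using loc by (intro integrable_bounded_linear[OF T]) (simp add: locally_integrable_def)
    then show "locally_integrable (\<lambda>x. T (f x))"
      by (simp add: locally_integrable_def T.scaleR)
    fix \<eta> :: "'a \<Rightarrow> real" assume \<eta>: "\<eta> \<in> test_functions"
    have "(\<integral>x. \<eta> x * T (f x) \<partial>lborel) = (\<integral>x. T (\<eta> x *\<^sub>R f x) \<partial>lborel)"
      by (simp add: T.scaleR)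
    also have "\<dots> = T (\<integral>x. \<eta> x *\<^sub>R f x \<partial>lborel)"
      by (rule integral_bounded_linear[OF T locally_integrable_test[OF loc f \<eta>]])
    finally show "(\<integral>x. \<eta> x * T (f x) \<partial>lborel) = 0" using eq[OF \<eta>] by (simp add: T.zero)
  qed
  from *[OF bounded_linear_Re] *[OF bounded_linear_Im] show ?thesis
    by eventually_elim (simp add: complex_eq_iff)
qed

subsection \<open>Weak derivatives and test functions\<close>

lemma cball_borel_measurable [measurable]: "cball (c::'a::euclidean_space) r \<in> sets borel"
  by simp

section \<open>Translation invariance\<close>

lemma nn_integral_translate:
  fixes f :: "'a::euclidean_space \<Rightarrow> ennreal"
  assumes [measurable]: "f \<in> borel_measurable borel"
  shows "(\<integral>\<^sup>+x. f (x + c) \<partial>lborel) = (\<integral>\<^sup>+x. f x \<partial>lborel)"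
proof -
  have "(\<integral>\<^sup>+x. f x \<partial>distr lborel borel ((+) c)) = (\<integral>\<^sup>+x. f (c + x) \<partial>lborel)"
    by (rule nn_integral_distr) simp_all
  then show ?thesis by (simp add: lborel_distr_plus add.commute)
qed

lemma integral_translate:
  fixes f :: "'a::euclidean_space \<Rightarrow> 'b::{banach,second_countable_topology}"
  assumes [measurable]: "f \<in> borel_measurable borel"
  shows "(\<integral>x. f (x + c) \<partial>lborel) = (\<integral>x. f x \<partial>lborel)"
proof -
  have "(\<integral>x. f x \<partial>distr lborel borel ((+) c)) = (\<integral>x. f (c + x) \<partial>lborel)"
    by (rule integral_distr) simp_all
  then show ?thesis by (simp add: lborel_distr_plus add.commute)
qed

lemma integrable_translate:
  fixes f :: "'a::euclidean_space \<Rightarrow> 'b::{banach,second_countable_topology}"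
  assumes "integrable lborel f"
  shows "integrable lborel (\<lambda>x. f (x + c))"
proof -
  have "integrable (distr lborel borel ((+) c)) f"
    using assms by (simp add: lborel_distr_plus)
  then have "integrable lborel (\<lambda>x. f (c + x))"
    by (rule integrable_distr[rotated]) simp
  then show ?thesis by (simp add: add.commute)
qed

lemma locally_integrable_translate:
  fixes f :: "'a::euclidean_space \<Rightarrow> 'b::{banach,second_countable_topology}"
  assumes f [measurable]: "f \<in> borel_measurable borel" and "locally_integrable f"
  shows "locally_integrable (\<lambda>x. f (x + c))"
  unfolding locally_integrable_def
proof
  fix R
  have [measurable]: "(\<lambda>x. f (x + c)) \<in> borel_measurable borel" by measurable
  have "integrable lborel (\<lambda>x. indicator (cball 0 (R + norm c)) (x + c) *\<^sub>R f (x + c))"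
    using assms(2) by (intro integrable_translate[where c = c]) (simp add: locally_integrable_def)
  then show "integrable lborel (\<lambda>x. indicator (cball 0 R) x *\<^sub>R f (x + c))"
  proof (rule Bochner_Integration.integrable_bound)
    have "norm (x + c) \<le> R + norm c" if "norm x \<le> R" for x
      using norm_triangle_ineq[of x c] that by linarith
    then show "AE x in lborel. norm (indicator (cball 0 R) x *\<^sub>R f (x + c))
        \<le> norm (indicator (cball 0 (R + norm c)) (x + c) *\<^sub>R f (x + c))"
      by (intro AE_I2) (auto simp: indicator_def)
  qed auto
qed

lemma test_functions_translate:
  assumes "\<eta> \<in> test_functions"
  shows "(\<lambda>x. \<eta> (x + c)) \<in> test_functions"
proof (rule test_functionI)
  show "Ck k (\<lambda>x. \<eta> (x + c))" for k
    by (intro Ck_translate test_functions_Ck assms)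
  have "bounded {x. \<eta> x \<noteq> 0}"
    using assms bounded_subset[OF compact_imp_bounded closure_subset]
    by (auto simp: test_functions_def)
  then have "bounded ((+) (- c) ` {x. \<eta> x \<noteq> 0})" by (rule bounded_translation)
  moreover have "{x. \<eta> (x + c) \<noteq> 0} \<subseteq> (+) (- c) ` {x. \<eta> x \<noteq> 0}"
  proof
    fix x assume "x \<in> {x. \<eta> (x + c) \<noteq> 0}"
    then show "x \<in> (+) (- c) ` {x. \<eta> x \<noteq> 0}" by (intro image_eqI[of _ _ "x + c"]) auto
  qed
  ultimately show "bounded {x. \<eta> (x + c) \<noteq> 0}" by (rule bounded_subset)
qed

section \<open>Difference quotients of test functions\<close>

lemma test_function_has_derivative:
  "\<eta> \<in> test_functions \<Longrightarrow> (\<eta> has_derivative (\<lambda>h. pderiv_at h \<eta> x)) (at x)"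
  using Ck_has_derivative[OF test_functions_Ck[of \<eta> "Suc 0"]] by simp

lemma test_function_line_derivative:
  assumes "\<eta> \<in> test_functions"
  shows "((\<lambda>t. \<eta> (x + t *\<^sub>R b)) has_real_derivative pderiv_at b \<eta> (x + t *\<^sub>R b)) (at t)"
proof -
  have "((\<lambda>t. \<eta> (x + t *\<^sub>R b)) has_derivative (\<lambda>h. pderiv_at (h *\<^sub>R b) \<eta> (x + t *\<^sub>R b))) (at t)"
    by (rule has_derivative_compose[OF _ test_function_has_derivative[OF assms]])
       (auto intro!: derivative_eq_intros)
  then show ?thesis
    unfolding has_field_derivative_def
    by (rule has_derivative_eq_rhs)
       (simp add: fun_eq_iff linear_cmul[OF has_derivative_linear[OF test_function_has_derivative[OF assms]]])
qed

text \<open>Off the closed support the function vanishes on an open set, hence so does its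
  derivative; the support does not grow under differentiation.\<close>

lemma test_functions_pderiv:
  assumes \<eta>: "\<eta> \<in> test_functions" and b: "b \<in> Basis"
  shows "pderiv_at b \<eta> \<in> test_functions"
proof (rule test_functionI)
  show "Ck k (pderiv_at b \<eta>)" for k
    using test_functions_Ck[OF \<eta>, of "Suc k"] b by simp
  have "pderiv_at b \<eta> x = 0" if "x \<notin> closure {x. \<eta> x \<noteq> 0}" for x
  proof (rule pderiv_at_eq)
    have "((\<lambda>_. 0) has_derivative (\<lambda>_. 0 :: real)) (at x)" by simp
    then show "(\<eta> has_derivative (\<lambda>_. 0)) (at x)"
    proof (rule has_derivative_transform_within_open)
      show "open (- closure {x. \<eta> x \<noteq> 0})" by (intro open_Compl closed_closure)
      show "0 = \<eta> y" if "y \<in> - closure {x. \<eta> x \<noteq> 0}" for y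
        using that closure_subset[of "{x. \<eta> x \<noteq> 0}"] by auto
    qed (use that in auto)
  qed
  then have "{x. pderiv_at b \<eta> x \<noteq> 0} \<subseteq> closure {x. \<eta> x \<noteq> 0}" by auto
  then show "bounded {x. pderiv_at b \<eta> x \<noteq> 0}"
    using \<eta> by (auto simp: test_functions_def intro: bounded_subset compact_imp_bounded)
qed

text \<open>The mean value inequality gives the factor \<open>\<bar>h\<bar>\<close>. Enlarging the
  radius by 1 absorbs every shift with \<open>\<bar>h\<bar> \<le> 1\<close>, so one majorant
  dominates all difference quotients at once.\<close>

lemma test_function_increment_bound:
  fixes \<eta> :: "'a::euclidean_space \<Rightarrow> real"
  assumes \<eta>: "\<eta> \<in> test_functions" and b: "b \<in> Basis"
  obtains C R where "0 \<le> C"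
    "\<And>h x. \<bar>h\<bar> \<le> 1 \<Longrightarrow> \<bar>\<eta> (x + h *\<^sub>R b) - \<eta> x\<bar> \<le> C * \<bar>h\<bar> * indicator (cball 0 R) x"
proof -
  obtain C0 R where R: "\<And>x. \<bar>\<eta> x\<bar> \<le> C0 * indicator (cball 0 R) x"
    by (rule test_function_bounded[OF \<eta>]) (rule that)
  obtain C R' where C: "0 \<le> C" "\<And>x. \<bar>pderiv_at b \<eta> x\<bar> \<le> C * indicator (cball 0 R') x"
    by (rule test_function_bounded[OF test_functions_pderiv[OF \<eta> b]]) (rule that)
  have C': "norm (pderiv_at b \<eta> x) \<le> C" for x
    using order_trans[OF C(2)[of x], of C] C(1) by (auto simp: indicator_def)
  have "\<bar>\<eta> (x + h *\<^sub>R b) - \<eta> x\<bar> \<le> C * \<bar>h\<bar> * indicator (cball 0 (R + 1)) x" if "\<bar>h\<bar> \<le> 1" for h x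
  proof (cases "norm x \<le> R + 1")
    case True
    have "norm (\<eta> (x + h *\<^sub>R b) - \<eta> (x + 0 *\<^sub>R b)) \<le> C * norm (h - 0)"
      by (rule field_differentiable_bound[of UNIV "\<lambda>t. \<eta> (x + t *\<^sub>R b)" "\<lambda>t. pderiv_at b \<eta> (x + t *\<^sub>R b)"])
         (auto intro!: has_field_derivative_at_within test_function_line_derivative \<eta> C'[unfolded real_norm_def])
    then show ?thesis using True by simp
  next
    case False
    have "norm (h *\<^sub>R b) \<le> 1" using that b by simp
    then have "\<not> norm (x + h *\<^sub>R b) \<le> R"
      using norm_triangle_ineq4[of "x + h *\<^sub>R b" "h *\<^sub>R b"] False by auto
    then have "\<eta> (x + h *\<^sub>R b) = 0" "\<eta> x = 0"
      using R[of x] R[of "x + h *\<^sub>R b"] False by auto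
    then show ?thesis using False by simp
  qed
  then show thesis by (rule that[OF C(1)])
qed

text \<open>Dominated convergence with the uniform majorant of the increments. The steps
  \<open>h n\<close> may have either sign; the chain rule below uses negative ones.\<close>

lemma integral_test_increment_tendsto:
  fixes f :: "'a::euclidean_space \<Rightarrow> 'b::{banach,second_countable_topology}"
  assumes \<eta>: "\<eta> \<in> test_functions" and b: "b \<in> Basis"
    and f [measurable]: "f \<in> borel_measurable borel" and loc: "locally_integrable f"
    and h: "h \<longlonglongrightarrow> 0" "\<And>n. h n \<noteq> 0" "\<And>n. \<bar>h n\<bar> \<le> 1"
  shows "(\<lambda>n. \<integral>x. ((\<eta> (x + h n *\<^sub>R b) - \<eta> x) / h n) *\<^sub>R f x \<partial>lborel)
    \<longlonglongrightarrow> (\<integral>x. pderiv_at b \<eta> x *\<^sub>R f x \<partial>lborel)"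
proof -
  obtain C R where C: "0 \<le> C"
    "\<And>h x. \<bar>h\<bar> \<le> 1 \<Longrightarrow> \<bar>\<eta> (x + h *\<^sub>R b) - \<eta> x\<bar> \<le> C * \<bar>h\<bar> * indicator (cball 0 R) x"
    by (rule test_function_increment_bound[OF \<eta> b]) (rule that)
  note [measurable] = borel_measurable_test_function[OF \<eta>]
    borel_measurable_test_function[OF test_functions_pderiv[OF \<eta> b]]
  have bound: "\<bar>(\<eta> (x + h n *\<^sub>R b) - \<eta> x) / h n\<bar> \<le> C * indicator (cball 0 R) x" for n x
    using C(2)[OF h(3)[of n], of x] h(2)[of n]
    by (simp add: abs_divide pos_divide_le_eq mult.commute mult.left_commute)
  have lim: "(\<lambda>n. (\<eta> (x + h n *\<^sub>R b) - \<eta> x) / h n) \<longlonglongrightarrow> pderiv_at b \<eta> x" for x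
  proof -
    have "((\<lambda>t. (\<eta> (x + t *\<^sub>R b) - \<eta> x) / t) \<longlongrightarrow> pderiv_at b \<eta> x) (at 0)"
      using test_function_line_derivative[OF \<eta>, of x b 0]
      by (simp add: has_field_derivative_iff)
    moreover have "filterlim h (at 0) sequentially"
      using h by (auto simp: filterlim_at)
    ultimately show ?thesis by (rule filterlim_compose)
  qed
  show ?thesis
  proof (rule integral_dominated_convergence[where w = "\<lambda>x. norm ((C * indicator (cball 0 R) x) *\<^sub>R f x)"])
    have "integrable lborel (\<lambda>x. C *\<^sub>R (indicator (cball 0 R) x *\<^sub>R f x))"
      using loc unfolding locally_integrable_def by (intro integrable_scaleR_right) blast
    then show "integrable lborel (\<lambda>x. norm ((C * indicator (cball 0 R) x) *\<^sub>R f x))"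
      by (intro integrable_norm) (simp add: mult.assoc)
    show "AE x in lborel. (\<lambda>n. ((\<eta> (x + h n *\<^sub>R b) - \<eta> x) / h n) *\<^sub>R f x) \<longlonglongrightarrow> pderiv_at b \<eta> x *\<^sub>R f x"
      by (intro AE_I2 tendsto_scaleR lim tendsto_const)
    show "AE x in lborel. norm (((\<eta> (x + h n *\<^sub>R b) - \<eta> x) / h n) *\<^sub>R f x)
        \<le> norm ((C * indicator (cball 0 R) x) *\<^sub>R f x)" for n
    proof (rule AE_I2)
      fix x
      have "\<bar>(\<eta> (x + h n *\<^sub>R b) - \<eta> x) / h n\<bar> \<le> \<bar>C * indicator (cball 0 R) x\<bar>"
        using bound[of x n] by linarith
      then show "norm (((\<eta> (x + h n *\<^sub>R b) - \<eta> x) / h n) *\<^sub>R f x)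
        \<le> norm ((C * indicator (cball 0 R) x) *\<^sub>R f x)"
        unfolding norm_scaleR by (rule mult_right_mono) simp
    qed
  qed auto
qed

lemma locally_integrable_const: "locally_integrable (\<lambda>_. c)"
  unfolding locally_integrable_def
  by (intro allI integrable_scaleR_left integrable_real_indicator) (simp_all add: emeasure_bounded_finite[OF bounded_cball, unfolded infinity_ennreal_def])

lemma integrable_test_function:
  assumes "\<eta> \<in> test_functions"
  shows "integrable lborel \<eta>"
  using locally_integrable_test[OF locally_integrable_const _ assms, of "1::real"] by simp

text \<open>By translation invariance each difference quotient has integral 0, and this passes to
  the limit. Applied to a product of test functions it becomes integration by parts.\<close>

lemma integral_pderiv_eq_0:
  fixes \<eta> :: "'a::euclidean_space \<Rightarrow> real"
  assumes \<eta>: "\<eta> \<in> test_functions" and b: "b \<in> Basis"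
  shows "(\<integral>x. pderiv_at b \<eta> x \<partial>lborel) = 0"
proof -
  have zero: "(\<integral>x. ((\<eta> (x + h *\<^sub>R b) - \<eta> x) / h) *\<^sub>R (1::real) \<partial>lborel) = 0" for h
    using integral_translate[OF borel_measurable_test_function[OF \<eta>]]
      integrable_test_function[OF \<eta>] integrable_test_function[OF test_functions_translate[OF \<eta>]]
    by simp
  have "(\<lambda>n. \<integral>x. ((\<eta> (x + inverse (real (Suc n)) *\<^sub>R b) - \<eta> x) / inverse (real (Suc n))) *\<^sub>R (1::real) \<partial>lborel)
      \<longlonglongrightarrow> (\<integral>x. pderiv_at b \<eta> x *\<^sub>R (1::real) \<partial>lborel)"
    by (rule integral_test_increment_tendsto[OF \<eta> b _ locally_integrable_const LIMSEQ_inverse_real_of_nat])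
       (auto simp: divide_simps)
  then show ?thesis by (simp only: zero LIMSEQ_const_iff) simp
qed

lemma pderiv_at_mult:
  assumes "\<eta> \<in> test_functions" "\<psi> \<in> test_functions"
  shows "pderiv_at b (\<lambda>x. \<eta> x * \<psi> x) x = pderiv_at b \<eta> x * \<psi> x + \<eta> x * pderiv_at b \<psi> x"
  by (subst pderiv_at_eq[OF has_derivative_mult[OF assms[THEN test_function_has_derivative]]]) simp

section \<open>Borel representatives, independence of the representative, and uniqueness\<close>

lemma borel_imp_lebesgue_measurable:
  "f \<in> borel_measurable borel \<Longrightarrow> f \<in> borel_measurable lebesgue"
  by (rule measurable_completion) simp

lemma has_weak_pderiv_borel_iff:
  assumes [measurable]: "f \<in> borel_measurable borel" "g \<in> borel_measurable borel" and b: "b \<in> Basis"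
  shows "has_weak_pderiv f b g \<longleftrightarrow>
    (\<forall>\<eta>\<in>test_functions. (\<integral>x. pderiv_at b \<eta> x *\<^sub>R f x \<partial>lborel) = - (\<integral>x. \<eta> x *\<^sub>R g x \<partial>lborel))"
proof -
  have "(\<integral>x. pderiv_at b \<eta> x *\<^sub>R f x \<partial>lebesgue) = (\<integral>x. pderiv_at b \<eta> x *\<^sub>R f x \<partial>lborel)"
    "(\<integral>x. \<eta> x *\<^sub>R g x \<partial>lebesgue) = (\<integral>x. \<eta> x *\<^sub>R g x \<partial>lborel)" if "\<eta> \<in> test_functions" for \<eta>
    using borel_measurable_test_function[OF that] borel_measurable_test_function[OF test_functions_pderiv[OF that b]]
    by (intro integral_completion; simp)+
  then show ?thesis unfolding has_weak_pderiv_def by auto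
qed

lemma has_weak_pderiv_cong_AE:
  assumes "AE x in lebesgue. f x = f' x" "AE x in lebesgue. g x = g' x"
    and m: "f \<in> borel_measurable lebesgue" "f' \<in> borel_measurable lebesgue"
    "g \<in> borel_measurable lebesgue" "g' \<in> borel_measurable lebesgue"
    and b: "b \<in> Basis"
  shows "has_weak_pderiv f b g \<longleftrightarrow> has_weak_pderiv f' b g'"
proof -
  have "(\<integral>x. pderiv_at b \<eta> x *\<^sub>R f x \<partial>lebesgue) = (\<integral>x. pderiv_at b \<eta> x *\<^sub>R f' x \<partial>lebesgue)"
    "(\<integral>x. \<eta> x *\<^sub>R g x \<partial>lebesgue) = (\<integral>x. \<eta> x *\<^sub>R g' x \<partial>lebesgue)" if "\<eta> \<in> test_functions" for \<eta>
  proof -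
    note [measurable] = m borel_imp_lebesgue_measurable[OF borel_measurable_test_function[OF that]]
      borel_imp_lebesgue_measurable[OF borel_measurable_test_function[OF test_functions_pderiv[OF that b]]]
    show "(\<integral>x. pderiv_at b \<eta> x *\<^sub>R f x \<partial>lebesgue) = (\<integral>x. pderiv_at b \<eta> x *\<^sub>R f' x \<partial>lebesgue)"
      by (rule integral_cong_AE) (use assms(1) in auto)
    show "(\<integral>x. \<eta> x *\<^sub>R g x \<partial>lebesgue) = (\<integral>x. \<eta> x *\<^sub>R g' x \<partial>lebesgue)"
      by (rule integral_cong_AE) (use assms(2) in auto)
  qed
  then show ?thesis unfolding has_weak_pderiv_def by auto
qed

lemma Lp_2_iff:
  "f \<in> Lp 2 \<longleftrightarrow> f \<in> borel_measurable lebesgue \<and> integrable lebesgue (\<lambda>x. (norm (f x))\<^sup>2)"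
  by (simp add: Lp_def powr_numeral)

lemma borel_Lp_2_iff:
  assumes "f \<in> borel_measurable borel"
  shows "f \<in> Lp 2 \<longleftrightarrow> integrable lborel (\<lambda>x. (norm (f x))\<^sup>2)"
  using assms by (simp add: Lp_2_iff borel_imp_lebesgue_measurable integrable_completion)

lemma lebesgue_measurable_borel_representative:
  fixes f :: "'a::euclidean_space \<Rightarrow> complex"
  assumes [measurable]: "f \<in> borel_measurable lebesgue"
  obtains f' where "f' \<in> borel_measurable borel" "AE x in lebesgue. f x = f' x"
proof -
  obtain r where r: "r \<in> borel_measurable lborel" "AE x in lborel. Re (f x) = r x"
    using completion_ex_borel_measurable_real[of "\<lambda>x. Re (f x)" lborel] by auto
  obtain i where i: "i \<in> borel_measurable lborel" "AE x in lborel. Im (f x) = i x"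
    using completion_ex_borel_measurable_real[of "\<lambda>x. Im (f x)" lborel] by auto
  show thesis
  proof (rule that[of "\<lambda>x. Complex (r x) (i x)"])
    show "(\<lambda>x. Complex (r x) (i x)) \<in> borel_measurable borel"
      using r(1) i(1) by (simp add: Complex_eq)
    from r(2) i(2) have "AE x in lborel. f x = Complex (r x) (i x)"
      by eventually_elim (simp add: complex_eq_iff)
    then show "AE x in lebesgue. f x = Complex (r x) (i x)" by (rule AE_completion)
  qed
qed

text \<open>Completeness of Lebesgue measure. The iterates of the scheme are specified only almost
  everywhere, so their measurability has to come from here.\<close>

lemma lebesgue_measurable_cong_AE:
  fixes f :: "'a::euclidean_space \<Rightarrow> complex"
  assumes f: "f \<in> borel_measurable lebesgue" and eq: "AE x in lebesgue. f x = g x"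
  shows "g \<in> borel_measurable lebesgue"
proof (rule measurableI)
  fix A :: "complex set" assume "A \<in> sets borel"
  then have sets: "f -` A \<in> sets lebesgue" using measurable_sets[OF f] by simp
  have ae: "AE x in lebesgue. x \<in> f -` A \<longleftrightarrow> x \<in> g -` A"
    using eq by eventually_elim simp
  have "g -` A \<in> sets lebesgue"
    by (rule completion.in_sets_AE[OF ae sets]) simp
  then show "g -` A \<inter> space lebesgue \<in> sets lebesgue" by simp
qed simp

lemma Lp_2_cong_AE:
  assumes "f \<in> Lp 2" "AE x in lebesgue. f x = g x" "g \<in> borel_measurable lebesgue"
  shows "g \<in> Lp 2"
proof -
  have f: "f \<in> borel_measurable lebesgue" "integrable lebesgue (\<lambda>x. (norm (f x))\<^sup>2)"
    using assms(1) by (auto simp: Lp_2_iff)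
  have "integrable lebesgue (\<lambda>x. (norm (g x))\<^sup>2)"
    by (rule integrable_cong_AE_imp[OF f(2)]) (use assms f(1) in auto)
  then show ?thesis using assms(3) by (simp add: Lp_2_iff)
qed

lemma Lp_2_borel_representative:
  fixes f :: "'a::euclidean_space \<Rightarrow> complex"
  assumes "f \<in> Lp 2"
  obtains f' where "f' \<in> borel_measurable borel" "AE x in lebesgue. f x = f' x" "f' \<in> Lp 2"
proof -
  have "f \<in> borel_measurable lebesgue" using assms by (simp add: Lp_2_iff)
  then obtain f' where f': "f' \<in> borel_measurable borel" "AE x in lebesgue. f x = f' x"
    by (rule lebesgue_measurable_borel_representative) (rule that)
  from that[OF this Lp_2_cong_AE[OF assms f'(2) borel_imp_lebesgue_measurable[OF f'(1)]]] show thesis .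
qed

text \<open>Since t is at most 1 + t^2, the sum of the indicator of the ball and the squared norm of
  \<open>f\<close> is an integrable majorant.\<close>

lemma locally_integrable_Lp_2:
  assumes [measurable]: "f \<in> borel_measurable borel" and "f \<in> Lp 2"
  shows "locally_integrable f"
  unfolding locally_integrable_def
proof
  fix R
  have "integrable lborel (\<lambda>x. indicator (cball 0 R) x *\<^sub>R (1::real))"
    using locally_integrable_const[of "1::real"] unfolding locally_integrable_def by blast
  then have "integrable lborel (\<lambda>x. indicator (cball 0 R) x *\<^sub>R 1 + (norm (f x))\<^sup>2)"
    using assms(2) by (intro Bochner_Integration.integrable_add) (simp_all add: borel_Lp_2_iff)
  then show "integrable lborel (\<lambda>x. indicator (cball 0 R) x *\<^sub>R f x)"
  proof (rule Bochner_Integration.integrable_bound)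
    have "t \<le> 1 + t\<^sup>2" for t :: real
      using sum_squares_bound[of t 1] zero_le_power2[of t] by (simp, linarith)
    then show "AE x in lborel. norm (indicator (cball 0 R) x *\<^sub>R f x)
        \<le> norm (indicator (cball 0 R) x *\<^sub>R (1::real) + (norm (f x))\<^sup>2)"
      by (intro AE_I2) (auto simp: indicator_def)
  qed auto
qed

lemma integrable_Lp_2_mult:
  fixes f g :: "'a::euclidean_space \<Rightarrow> complex"
  assumes "f \<in> Lp 2" "g \<in> Lp 2"
  shows "integrable lebesgue (\<lambda>x. f x * g x)"
proof (rule Bochner_Integration.integrable_bound)
  show "integrable lebesgue (\<lambda>x. (norm (f x))\<^sup>2 + (norm (g x))\<^sup>2)"
    using assms by (intro Bochner_Integration.integrable_add) (auto simp: Lp_2_iff)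
  show "(\<lambda>x. f x * g x) \<in> borel_measurable lebesgue"
    using assms by (auto simp: Lp_2_iff)
  have "s * t \<le> s\<^sup>2 + t\<^sup>2" for s t :: real
    using sum_squares_bound[of s t] zero_le_power2[of s] zero_le_power2[of t]
    unfolding mult.assoc by linarith
  then show "AE x in lebesgue. norm (f x * g x) \<le> norm ((norm (f x))\<^sup>2 + (norm (g x))\<^sup>2)"
    by (intro AE_I2) (simp add: norm_mult)
qed

text \<open>The difference of two candidates integrates to 0 against every test function. Because
  \<open>weak_pderiv\<close> is an arbitrary choice, every formula for it is obtained through this
  uniqueness and holds only almost everywhere.\<close>

lemma weak_pderiv_unique:
  assumes g: "g \<in> Lp 2" "has_weak_pderiv f b g" and g': "g' \<in> Lp 2" "has_weak_pderiv f b g'" and b: "b \<in> Basis"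
  shows "AE x in lebesgue. g x = g' x"
proof -
  obtain k where k: "k \<in> borel_measurable borel" "AE x in lebesgue. g x = k x" "k \<in> Lp 2"
    by (rule Lp_2_borel_representative[OF g(1)]) (rule that)
  obtain k' where k': "k' \<in> borel_measurable borel" "AE x in lebesgue. g' x = k' x" "k' \<in> Lp 2"
    by (rule Lp_2_borel_representative[OF g'(1)]) (rule that)
  note [measurable] = k(1) k'(1)
  have loc: "locally_integrable k" "locally_integrable k'"
    using k k' by (auto intro: locally_integrable_Lp_2)
  have "AE x in lborel. k x - k' x = 0"
  proof (rule AE_eq_0_if_test_integrals_eq_0)
    show "locally_integrable (\<lambda>x. k x - k' x)"
      using loc by (auto simp: locally_integrable_def scaleR_diff_right)
    fix \<eta> :: "'a \<Rightarrow> real" assume \<eta>: "\<eta> \<in> test_functions"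
    note [measurable] = borel_measurable_test_function[OF \<eta>]
    have eq: "(\<integral>x. \<eta> x *\<^sub>R g x \<partial>lebesgue) = (\<integral>x. \<eta> x *\<^sub>R g' x \<partial>lebesgue)"
      using g(2) g'(2) \<eta> by (simp add: has_weak_pderiv_def)
    have *: "(\<integral>x. \<eta> x *\<^sub>R u x \<partial>lebesgue) = (\<integral>x. \<eta> x *\<^sub>R v x \<partial>lborel)"
      if [measurable]: "u \<in> borel_measurable lebesgue" "v \<in> borel_measurable borel"
        and "AE x in lebesgue. u x = v x" for u v :: "'a \<Rightarrow> complex"
    proof -
      have "(\<integral>x. \<eta> x *\<^sub>R u x \<partial>lebesgue) = (\<integral>x. \<eta> x *\<^sub>R v x \<partial>lebesgue)"
        using that(3) borel_imp_lebesgue_measurable[OF that(2)]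
          borel_imp_lebesgue_measurable[OF borel_measurable_test_function[OF \<eta>]]
        by (intro integral_cong_AE) auto
      also have "(\<lambda>x. \<eta> x *\<^sub>R v x) \<in> borel_measurable lborel" by measurable
      from integral_completion[OF this] have "(\<integral>x. \<eta> x *\<^sub>R v x \<partial>lebesgue) = (\<integral>x. \<eta> x *\<^sub>R v x \<partial>lborel)" .
      finally show ?thesis .
    qed
    have "(\<integral>x. \<eta> x *\<^sub>R k x \<partial>lborel) = (\<integral>x. \<eta> x *\<^sub>R k' x \<partial>lborel)"
      using eq g(1) g'(1) by (simp add: *[OF _ k(1,2)] *[OF _ k'(1,2)] Lp_2_iff)
    then show "(\<integral>x. \<eta> x *\<^sub>R (k x - k' x) \<partial>lborel) = 0"
      using locally_integrable_test[OF loc(1) k(1) \<eta>] locally_integrable_test[OF loc(2) k'(1) \<eta>]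
      by (simp add: scaleR_diff_right)
  qed simp
  then have "AE x in lebesgue. k x - k' x = 0" by (rule AE_completion)
  with k(2) k'(2) show ?thesis by eventually_elim simp
qed

lemma weak_pderiv_spec:
  assumes "f \<in> H1" "b \<in> Basis"
  shows "weak_pderiv b f \<in> Lp 2" "has_weak_pderiv f b (weak_pderiv b f)"
proof -
  have "\<exists>g. g \<in> Lp 2 \<and> has_weak_pderiv f b g"
    using assms by (auto simp: H1_def)
  from someI_ex[OF this] show "weak_pderiv b f \<in> Lp 2" "has_weak_pderiv f b (weak_pderiv b f)"
    by (simp_all add: weak_pderiv_def)
qed

lemma H1_cong_AE:
  assumes f: "f \<in> H1" and eq: "AE x in lebesgue. f x = f' x" and m: "f' \<in> borel_measurable lebesgue"
  shows "f' \<in> H1"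
proof -
  have "f \<in> Lp 2" using f by (simp add: H1_def)
  moreover have "has_weak_pderiv f' b (weak_pderiv b f)" if b: "b \<in> Basis" for b
    using weak_pderiv_spec[OF f b] \<open>f \<in> Lp 2\<close> m b
    by (subst has_weak_pderiv_cong_AE[OF _ AE_I2, of f' f _ "weak_pderiv b f"])
       (use eq in \<open>auto simp: Lp_2_iff elim: eventually_mono\<close>)
  ultimately show ?thesis
    using Lp_2_cong_AE[OF _ eq m] weak_pderiv_spec(1)[OF f] by (auto simp: H1_def)
qed

text \<open>The classical derivative is a weak one, by the product rule and the vanishing integral
  of a derivative. This makes the nonpositivity of the potential on \<open>H1\<close> available for
  squares of test functions.\<close>

lemma of_real_test_function_H1:
  fixes \<psi> :: "'a::euclidean_space \<Rightarrow> real"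
  assumes \<psi>: "\<psi> \<in> test_functions"
  shows "(\<lambda>x. complex_of_real (\<psi> x)) \<in> H1"
proof -
  have L: "(\<lambda>x. complex_of_real (\<eta> x)) \<in> Lp 2" if "\<eta> \<in> test_functions" for \<eta> :: "'a \<Rightarrow> real"
    using borel_measurable_test_function[OF that] integrable_test_function[OF test_functions_square[OF that]]
    by (simp add: borel_Lp_2_iff)
  have "has_weak_pderiv (\<lambda>x. complex_of_real (\<psi> x)) b (\<lambda>x. complex_of_real (pderiv_at b \<psi> x))"
    if b: "b \<in> Basis" for b
  proof (subst has_weak_pderiv_borel_iff)
    note \<psi>' = test_functions_pderiv[OF \<psi> b]
    show "\<forall>\<eta>\<in>test_functions. (\<integral>x. pderiv_at b \<eta> x *\<^sub>R complex_of_real (\<psi> x) \<partial>lborel)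
        = - (\<integral>x. \<eta> x *\<^sub>R complex_of_real (pderiv_at b \<psi> x) \<partial>lborel)"
    proof
      fix \<eta> :: "'a \<Rightarrow> real" assume \<eta>: "\<eta> \<in> test_functions"
      note \<eta>' = test_functions_pderiv[OF \<eta> b]
      have "(\<integral>x. pderiv_at b \<eta> x * \<psi> x + \<eta> x * pderiv_at b \<psi> x \<partial>lborel) = 0"
        using integral_pderiv_eq_0[OF test_functions_mult[OF \<eta> test_functions_Ck[OF \<psi>]] b]
        by (simp add: pderiv_at_mult[OF \<eta> \<psi>])
      then have "(\<integral>x. pderiv_at b \<eta> x * \<psi> x \<partial>lborel) + (\<integral>x. \<eta> x * pderiv_at b \<psi> x \<partial>lborel) = 0"
        using integrable_test_function[OF test_functions_mult[OF \<eta>' test_functions_Ck[OF \<psi>]]]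
          integrable_test_function[OF test_functions_mult[OF \<eta> test_functions_Ck[OF \<psi>']]] by simp
      then show "(\<integral>x. pderiv_at b \<eta> x *\<^sub>R complex_of_real (\<psi> x) \<partial>lborel)
        = - (\<integral>x. \<eta> x *\<^sub>R complex_of_real (pderiv_at b \<psi> x) \<partial>lborel)"
        by (simp add: scaleR_conv_of_real eq_neg_iff_add_eq_0 flip: of_real_mult of_real_minus)
    qed
  qed (use b borel_measurable_test_function[OF \<psi>] borel_measurable_test_function[OF test_functions_pderiv[OF \<psi> b]] in auto)
  then show ?thesis
    using L[OF \<psi>] L[OF test_functions_pderiv[OF \<psi>]] by (auto simp: H1_def)
qed

subsection \<open>Continuity of translations in \<open>L\<^sup>1\<close>\<close>

definition L1_modulus :: "('a::euclidean_space \<Rightarrow> 'b::{banach,second_countable_topology}) \<Rightarrow> 'a \<Rightarrow> ennreal" where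
  "L1_modulus f c = (\<integral>\<^sup>+x. ennreal (norm (f (x + c) - f x)) \<partial>lborel)"

lemma L1_modulus_add:
  assumes [measurable]: "f \<in> borel_measurable borel" "g \<in> borel_measurable borel"
  shows "L1_modulus (\<lambda>x. f x + g x) c \<le> L1_modulus f c + L1_modulus g c"
proof -
  have [measurable]: "(\<lambda>x. f (x + c)) \<in> borel_measurable borel" "(\<lambda>x. g (x + c)) \<in> borel_measurable borel"
    by measurable
  have "L1_modulus (\<lambda>x. f x + g x) c \<le>
      (\<integral>\<^sup>+x. ennreal (norm (f (x + c) - f x)) + ennreal (norm (g (x + c) - g x)) \<partial>lborel)"
    unfolding L1_modulus_def
  proof (rule nn_integral_mono)
    fix x
    have "norm (f (x + c) + g (x + c) - (f x + g x)) \<le> norm (f (x + c) - f x) + norm (g (x + c) - g x)"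
      by (rule norm_diff_triangle_ineq)
    then show "ennreal (norm (f (x + c) + g (x + c) - (f x + g x)))
        \<le> ennreal (norm (f (x + c) - f x)) + ennreal (norm (g (x + c) - g x))"
      by (simp flip: ennreal_plus)
  qed
  also have "\<dots> = L1_modulus f c + L1_modulus g c"
    unfolding L1_modulus_def by (rule nn_integral_add) auto
  finally show ?thesis .
qed

lemma L1_modulus_le:
  assumes [measurable]: "f \<in> borel_measurable borel"
  shows "L1_modulus f c \<le> 2 * (\<integral>\<^sup>+x. ennreal (norm (f x)) \<partial>lborel)"
proof -
  have [measurable]: "(\<lambda>x. f (x + c)) \<in> borel_measurable borel"
    by measurable
  have "L1_modulus f c \<le> (\<integral>\<^sup>+x. ennreal (norm (f (x + c))) + ennreal (norm (f x)) \<partial>lborel)"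
    unfolding L1_modulus_def
    by (intro nn_integral_mono) (simp add: norm_triangle_ineq4 flip: ennreal_plus)
  also have "\<dots> = (\<integral>\<^sup>+x. ennreal (norm (f (x + c))) \<partial>lborel) + (\<integral>\<^sup>+x. ennreal (norm (f x)) \<partial>lborel)"
    by (rule nn_integral_add) auto
  also have "(\<integral>\<^sup>+x. ennreal (norm (f (x + c))) \<partial>lborel) = (\<integral>\<^sup>+x. ennreal (norm (f x)) \<partial>lborel)"
    by (rule nn_integral_translate[of "\<lambda>x. ennreal (norm (f x))"]) simp
  finally show ?thesis by (simp add: mult_2)
qed

text \<open>Outer regularity supplies \<open>U\<close> and inner regularity supplies
  \<open>K\<close>, each with half of the error.\<close>

lemma compact_open_approximation:
  fixes A :: "'a::euclidean_space set"
  assumes A [measurable]: "A \<in> sets borel" and fin: "emeasure lborel A < \<infinity>" and "0 < e"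
  obtains K U where "compact K" "open U" "K \<subseteq> A" "A \<subseteq> U" "emeasure lborel (U - K) < ennreal e"
proof -
  obtain U where U: "open U" "A \<subseteq> U" "emeasure lborel (U - A) < ennreal (e/2)"
    using outer_regular_lborel[OF A, of "e/2"] \<open>0 < e\<close> by (metis half_gt_zero)
  \<comment> \<open>Lebesgue measure restricted to \<open>A\<close> is finite, as inner regularity
    requires.\<close>
  define M where "M = density lborel (indicator A :: 'a \<Rightarrow> ennreal)"
  have M: "emeasure M B = emeasure lborel (A \<inter> B)" if [measurable]: "B \<in> sets borel" for B
    unfolding M_def by (subst emeasure_density) (auto simp flip: indicator_inter_arith)
  have M_fin: "emeasure M (space M) \<noteq> \<infinity>"
    using fin M[of UNIV] by (simp add: M_def)
  have "emeasure M A = (SUP K\<in>{K. K \<subseteq> A \<and> compact K}. emeasure M K)"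
    by (rule inner_regular[OF _ M_fin A]) (simp add: M_def)
  moreover have "emeasure M A \<noteq> \<infinity>" using fin by (simp add: M)
  ultimately have "\<exists>K\<in>{K. K \<subseteq> A \<and> compact K}. emeasure M A < emeasure M K + ennreal (e/2)"
    using \<open>0 < e\<close> by (intro SUP_approx_ennreal) (auto intro: exI[of _ "{}"])
  then obtain K where K: "K \<subseteq> A" "compact K" "emeasure lborel A < emeasure lborel K + ennreal (e/2)"
    by (auto simp: M Int_absorb1 borel_compact)
  have [measurable]: "K \<in> sets borel" "U \<in> sets borel" using K U by (auto simp: borel_compact)
  have finK: "emeasure lborel K \<noteq> \<infinity>"
    using fin emeasure_mono[OF K(1), of lborel] by (auto simp: top_unique)
  have "emeasure lborel K + emeasure lborel (A - K) = emeasure lborel A"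
    using K(1) by (subst plus_emeasure) (auto simp: Un_absorb1)
  with K(3) have "emeasure lborel (A - K) < ennreal (e/2)"
    using finK by (metis ennreal_add_left_cancel_less)
  moreover have "emeasure lborel (U - K) \<le> emeasure lborel (U - A) + emeasure lborel (A - K)"
    by (intro order_trans[OF emeasure_mono emeasure_subadditive]) auto
  ultimately have "emeasure lborel (U - K) < ennreal (e/2) + ennreal (e/2)"
    using U(3) add_strict_mono by (metis order.strict_trans1)
  then have "emeasure lborel (U - K) < ennreal e"
    using \<open>0 < e\<close> by (simp flip: ennreal_plus)
  then show thesis using that K U by blast
qed

text \<open>For the indicator of \<open>A\<close> squeezed between a compact \<open>K\<close> and an
  open \<open>U\<close>, a small shift moves \<open>K\<close> inside \<open>U\<close>; then
  \<open>A\<close> and its shift differ only within \<open>U - K\<close> and its translate.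
  Additivity and approximation in mean extend this to all integrable functions.\<close>

lemma L1_modulus_tendsto_0:
  fixes f :: "'a::euclidean_space \<Rightarrow> 'b::{banach,second_countable_topology}"
  assumes "integrable lborel f" "0 < e"
  shows "\<exists>d>0. \<forall>c. norm c < d \<longrightarrow> L1_modulus f c \<le> ennreal e"
  using assms
proof (induction f arbitrary: e rule: integrable_induct)
  case (base A v)
  \<comment> \<open>The error is incurred twice, on \<open>U - K\<close> and on its translate, and
    is multiplied by \<open>norm v\<close>. The added 1 avoids division by zero.\<close>
  define e' where "e' = e / (2 * (norm v + 1))"
  have e': "0 < e'" using base by (simp add: e'_def add_nonneg_pos)
  obtain K U where KU: "compact K" "open U" "K \<subseteq> A" "A \<subseteq> U" "emeasure lborel (U - K) < ennreal e'"
    using compact_open_approximation[of A e'] base e' by auto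
  obtain d where d: "0 < d" "(\<Union>x\<in>K. ball x d) \<subseteq> U"
    by (rule compact_subset_open_imp_ball_epsilon_subset[OF KU(1,2) order_trans[OF KU(3,4)]]) (rule that)
  have [measurable]: "K \<in> sets borel" "U \<in> sets borel" using KU by (auto simp: borel_compact)
  have "L1_modulus (\<lambda>x. indicator A x *\<^sub>R v) c \<le> ennreal e" if c: "norm c < d" for c
  proof -
    have in_U: "x + c \<in> U" "x - c \<in> U" if "x \<in> K" for x
    proof -
      have "x + c \<in> ball x d" "x - c \<in> ball x d"
        using c by (auto simp: dist_norm)
      then show "x + c \<in> U" "x - c \<in> U" using d(2) that by blast+
    qed
    have "L1_modulus (\<lambda>x. indicator A x *\<^sub>R v) c
        \<le> (\<integral>\<^sup>+x. ennreal (norm v) * (indicator (U - K) (x + c) + indicator (U - K) x) \<partial>lborel)"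
      unfolding L1_modulus_def
    proof (rule nn_integral_mono)
      fix x
      \<comment> \<open>Suppose exactly one of \<open>x\<close> and \<open>x + c\<close> lies in
        \<open>A\<close>. Either that point is outside \<open>K\<close> and so lies in
        \<open>U - K\<close>, or it is in \<open>K\<close> and the shift puts the other point into
        \<open>U\<close>, where it avoids \<open>A\<close> and hence \<open>K\<close>.\<close>
      have 1: "norm (indicator A (x + c) *\<^sub>R v - indicator A x *\<^sub>R v)
          \<le> norm v * (indicator (U - K) (x + c) + indicator (U - K) x)"
        using in_U(1)[of x] in_U(2)[of "x + c"] KU(3,4) by (auto simp: indicator_def)
      have 2: "ennreal (norm v * (indicator (U - K) (x + c) + indicator (U - K) x)) =
          ennreal (norm v) * (indicator (U - K) (x + c) + indicator (U - K) x)"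
        by (auto simp: indicator_def ennreal_mult'')
      show "ennreal (norm (indicator A (x + c) *\<^sub>R v - indicator A x *\<^sub>R v))
          \<le> ennreal (norm v) * (indicator (U - K) (x + c) + indicator (U - K) x)"
        using ennreal_leI[OF 1] unfolding 2 .
    qed
    also have "\<dots> = ennreal (norm v) * ((\<integral>\<^sup>+x. indicator (U - K) (x + c) \<partial>lborel) + (\<integral>\<^sup>+x. indicator (U - K) x \<partial>lborel))"
      by (subst nn_integral_cmult, measurable, subst nn_integral_add) measurable
    also have "(\<integral>\<^sup>+x. indicator (U - K) (x + c) \<partial>lborel) = (\<integral>\<^sup>+x. indicator (U - K) x \<partial>lborel)"
      by (rule nn_integral_translate) simp
    also have "(\<integral>\<^sup>+x. indicator (U - K) x \<partial>lborel) = emeasure lborel (U - K)"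
      by (rule nn_integral_indicator) simp
    also have "ennreal (norm v) * (emeasure lborel (U - K) + emeasure lborel (U - K))
        \<le> ennreal (norm v) * (ennreal e' + ennreal e')"
      using KU(5) by (intro mult_left_mono add_mono) auto
    also have "\<dots> = ennreal (norm v * (e' + e'))"
      using e' by (simp add: ennreal_mult' flip: ennreal_plus)
    also have "\<dots> \<le> ennreal e"
    proof (rule ennreal_leI)
      have "norm v * (e' + e') \<le> (norm v + 1) * (e' + e')"
        using e' by (intro mult_right_mono) auto
      also have "\<dots> = e"
      proof -
        have "c * (e / (2 * c) + e / (2 * c)) = e" if "c \<noteq> 0" for c :: real
          using that by (simp add: field_simps)
        moreover have "norm v + 1 \<noteq> 0" using norm_ge_zero[of v] by linarith
        ultimately show ?thesis unfolding e'_def by blast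
      qed
      finally show "norm v * (e' + e') \<le> e" .
    qed
    finally show ?thesis .
  qed
  then show ?case using d(1) by blast
next
  case (add f g)
  obtain d1 where d1: "d1 > 0" "\<And>c. norm c < d1 \<Longrightarrow> L1_modulus f c \<le> ennreal (e/2)"
    using add.IH(1)[of "e/2"] add.prems by auto
  obtain d2 where d2: "d2 > 0" "\<And>c. norm c < d2 \<Longrightarrow> L1_modulus g c \<le> ennreal (e/2)"
    using add.IH(2)[of "e/2"] add.prems by auto
  have "L1_modulus (\<lambda>x. f x + g x) c \<le> ennreal e" if "norm c < min d1 d2" for c
  proof -
    have "L1_modulus (\<lambda>x. f x + g x) c \<le> L1_modulus f c + L1_modulus g c"
      using add.hyps by (intro L1_modulus_add) auto
    also have "\<dots> \<le> ennreal (e/2) + ennreal (e/2)"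
      using that d1 d2 by (intro add_mono) auto
    also have "\<dots> = ennreal e" using add.prems by (simp flip: ennreal_plus)
    finally show ?thesis .
  qed
  then show ?case using d1 d2 by (intro exI[of _ "min d1 d2"]) auto
next
  case (lim f s)
  have [measurable]: "f \<in> borel_measurable borel" "s i \<in> borel_measurable borel" for i
    using lim.hyps by auto
  have "(\<lambda>i. \<integral>x. norm (f x - s i x) \<partial>lborel) \<longlonglongrightarrow> (\<integral>x. 0 \<partial>(lborel :: 'a measure))"
  \<comment> \<open>The approximants satisfy \<open>norm (s i x) \<le> 2 * norm (f x)\<close>,
    whence the factor 3.\<close>
  proof (rule integral_dominated_convergence[where w = "\<lambda>x. 3 * norm (f x)"])
    show "AE x in lborel. (\<lambda>i. norm (f x - s i x)) \<longlonglongrightarrow> 0"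
      using lim.hyps(2) by (intro AE_I2 tendsto_norm_zero) (auto intro!: tendsto_eq_intros)
    show "AE x in lborel. norm (norm (f x - s i x)) \<le> 3 * norm (f x)" for i
    proof (rule AE_I2)
      fix x
      show "norm (norm (f x - s i x)) \<le> 3 * norm (f x)"
        using norm_triangle_ineq4[of "f x" "s i x"] lim.hyps(3)[of x i] by simp
    qed
    show "integrable lborel (\<lambda>x. 3 * norm (f x))"
      using lim.hyps by simp
  qed auto
  then have "\<forall>\<^sub>F i in sequentially. (\<integral>x. norm (f x - s i x) \<partial>lborel) < e/4"
    using lim.prems by (intro order_tendstoD) auto
  \<comment> \<open>\<open>L1_modulus_le\<close> counts the approximation error twice, so e/4
    contributes e/2 and the approximant the other half.\<close>
  then obtain i where i: "(\<integral>x. norm (f x - s i x) \<partial>lborel) < e/4"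
    by (auto dest: eventually_happens)
  obtain d where d: "d > 0" "\<And>c. norm c < d \<Longrightarrow> L1_modulus (s i) c \<le> ennreal (e/2)"
    using lim.IH[of "e/2" i] lim.prems by auto
  have "L1_modulus f c \<le> ennreal e" if "norm c < d" for c
  proof -
    have "L1_modulus f c = L1_modulus (\<lambda>x. (f x - s i x) + s i x) c" by simp
    also have "\<dots> \<le> L1_modulus (\<lambda>x. f x - s i x) c + L1_modulus (s i) c"
      by (rule L1_modulus_add) auto
    also have "\<dots> \<le> 2 * (\<integral>\<^sup>+x. ennreal (norm (f x - s i x)) \<partial>lborel) + ennreal (e/2)"
      using that d by (intro add_mono L1_modulus_le) auto
    also have "(\<integral>\<^sup>+x. ennreal (norm (f x - s i x)) \<partial>lborel) = ennreal (\<integral>x. norm (f x - s i x) \<partial>lborel)"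
      using lim.hyps by (intro nn_integral_eq_integral) auto
    also have "2 * ennreal (\<integral>x. norm (f x - s i x) \<partial>lborel) + ennreal (e/2) \<le> 2 * ennreal (e/4) + ennreal (e/2)"
      using i by (intro add_mono mult_left_mono ennreal_leI) auto
    also have "\<dots> = ennreal e"
      using lim.prems by (simp add: mult_2 flip: ennreal_plus)
    finally show ?thesis .
  qed
  then show ?case using d by blast
qed

text \<open>Tonelli with the space integral inside: for fixed t the shift by
  \<open>t *\<^sub>R v\<close> disappears by translation invariance, leaving a bound independent of
  t on the bounded interval. All exchanges of line and space integrals below rest on this.\<close>

lemma integrable_kernel_translate:
  fixes f :: "'a::euclidean_space \<Rightarrow> 'b::{banach,second_countable_topology}" and k :: "'a \<Rightarrow> real \<Rightarrow> real"
  assumes f [measurable]: "f \<in> borel_measurable borel" and loc: "locally_integrable f"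
    and k [measurable]: "case_prod k \<in> borel_measurable (borel \<Otimes>\<^sub>M borel)"
    and bound: "\<And>x t. \<bar>k x t\<bar> \<le> C * indicator (cball 0 R) x * indicator {0..h} t"
  shows "integrable (lborel \<Otimes>\<^sub>M lborel) (\<lambda>(x, t). k x t *\<^sub>R f (x + t *\<^sub>R v))"
proof (rule integrableI_bounded)
  have [measurable]: "(\<lambda>(x, t). f (x + t *\<^sub>R v)) \<in> borel_measurable (borel \<Otimes>\<^sub>M borel)"
    by measurable
  show m: "(\<lambda>(x, t). k x t *\<^sub>R f (x + t *\<^sub>R v)) \<in> borel_measurable (lborel \<Otimes>\<^sub>M lborel)"
    by measurable
  \<comment> \<open>This radius covers \<open>x + t *\<^sub>R v\<close> for all x in the ball of
    radius \<open>R\<close> and all t in \<open>{0..h}\<close>.\<close>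
  define S where "S = R + \<bar>h\<bar> * norm v"
  define J where "J = (\<integral>\<^sup>+y. ennreal (norm (indicator (cball 0 S) y *\<^sub>R f y)) \<partial>lborel)"
  have J: "J < \<infinity>"
    using loc by (simp add: locally_integrable_def integrable_iff_bounded J_def)
  have "(\<integral>\<^sup>+p. ennreal (norm (case p of (x, t) \<Rightarrow> k x t *\<^sub>R f (x + t *\<^sub>R v))) \<partial>(lborel \<Otimes>\<^sub>M lborel))
      = (\<integral>\<^sup>+t. (\<integral>\<^sup>+x. ennreal (norm (k x t *\<^sub>R f (x + t *\<^sub>R v))) \<partial>lborel) \<partial>lborel)"
    using m by (subst lborel_pair.nn_integral_snd[symmetric]) auto
  also have "\<dots> \<le> (\<integral>\<^sup>+t. (ennreal C * J) * indicator {0..h} t \<partial>lborel)"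
  proof (rule nn_integral_mono)
    fix t
    have "(\<integral>\<^sup>+x. ennreal (norm (k x t *\<^sub>R f (x + t *\<^sub>R v))) \<partial>lborel)
        \<le> (\<integral>\<^sup>+x. ennreal C * indicator {0..h} t *
              ennreal (norm (indicator (cball 0 S) (x + t *\<^sub>R v) *\<^sub>R f (x + t *\<^sub>R v))) \<partial>lborel)"
    proof (rule nn_integral_mono)
      fix x
      show "ennreal (norm (k x t *\<^sub>R f (x + t *\<^sub>R v)))
          \<le> ennreal C * indicator {0..h} t *
              ennreal (norm (indicator (cball 0 S) (x + t *\<^sub>R v) *\<^sub>R f (x + t *\<^sub>R v)))"
      proof (cases "x \<in> cball 0 R \<and> t \<in> {0..h}")
        case True
        have "norm (x + t *\<^sub>R v) \<le> norm x + \<bar>t\<bar> * norm v"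
          using norm_triangle_ineq[of x "t *\<^sub>R v"] by simp
        also have "\<dots> \<le> S" using True by (auto simp: S_def intro!: add_mono mult_right_mono)
        finally have "norm (x + t *\<^sub>R v) \<le> S" .
        moreover have "\<bar>k x t\<bar> \<le> C" using bound[of x t] True by simp
        then have "ennreal (\<bar>k x t\<bar> * norm (f (x + t *\<^sub>R v))) \<le> ennreal (C * norm (f (x + t *\<^sub>R v)))"
          by (intro ennreal_leI mult_right_mono) auto
        ultimately show ?thesis using True by (simp add: ennreal_mult'')
      next
        case False
        then have "k x t = 0" using bound[of x t] by (auto simp: indicator_def)
        then show ?thesis by simp
      qed
    qed
    also have "\<dots> = ennreal C * indicator {0..h} t *
        (\<integral>\<^sup>+x. ennreal (norm (indicator (cball 0 S) (x + t *\<^sub>R v) *\<^sub>R f (x + t *\<^sub>R v))) \<partial>lborel)"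
      by (intro nn_integral_cmult) measurable
    also have "(\<integral>\<^sup>+x. ennreal (norm (indicator (cball 0 S) (x + t *\<^sub>R v) *\<^sub>R f (x + t *\<^sub>R v))) \<partial>lborel) = J"
      unfolding J_def by (rule nn_integral_translate) measurable
    finally show "(\<integral>\<^sup>+x. ennreal (norm (k x t *\<^sub>R f (x + t *\<^sub>R v))) \<partial>lborel)
        \<le> (ennreal C * J) * indicator {0..h} t" by (simp add: mult_ac)
  qed
  also have "\<dots> = ennreal C * J * emeasure lborel {0..h}"
    by (intro nn_integral_cmult_indicator) simp
  also have "\<dots> < \<infinity>"
  proof -
    have "emeasure lborel {0..h} < \<infinity>" by (intro emeasure_bounded_finite bounded_closed_interval)
    then show ?thesis using J by (auto simp: ennreal_mult_less_top)
  qed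
  finally show "(\<integral>\<^sup>+p. ennreal (norm (case p of (x, t) \<Rightarrow> k x t *\<^sub>R f (x + t *\<^sub>R v))) \<partial>(lborel \<Otimes>\<^sub>M lborel)) < \<infinity>" .
qed

subsection \<open>Difference quotients of weakly differentiable functions\<close>

context
  fixes f g :: "'a::euclidean_space \<Rightarrow> complex" and b :: 'a
  assumes b: "b \<in> Basis"
    and f [measurable]: "f \<in> borel_measurable borel" and floc: "locally_integrable f"
    and g [measurable]: "g \<in> borel_measurable borel" and gloc: "locally_integrable g"
    and weak: "has_weak_pderiv f b g"
begin

lemma weak_test_eq:
  "\<eta> \<in> test_functions \<Longrightarrow> (\<integral>x. pderiv_at b \<eta> x *\<^sub>R f x \<partial>lborel) = - (\<integral>x. \<eta> x *\<^sub>R g x \<partial>lborel)"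
  using weak has_weak_pderiv_borel_iff[OF f g b] by blast

lemma integrable_line_kernel:
  "integrable (lborel \<Otimes>\<^sub>M lborel)
    (\<lambda>(x, t::real). (indicator (cball 0 R) x * indicator {0..h} t) *\<^sub>R g (x + t *\<^sub>R b))"
  by (rule integrable_kernel_translate[OF g gloc, of "\<lambda>x t. indicator (cball 0 R) x * indicator {0..h} t" 1 R h])
     (auto simp: indicator_def)

text \<open>Fubini gives the claim on each ball; countably many balls exhaust the space, so the
  exceptional sets unite to a null set.\<close>

lemma AE_integrable_line:
  "AE x in lborel. integrable lborel (\<lambda>t. indicator {0..h} t *\<^sub>R g (x + t *\<^sub>R b))"
proof -
  have "AE x in lborel. \<forall>n::nat. integrable lborel
      (\<lambda>t. (indicator (cball 0 (real n)) x * indicator {0..h} t) *\<^sub>R g (x + t *\<^sub>R b))"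
    unfolding AE_all_countable
    using lborel_pair.AE_integrable_fst'[OF integrable_line_kernel] by auto
  then show ?thesis
  proof eventually_elim
    case (elim x)
    obtain n :: nat where "norm x < real n" using reals_Archimedean2 by blast
    then show ?case using elim[rule_format, of n] by simp
  qed
qed

lemma locally_integrable_line_integral:
  "locally_integrable (\<lambda>x. \<integral>t. indicator {0..h} t *\<^sub>R g (x + t *\<^sub>R b) \<partial>lborel)"
  unfolding locally_integrable_def
proof
  fix R
  have "integrable lborel (\<lambda>x. \<integral>t. (indicator (cball 0 R) x * indicator {0..h} t) *\<^sub>R g (x + t *\<^sub>R b) \<partial>lborel)"
    using lborel_pair.integrable_fst'[OF integrable_line_kernel[of R h]] by simp
  then show "integrable lborel (\<lambda>x. indicator (cball 0 R) x *\<^sub>R (\<integral>t. indicator {0..h} t *\<^sub>R g (x + t *\<^sub>R b) \<partial>lborel))"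
    by (simp only: integral_scaleR_right flip: scaleR_scaleR)
qed

text \<open>The fundamental theorem of calculus for weak derivatives along a coordinate direction,
  proved by testing. Fubini and a shift place the translation on the test function, the weak
  derivative identity moves the derivative there, and the classical theorem integrates it in t. The
  exceptional null set depends on \<open>h\<close>.\<close>

lemma AE_increment_eq_line_integral:
  assumes h: "0 \<le> h"
  shows "AE x in lborel. f (x + h *\<^sub>R b) - f x = (\<integral>t. indicator {0..h} t *\<^sub>R g (x + t *\<^sub>R b) \<partial>lborel)"
proof -
  define L where "L x = (\<integral>t. indicator {0..h} t *\<^sub>R g (x + t *\<^sub>R b) \<partial>lborel)" for x
  have [measurable]: "(\<lambda>x. f (x + h *\<^sub>R b)) \<in> borel_measurable borel" by measurable
  have [measurable]: "L \<in> borel_measurable borel"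
    unfolding L_def by measurable
  have Lloc: "locally_integrable L"
    using locally_integrable_line_integral by (simp add: L_def[abs_def])
  have fhloc: "locally_integrable (\<lambda>x. f (x + h *\<^sub>R b))"
    by (rule locally_integrable_translate[OF f floc])
  have "AE x in lborel. f (x + h *\<^sub>R b) - f x - L x = 0"
  proof (rule AE_eq_0_if_test_integrals_eq_0)
    show "locally_integrable (\<lambda>x. f (x + h *\<^sub>R b) - f x - L x)"
      using floc fhloc Lloc by (auto simp: locally_integrable_def scaleR_diff_right)
    fix \<eta> :: "'a \<Rightarrow> real" assume \<eta>: "\<eta> \<in> test_functions"
    note \<eta>' = test_functions_pderiv[OF \<eta> b]
    note [measurable] = borel_measurable_test_function[OF \<eta>] borel_measurable_test_function[OF \<eta>']
    obtain C R where C: "\<And>x. \<bar>\<eta> x\<bar> \<le> C * indicator (cball 0 R) x"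
      by (rule test_function_bounded[OF \<eta>]) (rule that)
    obtain C' R' where C': "0 \<le> C'" "\<And>x. \<bar>pderiv_at b \<eta> x\<bar> \<le> C' * indicator (cball 0 R') x"
      by (rule test_function_bounded[OF \<eta>']) (rule that)
    have "(\<integral>x. \<eta> x *\<^sub>R L x \<partial>lborel) =
        (\<integral>x. (\<integral>t. (\<eta> x * indicator {0..h} t) *\<^sub>R g (x + t *\<^sub>R b) \<partial>lborel) \<partial>lborel)"
      by (simp only: L_def integral_scaleR_right flip: scaleR_scaleR)
    also have "\<dots> = (\<integral>t. (\<integral>x. (\<eta> x * indicator {0..h} t) *\<^sub>R g (x + t *\<^sub>R b) \<partial>lborel) \<partial>lborel)"
    proof (rule lborel_pair.Fubini_integral[symmetric])
      show "integrable (lborel \<Otimes>\<^sub>M lborel) (\<lambda>(x, t). (\<eta> x * indicator {0..h} t) *\<^sub>R g (x + t *\<^sub>R b))"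
        by (rule integrable_kernel_translate[OF g gloc, of "\<lambda>x t. \<eta> x * indicator {0..h} t" C R h])
           (use C in \<open>auto simp: abs_mult indicator_def split: if_splits\<close>)
    qed
    \<comment> \<open>For each t the weak derivative identity is used with the test function
      translated by \<open>- t *\<^sub>R b\<close>.\<close>
    also have "\<dots> = (\<integral>t. (\<integral>x. (- indicator {0..h} t * pderiv_at b \<eta> (x - t *\<^sub>R b)) *\<^sub>R f x \<partial>lborel) \<partial>lborel)"
    proof (rule Bochner_Integration.integral_cong[OF refl])
      fix t :: real
      have [measurable]: "(\<lambda>x. \<eta> (x - t *\<^sub>R b)) \<in> borel_measurable borel" by measurable
      have "(\<integral>x. \<eta> x *\<^sub>R g (x + t *\<^sub>R b) \<partial>lborel) = (\<integral>x. \<eta> (x - t *\<^sub>R b) *\<^sub>R g x \<partial>lborel)"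
        using integral_translate[of "\<lambda>x. \<eta> (x - t *\<^sub>R b) *\<^sub>R g x" "t *\<^sub>R b"] by simp
      also have "\<dots> = - (\<integral>x. pderiv_at b \<eta> (x - t *\<^sub>R b) *\<^sub>R f x \<partial>lborel)"
        using weak_test_eq[OF test_functions_translate[OF \<eta>, of "- t *\<^sub>R b"]]
          pderiv_at_translate[OF test_functions_Ck[OF \<eta>], where b = b and c = "- t *\<^sub>R b"] by simp
      finally show "(\<integral>x. (\<eta> x * indicator {0..h} t) *\<^sub>R g (x + t *\<^sub>R b) \<partial>lborel)
        = (\<integral>x. (- indicator {0..h} t * pderiv_at b \<eta> (x - t *\<^sub>R b)) *\<^sub>R f x \<partial>lborel)"
        by (simp add: indicator_def)
    qed
    also have "\<dots> = (\<integral>x. (\<integral>t. (- indicator {0..h} t * pderiv_at b \<eta> (x - t *\<^sub>R b)) *\<^sub>R f x \<partial>lborel) \<partial>lborel)"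
    proof (rule lborel_pair.Fubini_integral)
      have [measurable]: "(\<lambda>(x, t). pderiv_at b \<eta> (x - t *\<^sub>R b)) \<in> borel_measurable (borel \<Otimes>\<^sub>M borel)"
        by measurable
      have "\<bar>- indicator {0..h} t * pderiv_at b \<eta> (x - t *\<^sub>R b)\<bar>
          \<le> C' * indicator (cball 0 (R' + h)) x * indicator {0..h} t" for x t
      proof (cases "t \<in> {0..h}")
        case True
        have "norm x \<le> norm (x - t *\<^sub>R b) + h"
          using norm_triangle_ineq[of "x - t *\<^sub>R b" "t *\<^sub>R b"] b True by simp
        then show ?thesis
          using C'(2)[of "x - t *\<^sub>R b"] C'(1) True
          by (cases "norm (x - t *\<^sub>R b) \<le> R'"; cases "norm x \<le> R' + h") auto
      qed simp
      \<comment> \<open>The shift direction is 0 because \<open>f\<close> is evaluated at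
        \<open>x\<close> itself; the dependence on t is all in the kernel.\<close>
      from integrable_kernel_translate[OF f floc _ this, of 0]
      show "integrable (lborel \<Otimes>\<^sub>M lborel)
          (\<lambda>(x, t). (- indicator {0..h} t * pderiv_at b \<eta> (x - t *\<^sub>R b)) *\<^sub>R f x)"
        by simp
    qed
    also have "\<dots> = (\<integral>x. (\<eta> (x - h *\<^sub>R b) - \<eta> x) *\<^sub>R f x \<partial>lborel)"
    proof (rule Bochner_Integration.integral_cong[OF refl])
      fix x
      have cont: "continuous_on {0..h} (\<lambda>t. - pderiv_at b \<eta> (x + t *\<^sub>R (- b)))"
        by (intro continuous_on_minus continuous_on_compose2[OF continuous_on_test_function[OF \<eta>']])
           (auto intro!: continuous_intros)
      have "((\<lambda>t. \<eta> (x + t *\<^sub>R (- b))) has_vector_derivative - pderiv_at b \<eta> (x + t *\<^sub>R (- b))) (at t within {0..h})" for t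
      proof -
        have "pderiv_at (- b) \<eta> y = - pderiv_at b \<eta> y" for y
          using linear_neg[OF has_derivative_linear[OF test_function_has_derivative[OF \<eta>]]] by simp
        then show ?thesis
          using test_function_line_derivative[OF \<eta>, of x "- b" t]
          by (simp only: has_real_derivative_iff_has_vector_derivative has_vector_derivative_at_within)
      qed
      from integral_FTC_atLeastAtMost[OF h this cont]
      have "(\<integral>t. - indicator {0..h} t * pderiv_at b \<eta> (x - t *\<^sub>R b) \<partial>lborel) = \<eta> (x - h *\<^sub>R b) - \<eta> x"
        by simp
      moreover have "integrable lborel (\<lambda>t. - indicator {0..h} t * pderiv_at b \<eta> (x - t *\<^sub>R b))"
        using borel_integrable_compact[OF compact_Icc cont] by simp
      ultimately show "(\<integral>t. (- indicator {0..h} t * pderiv_at b \<eta> (x - t *\<^sub>R b)) *\<^sub>R f x \<partial>lborel)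
          = (\<eta> (x - h *\<^sub>R b) - \<eta> x) *\<^sub>R f x"
        by (subst integral_scaleR_left) (simp_all only:)
    qed
    also have "\<dots> = (\<integral>x. \<eta> (x - h *\<^sub>R b) *\<^sub>R f x \<partial>lborel) - (\<integral>x. \<eta> x *\<^sub>R f x \<partial>lborel)"
      using locally_integrable_test[OF floc f \<eta>]
        locally_integrable_test[OF floc f test_functions_translate[OF \<eta>, of "- h *\<^sub>R b"]]
      by (simp add: scaleR_diff_left)
    also have "(\<integral>x. \<eta> (x - h *\<^sub>R b) *\<^sub>R f x \<partial>lborel) = (\<integral>x. \<eta> x *\<^sub>R f (x + h *\<^sub>R b) \<partial>lborel)"
      using integral_translate[of "\<lambda>x. \<eta> (x - h *\<^sub>R b) *\<^sub>R f x" "h *\<^sub>R b"] by simp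
    finally show "(\<integral>x. \<eta> x *\<^sub>R (f (x + h *\<^sub>R b) - f x - L x) \<partial>lborel) = 0"
      using locally_integrable_test[OF floc f \<eta>] locally_integrable_test[OF fhloc _ \<eta>]
        locally_integrable_test[OF Lloc _ \<eta>]
      by (simp add: scaleR_diff_right)
  qed measurable
  then show ?thesis by (simp add: L_def)
qed

text \<open>The error of the difference quotient is the average over t in \<open>{0..h}\<close> of
  \<open>g (x + t *\<^sub>R b) - g x\<close>, so its mean over the ball is at most a uniform bound
  for the modulus of continuity of \<open>g\<close> in mean.\<close>

lemma difference_quotient_L1_bound:
  fixes R h :: real
  assumes h: "0 < h" "h \<le> 1" and e: "\<And>t. t \<in> {0..h} \<Longrightarrow>
      L1_modulus (\<lambda>x. indicator (cball 0 (R + 1)) x *\<^sub>R g x) (t *\<^sub>R b) \<le> ennreal e"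
  shows "(\<integral>\<^sup>+x. ennreal (norm (indicator (cball 0 R) x *\<^sub>R ((f (x + h *\<^sub>R b) - f x) /\<^sub>R h - g x))) \<partial>lborel) \<le> ennreal e"
proof -
  \<comment> \<open>The margin 1 matches \<open>h \<le> 1\<close>: on the ball of radius
    \<open>R\<close> the cutoff is invisible at all shifted points, and \<open>g'\<close> is
    globally integrable.\<close>
  define g' where "g' x = indicator (cball 0 (R + 1)) x *\<^sub>R g x" for x
  have [measurable]: "g' \<in> borel_measurable borel" unfolding g'_def by measurable
  have "AE x in lborel. ennreal (norm (indicator (cball 0 R) x *\<^sub>R ((f (x + h *\<^sub>R b) - f x) /\<^sub>R h - g x)))
      \<le> (\<integral>\<^sup>+t. ennreal (inverse h) * indicator {0..h} t * ennreal (norm (g' (x + t *\<^sub>R b) - g' x)) \<partial>lborel)"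
    using AE_increment_eq_line_integral[OF less_imp_le[OF h(1)]] AE_integrable_line[of h]
  proof eventually_elim
    case (elim x)
    show ?case
    proof (cases "x \<in> cball 0 R")
      case True
      have 1: "integrable lborel (\<lambda>t. indicator {0..h} t *\<^sub>R g x)"
        using h by (intro integrable_scaleR_left integrable_real_indicator) auto
      have "(\<integral>t. indicator {0..h} t *\<^sub>R g x \<partial>lborel) = h *\<^sub>R g x"
        using h by (subst integral_scaleR_left) auto
      then have "(f (x + h *\<^sub>R b) - f x) /\<^sub>R h - g x
          = inverse h *\<^sub>R ((\<integral>t. indicator {0..h} t *\<^sub>R g (x + t *\<^sub>R b) \<partial>lborel) - (\<integral>t. indicator {0..h} t *\<^sub>R g x \<partial>lborel))"
        using h elim(1) by (simp add: scaleR_diff_right)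
      also have "\<dots> = inverse h *\<^sub>R (\<integral>t. indicator {0..h} t *\<^sub>R (g (x + t *\<^sub>R b) - g x) \<partial>lborel)"
        using elim(2) 1 by (simp add: scaleR_diff_right)
      also have "\<dots> = inverse h *\<^sub>R (\<integral>t. indicator {0..h} t *\<^sub>R (g' (x + t *\<^sub>R b) - g' x) \<partial>lborel)"
      proof -
        have "norm (x + t *\<^sub>R b) \<le> R + 1" if "t \<in> {0..h}" for t
          using norm_triangle_ineq[of x "t *\<^sub>R b"] b that True h by auto
        then have "indicator {0..h} t *\<^sub>R (g (x + t *\<^sub>R b) - g x) = indicator {0..h} t *\<^sub>R (g' (x + t *\<^sub>R b) - g' x)" for t
          using True by (auto simp: g'_def indicator_def)
        then show ?thesis by (simp only:)
      qed
      also have "\<dots> = (\<integral>t. (inverse h * indicator {0..h} t) *\<^sub>R (g' (x + t *\<^sub>R b) - g' x) \<partial>lborel)"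
        by (simp flip: scaleR_scaleR)
      finally have eq: "(f (x + h *\<^sub>R b) - f x) /\<^sub>R h - g x = \<dots>" .
      have "ennreal (norm (\<integral>t. (inverse h * indicator {0..h} t) *\<^sub>R (g' (x + t *\<^sub>R b) - g' x) \<partial>lborel))
          \<le> (\<integral>\<^sup>+t. ennreal (norm ((inverse h * indicator {0..h} t) *\<^sub>R (g' (x + t *\<^sub>R b) - g' x))) \<partial>lborel)"
      \<comment> \<open>Without integrability the integral takes the default value 0 and the bound
        is trivial.\<close>
      proof (cases "integrable lborel (\<lambda>t. (inverse h * indicator {0..h} t) *\<^sub>R (g' (x + t *\<^sub>R b) - g' x))")
        case False
        show ?thesis by (simp only: not_integrable_integral_eq[OF False] norm_zero ennreal_0 zero_le)
      qed (rule integral_norm_bound_ennreal)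
      also have "\<dots> = (\<integral>\<^sup>+t. ennreal (inverse h) * indicator {0..h} t * ennreal (norm (g' (x + t *\<^sub>R b) - g' x)) \<partial>lborel)"
        using h by (intro nn_integral_cong) (auto simp: indicator_def ennreal_mult'')
      finally show ?thesis using True by (simp add: eq)
    qed simp
  qed
  then have "(\<integral>\<^sup>+x. ennreal (norm (indicator (cball 0 R) x *\<^sub>R ((f (x + h *\<^sub>R b) - f x) /\<^sub>R h - g x))) \<partial>lborel)
      \<le> (\<integral>\<^sup>+x. (\<integral>\<^sup>+t. ennreal (inverse h) * indicator {0..h} t * ennreal (norm (g' (x + t *\<^sub>R b) - g' x)) \<partial>lborel) \<partial>lborel)"
    by (rule nn_integral_mono_AE)
  also have "\<dots> = (\<integral>\<^sup>+t. (\<integral>\<^sup>+x. ennreal (inverse h) * indicator {0..h} t * ennreal (norm (g' (x + t *\<^sub>R b) - g' x)) \<partial>lborel) \<partial>lborel)"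
  proof (rule lborel_pair.Fubini'[symmetric])
    have [measurable]: "(\<lambda>(x, t). g' (x + t *\<^sub>R b)) \<in> borel_measurable (borel \<Otimes>\<^sub>M borel)"
      by measurable
    show "(\<lambda>(x, t). ennreal (inverse h) * indicator {0..h} t * ennreal (norm (g' (x + t *\<^sub>R b) - g' x)))
        \<in> borel_measurable (lborel \<Otimes>\<^sub>M lborel)"
      by measurable
  qed
  also have "\<dots> = (\<integral>\<^sup>+t. ennreal (inverse h) * indicator {0..h} t * L1_modulus g' (t *\<^sub>R b) \<partial>lborel)"
  proof (rule nn_integral_cong)
    fix t :: real
    have [measurable]: "(\<lambda>x. g' (x + t *\<^sub>R b)) \<in> borel_measurable borel" by measurable
    show "(\<integral>\<^sup>+x. ennreal (inverse h) * indicator {0..h} t * ennreal (norm (g' (x + t *\<^sub>R b) - g' x)) \<partial>lborel)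
        = ennreal (inverse h) * indicator {0..h} t * L1_modulus g' (t *\<^sub>R b)"
      unfolding L1_modulus_def by (rule nn_integral_cmult) measurable
  qed
  also have "\<dots> \<le> (\<integral>\<^sup>+t. ennreal (inverse h) * ennreal e * indicator {0..h} t \<partial>lborel)"
    using e by (intro nn_integral_mono) (auto simp: indicator_def g'_def[abs_def] intro!: mult_left_mono)
  also have "\<dots> = ennreal (inverse h) * ennreal e * ennreal h"
    using h by (subst nn_integral_cmult_indicator) auto
  also have "\<dots> = ennreal e"
  proof -
    have "ennreal (inverse h) * ennreal h = ennreal (inverse h * h)"
      using h by (intro ennreal_mult''[symmetric]) simp
    also have "\<dots> = 1" using h by simp
    finally show ?thesis by (simp add: mult.assoc mult.left_commute)
  qed
  finally show ?thesis .
qed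

lemma difference_quotient_tendsto_L1:
  fixes h :: "nat \<Rightarrow> real" and R :: real
  assumes h: "h \<longlonglongrightarrow> 0" "\<And>n. 0 < h n" "\<And>n. h n \<le> 1"
  defines "u \<equiv> \<lambda>n x. indicator (cball 0 R) x *\<^sub>R ((f (x + h n *\<^sub>R b) - f x) /\<^sub>R h n - g x)"
  shows "integrable lborel (u n)" "(\<lambda>n. \<integral>x. norm (u n x) \<partial>lborel) \<longlonglongrightarrow> 0"
proof -
  show int: "integrable lborel (u n)" for n
  proof -
    have "integrable lborel (\<lambda>x. inverse (h n) *\<^sub>R (indicator (cball 0 R) x *\<^sub>R f (x + h n *\<^sub>R b)
        - indicator (cball 0 R) x *\<^sub>R f x) - indicator (cball 0 R) x *\<^sub>R g x)"
      using floc gloc locally_integrable_translate[OF f floc, of "h n *\<^sub>R b"]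
      unfolding locally_integrable_def
      by (intro Bochner_Integration.integrable_diff integrable_scaleR_right) blast+
    then show ?thesis by (simp add: u_def algebra_simps)
  qed
  show "(\<lambda>n. \<integral>x. norm (u n x) \<partial>lborel) \<longlonglongrightarrow> 0"
  proof (rule LIMSEQ_I)
    fix r :: real assume r: "0 < r"
    have "integrable lborel (\<lambda>x. indicator (cball 0 (R + 1)) x *\<^sub>R g x)"
      using gloc by (simp add: locally_integrable_def)
    from L1_modulus_tendsto_0[OF this, of "r/2"] r
    obtain d where d: "d > 0" "\<And>c. norm c < d \<Longrightarrow>
        L1_modulus (\<lambda>x. indicator (cball 0 (R + 1)) x *\<^sub>R g x) c \<le> ennreal (r/2)" by auto
    obtain N where N: "\<And>n. n \<ge> N \<Longrightarrow> norm (h n) < d"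
      using LIMSEQ_D[OF h(1) d(1)] by auto
    have "norm ((\<integral>x. norm (u n x) \<partial>lborel) - 0) < r" if "n \<ge> N" for n
    proof -
      have "ennreal (\<integral>x. norm (u n x) \<partial>lborel) = (\<integral>\<^sup>+x. ennreal (norm (u n x)) \<partial>lborel)"
        using int by (intro nn_integral_eq_integral[symmetric]) auto
      also have "\<dots> \<le> ennreal (r/2)"
        unfolding u_def
      proof (rule difference_quotient_L1_bound[OF h(2,3)])
        fix t assume "t \<in> {0..h n}"
        then have "norm (t *\<^sub>R b) < d" using N[OF that] b by auto
        then show "L1_modulus (\<lambda>x. indicator (cball 0 (R + 1)) x *\<^sub>R g x) (t *\<^sub>R b) \<le> ennreal (r/2)"
          by (rule d(2))
      qed
      finally have "(\<integral>x. norm (u n x) \<partial>lborel) \<le> r/2"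
        using r by (simp add: ennreal_le_iff)
      then show ?thesis using r by (simp add: integral_nonneg_AE abs_of_nonneg)
    qed
    then show "\<exists>N. \<forall>n\<ge>N. norm ((\<integral>x. norm (u n x) \<partial>lborel) - 0) < r" by blast
  qed
qed

end

text \<open>Caratheodory's form of differentiability, a factor continuous at \<open>y\<close>,
  avoids dividing by \<open>s n - y\<close>, which may vanish for infinitely many
  \<open>n\<close>.\<close>

lemma secant_slope_tendsto:
  fixes G :: "real \<Rightarrow> real"
  assumes "(G has_real_derivative D) (at y)" and q: "(\<lambda>n. (s n - y) / h n) \<longlonglongrightarrow> q"
    and h: "h \<longlonglongrightarrow> 0" "\<And>n. h n \<noteq> (0::real)"
  shows "(\<lambda>n. (G (s n) - G y) / h n) \<longlonglongrightarrow> D * q"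
proof -
  obtain g where g: "\<And>z. G z - G y = g z * (z - y)" "isCont g y" "g y = D"
    using assms(1) unfolding CARAT_DERIV by auto
  have "(\<lambda>n. (s n - y) / h n * h n + y) \<longlonglongrightarrow> q * 0 + y"
    by (intro tendsto_intros q h)
  then have "s \<longlonglongrightarrow> y" using h(2) by simp
  then have "(\<lambda>n. g (s n)) \<longlonglongrightarrow> D"
    using isCont_tendsto_compose[OF g(2)] g(3) by blast
  from tendsto_mult[OF this q] show ?thesis by (simp add: g(1))
qed

text \<open>
  The chain rule is read off from difference quotients: those of \<open>f\<close> converge to \<open>g\<close> locally in
  \<open>L\<^sup>1\<close>, hence almost everywhere along a subsequence, and differentiability of \<open>G\<close> at the single
  point \<open>Re (f x)\<close> then suffices.
\<close>

lemma has_weak_pderiv_compose_Re: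
  fixes f g :: "'a::euclidean_space \<Rightarrow> complex" and G G' :: "real \<Rightarrow> real"
  assumes b: "b \<in> Basis"
    and f [measurable]: "f \<in> borel_measurable borel" and floc: "locally_integrable f"
    and g [measurable]: "g \<in> borel_measurable borel" and gloc: "locally_integrable g"
    and weak: "has_weak_pderiv f b g"
    and G: "\<And>t. (G has_real_derivative G' t) (at t)" "\<And>t. \<bar>G' t\<bar> \<le> 1" "G 0 = 0"
    and [measurable]: "G' \<in> borel_measurable borel"
  shows "has_weak_pderiv (\<lambda>x. complex_of_real (G (Re (f x)))) b (\<lambda>x. complex_of_real (G' (Re (f x)) * Re (g x)))"
proof -
  have Lip: "\<bar>G s - G t\<bar> \<le> \<bar>s - t\<bar>" for s t
    using field_differentiable_bound[of UNIV G G' 1 t s] G(1,2) by (auto intro: has_field_derivative_at_within)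
  have [measurable]: "G \<in> borel_measurable borel"
    by (intro borel_measurable_continuous_onI DERIV_continuous_on[of UNIV G G'] G(1)) 
  define F where "F x = G (Re (f x))" for x
  have F [measurable]: "F \<in> borel_measurable borel" unfolding F_def by measurable
  have Floc: "locally_integrable F"
    unfolding locally_integrable_def
  proof
    fix R
    have "integrable lborel (\<lambda>x. indicator (cball 0 R) x *\<^sub>R f x)"
      using floc by (simp add: locally_integrable_def)
    then show "integrable lborel (\<lambda>x. indicator (cball 0 R) x *\<^sub>R F x)"
    proof (rule Bochner_Integration.integrable_bound)
      have "\<bar>F x\<bar> \<le> norm (f x)" for x
        using Lip[of "Re (f x)" 0] abs_Re_le_cmod[of "f x"] by (simp add: F_def G(3))
      then show "AE x in lborel. norm (indicator (cball 0 R) x *\<^sub>R F x) \<le> norm (indicator (cball 0 R) x *\<^sub>R f x)"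
        by (intro AE_I2) (auto simp: indicator_def)
    qed measurable
  qed
  have main: "(\<integral>x. pderiv_at b \<eta> x * F x \<partial>lborel) = - (\<integral>x. \<eta> x * (G' (Re (f x)) * Re (g x)) \<partial>lborel)"
    if \<eta>: "\<eta> \<in> test_functions" for \<eta>
  proof -
    note [measurable] = borel_measurable_test_function[OF \<eta>]
    obtain C R where C: "0 \<le> C" "\<And>x. \<bar>\<eta> x\<bar> \<le> C * indicator (cball 0 R) x"
      by (rule test_function_bounded[OF \<eta>]) (rule that)
    define h where "h n = inverse (real (Suc n))" for n
    define u where "u n x = indicator (cball 0 R) x *\<^sub>R ((f (x + h n *\<^sub>R b) - f x) /\<^sub>R h n - g x)" for n x
    have h: "h \<longlonglongrightarrow> 0" "\<And>n. 0 < h n" "\<And>n. h n \<le> 1"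
      unfolding h_def using LIMSEQ_inverse_real_of_nat by (auto simp: divide_simps)
    have u: "integrable lborel (u n)" "(\<lambda>n. \<integral>x. norm (u n x) \<partial>lborel) \<longlonglongrightarrow> 0" for n
      unfolding u_def[abs_def]
      using difference_quotient_tendsto_L1[OF b f floc g gloc weak h, of R] by auto
    from tendsto_L1_AE_subseq[OF this] obtain r
      where r: "strict_mono r" "AE x in lborel. (\<lambda>n. u (r n) x) \<longlonglongrightarrow> 0" by blast
    define k where "k n = h (r n)" for n
    have k: "k \<longlonglongrightarrow> 0" "\<And>n. 0 < k n" "\<And>n. k n \<le> 1"
      using LIMSEQ_subseq_LIMSEQ[OF h(1) r(1)] h(2,3) by (auto simp: k_def[abs_def] o_def)
    have k0: "k n \<noteq> 0" for n using k(2)[of n] by simp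
    define y where "y n x = Re (f (x + k n *\<^sub>R b))" for n x
    \<comment> \<open>The secant slope of \<open>G\<close> between the two values of
      \<open>Re f\<close>, set to 0 where they coincide. The Lipschitz bound keeps it in
      [-1, 1].\<close>
    define m where "m n x = (if y n x = Re (f x) then 0 else (G (y n x) - F x) / (y n x - Re (f x)))" for n x
    define Q where "Q n x = (F (x + k n *\<^sub>R b) - F x) / k n" for n x
    have [measurable]: "(\<lambda>x. f (x + k n *\<^sub>R b)) \<in> borel_measurable borel"
      "(\<lambda>x. F (x + k n *\<^sub>R b)) \<in> borel_measurable borel" for n by measurable
    have [measurable]: "y n \<in> borel_measurable borel" "Q n \<in> borel_measurable borel"
      "m n \<in> borel_measurable borel" for n
      unfolding y_def[abs_def] Q_def[abs_def] m_def[abs_def] by measurable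
    have m_le: "\<bar>m n x\<bar> \<le> 1" for n x
      using Lip[of "y n x" "Re (f x)"] by (simp add: m_def F_def divide_le_eq_1)
    have dq: "(y n x - Re (f x)) / k n = Re (g x) + Re (u (r n) x)" if "x \<in> cball 0 R" for n x
      using that by (simp add: y_def u_def k_def divide_inverse_commute)
    have Q_eq: "Q n x = m n x * (Re (g x) + Re (u (r n) x))" if "x \<in> cball 0 R" for n x
      unfolding dq[OF that, symmetric] by (auto simp: Q_def m_def F_def y_def)
    \<comment> \<open>The split separates two kinds of convergence: the part with
      \<open>Re (g x)\<close> is dominated and converges pointwise, while the part with
      \<open>u\<close> tends to 0 in mean.\<close>
    have \<eta>Q: "\<eta> x * Q n x = \<eta> x * (m n x * Re (g x)) + \<eta> x * (m n x * Re (u (r n) x))" for n x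
    proof (cases "x \<in> cball 0 R")
      case False
      then show ?thesis using C(2)[of x] by simp
    qed (simp add: Q_eq algebra_simps)
    have g_bound: "\<bar>\<eta> x * (t * Re (g x))\<bar> \<le> norm (C *\<^sub>R (indicator (cball 0 R) x *\<^sub>R g x))" if "\<bar>t\<bar> \<le> 1" for t x
    proof -
      have "\<bar>t * Re (g x)\<bar> \<le> 1 * norm (g x)"
        unfolding abs_mult using that abs_Re_le_cmod by (intro mult_mono) auto
      then have "\<bar>\<eta> x\<bar> * \<bar>t * Re (g x)\<bar> \<le> (C * indicator (cball 0 R) x) * norm (g x)"
        using C by (intro mult_mono) auto
      then show ?thesis using C(1) by (simp add: abs_mult mult_ac)
    qed
    have g_int: "integrable lborel (\<lambda>x. norm (C *\<^sub>R (indicator (cball 0 R) x *\<^sub>R g x)))"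
      using gloc unfolding locally_integrable_def by (intro integrable_norm integrable_scaleR_right) blast
    have "(\<lambda>n. \<integral>x. \<eta> x * (m n x * Re (g x)) \<partial>lborel) \<longlonglongrightarrow> (\<integral>x. \<eta> x * (G' (Re (f x)) * Re (g x)) \<partial>lborel)"
    proof (rule integral_dominated_convergence[where w = "\<lambda>x. norm (C *\<^sub>R (indicator (cball 0 R) x *\<^sub>R g x))"])
      show "AE x in lborel. norm (\<eta> x * (m n x * Re (g x))) \<le> norm (C *\<^sub>R (indicator (cball 0 R) x *\<^sub>R g x))" for n
        using g_bound[OF m_le] by (intro AE_I2) (simp only: real_norm_def)
      show "AE x in lborel. (\<lambda>n. \<eta> x * (m n x * Re (g x))) \<longlonglongrightarrow> \<eta> x * (G' (Re (f x)) * Re (g x))"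
        using r(2)
      proof eventually_elim
        case (elim x)
        show ?case
        proof (cases "x \<in> cball 0 R")
          case True
          have Re_u: "(\<lambda>n. Re (u (r n) x)) \<longlonglongrightarrow> 0" using tendsto_Re[OF elim] by simp
          have "(\<lambda>n. (y n x - Re (f x)) / k n) \<longlonglongrightarrow> Re (g x)"
            unfolding dq[OF True] using tendsto_add[OF tendsto_const Re_u] by simp
          from secant_slope_tendsto[OF G(1) this k(1) k0]
          have "(\<lambda>n. Q n x) \<longlonglongrightarrow> G' (Re (f x)) * Re (g x)"
            by (simp add: Q_def F_def y_def)
          moreover have "(\<lambda>n. m n x * Re (u (r n) x)) \<longlonglongrightarrow> 0"
          proof (rule tendsto_rabs_zero_cancel, rule tendsto_sandwich[OF _ _ tendsto_const])
            show "(\<lambda>n. \<bar>Re (u (r n) x)\<bar>) \<longlonglongrightarrow> 0" using tendsto_rabs_zero[OF Re_u] .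
            show "\<forall>\<^sub>F n in sequentially. \<bar>m n x * Re (u (r n) x)\<bar> \<le> \<bar>Re (u (r n) x)\<bar>"
              using m_le[of _ x] by (intro always_eventually allI) (simp add: abs_mult mult_left_le_one_le)
          qed simp
          ultimately have "(\<lambda>n. Q n x - m n x * Re (u (r n) x)) \<longlonglongrightarrow> G' (Re (f x)) * Re (g x) - 0"
            by (rule tendsto_diff)
          \<comment> \<open>The slope alone may fail to converge because of its default value 0. Its
            product with \<open>Re (g x)\<close> converges, being \<open>Q\<close> minus a null
            sequence.\<close>
          then have "(\<lambda>n. m n x * Re (g x)) \<longlonglongrightarrow> G' (Re (f x)) * Re (g x)"
            by (simp add: Q_eq[OF True] algebra_simps)
          then show ?thesis by (rule tendsto_mult_left)
        next
          case False
          then show ?thesis using C(2)[of x] by simp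
        qed
      qed
    qed (use g_int in auto)
    moreover have "(\<lambda>n. \<integral>x. \<eta> x * (m n x * Re (u (r n) x)) \<partial>lborel) \<longlonglongrightarrow> 0"
    proof (rule Lim_null_comparison)
      show "(\<lambda>n. C * (\<integral>x. norm (u (r n) x) \<partial>lborel)) \<longlonglongrightarrow> 0"
        using tendsto_mult_right_zero[OF LIMSEQ_subseq_LIMSEQ[OF u(2) r(1)]] by (simp add: o_def)
      show "\<forall>\<^sub>F n in sequentially. norm (\<integral>x. \<eta> x * (m n x * Re (u (r n) x)) \<partial>lborel)
          \<le> C * (\<integral>x. norm (u (r n) x) \<partial>lborel)"
      proof (intro always_eventually allI)
        fix n
        have "norm (\<integral>x. \<eta> x * (m n x * Re (u (r n) x)) \<partial>lborel) \<le> (\<integral>x. norm (\<eta> x * (m n x * Re (u (r n) x))) \<partial>lborel)"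
          by (rule integral_norm_bound)
        also have "\<dots> \<le> (\<integral>x. C * norm (u (r n) x) \<partial>lborel)"
        proof (rule integral_mono')
          fix x
          have "\<bar>\<eta> x\<bar> \<le> C" using order_trans[OF C(2)[of x], of C] C(1) by (auto simp: indicator_def)
          moreover have "\<bar>m n x * Re (u (r n) x)\<bar> \<le> 1 * norm (u (r n) x)"
            unfolding abs_mult using m_le abs_Re_le_cmod by (intro mult_mono) auto
          ultimately have "\<bar>\<eta> x\<bar> * \<bar>m n x * Re (u (r n) x)\<bar> \<le> C * (1 * norm (u (r n) x))"
            using C(1) by (intro mult_mono) auto
          then show "norm (\<eta> x * (m n x * Re (u (r n) x))) \<le> C * norm (u (r n) x)"
            by (simp add: abs_mult)
        qed (use u(1) C(1) in auto)
        finally show "norm (\<integral>x. \<eta> x * (m n x * Re (u (r n) x)) \<partial>lborel) \<le> C * (\<integral>x. norm (u (r n) x) \<partial>lborel)"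
          by simp
      qed
    qed
    ultimately have sum: "(\<lambda>n. (\<integral>x. \<eta> x * (m n x * Re (g x)) \<partial>lborel) + (\<integral>x. \<eta> x * (m n x * Re (u (r n) x)) \<partial>lborel))
        \<longlonglongrightarrow> (\<integral>x. \<eta> x * (G' (Re (f x)) * Re (g x)) \<partial>lborel) + 0"
      by (rule tendsto_add)
    \<comment> \<open>Discrete integration by parts: translation invariance turns the forward
      quotient of \<open>F\<close> into a backward quotient of the test function, hence the step
      \<open>- k n\<close>.\<close>
    have eq: "(\<integral>x. \<eta> x * (m n x * Re (g x)) \<partial>lborel) + (\<integral>x. \<eta> x * (m n x * Re (u (r n) x)) \<partial>lborel)
        = - (\<integral>x. ((\<eta> (x + (- k n) *\<^sub>R b) - \<eta> x) / (- k n)) *\<^sub>R F x \<partial>lborel)" for n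
    proof -
      have i0: "integrable lborel (\<lambda>x. \<eta> x * (m n x * Re (g x)))"
        by (rule Bochner_Integration.integrable_bound[OF g_int])
           (use g_bound[OF m_le] in \<open>simp_all only: real_norm_def abs_norm_cancel AE_I2\<close>, measurable)
      have i1: "integrable lborel (\<lambda>x. \<eta> x * F x)"
        using locally_integrable_test[OF Floc F \<eta>] by simp
      have i2: "integrable lborel (\<lambda>x. \<eta> (x - k n *\<^sub>R b) * F x)"
        using locally_integrable_test[OF Floc F test_functions_translate[OF \<eta>, of "- k n *\<^sub>R b"]] by simp
      have i3: "integrable lborel (\<lambda>x. \<eta> x * F (x + k n *\<^sub>R b))"
        using locally_integrable_test[OF locally_integrable_translate[OF F Floc] _ \<eta>, of "k n *\<^sub>R b"] by simp
      have iQ: "integrable lborel (\<lambda>x. \<eta> x * Q n x)"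
      proof -
        have "integrable lborel (\<lambda>x. inverse (k n) * (\<eta> x * F (x + k n *\<^sub>R b) - \<eta> x * F x))"
          by (intro integrable_mult_right Bochner_Integration.integrable_diff i1 i3)
        then show ?thesis by (simp add: Q_def divide_inverse algebra_simps)
      qed
      have iu: "integrable lborel (\<lambda>x. \<eta> x * (m n x * Re (u (r n) x)))"
        using Bochner_Integration.integrable_diff[OF iQ i0] by (simp add: \<eta>Q)
      have "(\<integral>x. \<eta> x * (m n x * Re (g x)) \<partial>lborel) + (\<integral>x. \<eta> x * (m n x * Re (u (r n) x)) \<partial>lborel) = (\<integral>x. \<eta> x * Q n x \<partial>lborel)"
        using i0 iu by (simp add: \<eta>Q)
      also have "\<dots> = (\<integral>x. inverse (k n) * (\<eta> x * F (x + k n *\<^sub>R b) - \<eta> x * F x) \<partial>lborel)"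
        by (simp add: Q_def divide_inverse algebra_simps)
      also have "\<dots> = inverse (k n) * ((\<integral>x. \<eta> x * F (x + k n *\<^sub>R b) \<partial>lborel) - (\<integral>x. \<eta> x * F x \<partial>lborel))"
        using i1 i3 by simp
      also have "(\<integral>x. \<eta> x * F (x + k n *\<^sub>R b) \<partial>lborel) = (\<integral>x. \<eta> (x - k n *\<^sub>R b) * F x \<partial>lborel)"
        using integral_translate[of "\<lambda>x. \<eta> (x - k n *\<^sub>R b) * F x" "k n *\<^sub>R b"] by simp
      also have "inverse (k n) * ((\<integral>x. \<eta> (x - k n *\<^sub>R b) * F x \<partial>lborel) - (\<integral>x. \<eta> x * F x \<partial>lborel))
          = (\<integral>x. inverse (k n) * (\<eta> (x - k n *\<^sub>R b) * F x - \<eta> x * F x) \<partial>lborel)"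
        using i1 i2 by simp
      also have "\<dots> = (\<integral>x. - (((\<eta> (x + (- k n) *\<^sub>R b) - \<eta> x) / (- k n)) *\<^sub>R F x) \<partial>lborel)"
        by (intro Bochner_Integration.integral_cong refl) (simp add: divide_inverse algebra_simps)
      finally show ?thesis by simp
    qed
    have lim: "(\<lambda>n. - (\<integral>x. ((\<eta> (x + (- k n) *\<^sub>R b) - \<eta> x) / (- k n)) *\<^sub>R F x \<partial>lborel))
        \<longlonglongrightarrow> - (\<integral>x. pderiv_at b \<eta> x *\<^sub>R F x \<partial>lborel)"
      using k k0 tendsto_minus[OF k(1)]
      by (intro tendsto_minus integral_test_increment_tendsto[OF \<eta> b F Floc]) (auto simp: less_imp_le)
    have "(\<integral>x. \<eta> x * (G' (Re (f x)) * Re (g x)) \<partial>lborel) + 0 = - (\<integral>x. pderiv_at b \<eta> x *\<^sub>R F x \<partial>lborel)"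
      by (rule LIMSEQ_unique[OF sum[unfolded eq] lim])
    then show ?thesis by simp
  qed
  show ?thesis
  proof (subst has_weak_pderiv_borel_iff[OF _ _ b])
    show "\<forall>\<eta>\<in>test_functions. (\<integral>x. pderiv_at b \<eta> x *\<^sub>R complex_of_real (G (Re (f x))) \<partial>lborel)
        = - (\<integral>x. \<eta> x *\<^sub>R complex_of_real (G' (Re (f x)) * Re (g x)) \<partial>lborel)"
      using main by (simp add: scaleR_conv_of_real F_def flip: of_real_mult of_real_minus)
  qed measurable
qed

subsection \<open>The test function of the energy argument\<close>

lemma H1_Lp_2: "f \<in> H1 \<Longrightarrow> f \<in> Lp 2"
  by (simp add: H1_def)

lemma Lp_2_measurable: "f \<in> Lp 2 \<Longrightarrow> f \<in> borel_measurable lebesgue"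
  by (simp add: Lp_2_iff)

lemma cnj_Lp_2: "f \<in> Lp 2 \<Longrightarrow> (\<lambda>x. cnj (f x)) \<in> Lp 2"
  by (auto simp: Lp_2_iff intro: borel_measurable_continuous_on[OF continuous_on_cnj[OF continuous_on_id]])

lemma Lp_2_bound:
  assumes "f \<in> Lp 2" "g \<in> borel_measurable lebesgue" "AE x in lebesgue. norm (g x) \<le> norm (f x)"
  shows "g \<in> Lp 2"
proof -
  have "integrable lebesgue (\<lambda>x. (norm (g x))\<^sup>2)"
  proof (rule Bochner_Integration.integrable_bound)
    show "integrable lebesgue (\<lambda>x. (norm (f x))\<^sup>2)" using assms(1) by (simp add: Lp_2_iff)
    show "AE x in lebesgue. norm ((norm (g x))\<^sup>2) \<le> norm ((norm (f x))\<^sup>2)"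
      using assms(3) by eventually_elim (simp add: power_mono)
  qed (use assms(2) in simp)
  then show ?thesis using assms(2) by (simp add: Lp_2_iff)
qed

lemma integrable_test_scaleR_Lp_2:
  fixes f :: "'a::euclidean_space \<Rightarrow> complex"
  assumes "\<eta> \<in> test_functions" "f \<in> Lp 2"
  shows "integrable lebesgue (\<lambda>x. \<eta> x *\<^sub>R f x)"
  using integrable_Lp_2_mult[OF H1_Lp_2[OF of_real_test_function_H1[OF assms(1)]] assms(2)]
  by (simp add: scaleR_conv_of_real)

text \<open>Linearity is over the reals, so extraction of the imaginary part is covered as well as
  negation and complex scaling.\<close>

lemma has_weak_pderiv_bounded_linear:
  fixes T :: "complex \<Rightarrow> complex"
  assumes T: "bounded_linear T" and b: "b \<in> Basis" and fg: "f \<in> Lp 2" "g \<in> Lp 2"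
    and weak: "has_weak_pderiv f b g"
  shows "has_weak_pderiv (\<lambda>x. T (f x)) b (\<lambda>x. T (g x))"
  unfolding has_weak_pderiv_def
proof
  interpret T: bounded_linear T by fact
  have T_int: "(\<integral>x. \<eta> x *\<^sub>R T (u x) \<partial>lebesgue) = T (\<integral>x. \<eta> x *\<^sub>R u x \<partial>lebesgue)"
    if "\<eta> \<in> test_functions" "u \<in> Lp 2" for \<eta> and u :: "'a \<Rightarrow> complex"
    using integral_bounded_linear[OF T integrable_test_scaleR_Lp_2[OF that]] by (simp add: T.scaleR)
  fix \<eta> :: "'a \<Rightarrow> real" assume \<eta>: "\<eta> \<in> test_functions"
  then show "(\<integral>x. pderiv_at b \<eta> x *\<^sub>R T (f x) \<partial>lebesgue) = - (\<integral>x. \<eta> x *\<^sub>R T (g x) \<partial>lebesgue)"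
    using weak by (simp add: T_int[OF \<eta> fg(2)] T_int[OF test_functions_pderiv[OF \<eta> b] fg(1)] has_weak_pderiv_def T.neg)
qed

lemma has_weak_pderiv_add:
  assumes b: "b \<in> Basis" and "f \<in> Lp 2" "g \<in> Lp 2" "f' \<in> Lp 2" "g' \<in> Lp 2"
    and "has_weak_pderiv f b g" "has_weak_pderiv f' b g'"
  shows "has_weak_pderiv (\<lambda>x. f x + f' x) b (\<lambda>x. g x + g' x)"
  unfolding has_weak_pderiv_def
proof
  fix \<eta> :: "'a \<Rightarrow> real" assume \<eta>: "\<eta> \<in> test_functions"
  note int = integrable_test_scaleR_Lp_2[OF \<eta>] integrable_test_scaleR_Lp_2[OF test_functions_pderiv[OF \<eta> b]]
  show "(\<integral>x. pderiv_at b \<eta> x *\<^sub>R (f x + f' x) \<partial>lebesgue) = - (\<integral>x. \<eta> x *\<^sub>R (g x + g' x) \<partial>lebesgue)"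
    using assms \<eta> by (simp add: scaleR_add_right int has_weak_pderiv_def)
qed

text \<open>
  A \<open>C\<^sup>1\<close> substitute for the negative part: it vanishes exactly on \<open>[0, \<infinity>)\<close>, is nonincreasing and
  1-Lipschitz, which is all that the energy argument uses, and it spares the chain rule for the
  kink of the negative part.
\<close>

definition smooth_negpart :: "real \<Rightarrow> real" where
  "smooth_negpart t = (min t 0)\<^sup>2 / (1 + t\<^sup>2)"

text \<open>For t < 0 the quotient rule gives the numerator 2t(1 + t^2) - 2t^3 = 2t. The denominator
  in \<open>smooth_negpart\<close> is there to bound the slope, which for the plain square would
  grow linearly.\<close>

definition smooth_negpart_deriv :: "real \<Rightarrow> real" where
  "smooth_negpart_deriv t = 2 * min t 0 / (1 + t\<^sup>2)\<^sup>2"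

lemma one_plus_square_pos: "0 < 1 + (t::real)\<^sup>2"
  by (simp add: add_pos_nonneg)

lemma smooth_negpart_has_derivative:
  "(smooth_negpart has_real_derivative smooth_negpart_deriv t) (at t)"
proof -
  have sq: "((\<lambda>t::real. (min t 0)\<^sup>2) has_real_derivative 2 * min t 0) (at t)"
  proof (cases t "0::real" rule: linorder_cases)
    case less
    have "((\<lambda>t. t\<^sup>2) has_real_derivative 2 * t) (at t)" by (auto intro!: derivative_eq_intros)
    then have "((\<lambda>t::real. (min t 0)\<^sup>2) has_real_derivative 2 * t) (at t)"
      by (rule has_field_derivative_transform_within_open[where S = "{..<0}"]) (use less in auto)
    then show ?thesis using less by simp
  next
    case equal
    have "((\<lambda>h::real. (min h 0)\<^sup>2 / h) \<longlongrightarrow> 0) (at 0)"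
    proof (rule Lim_null_comparison)
      show "((\<lambda>h::real. \<bar>h\<bar>) \<longlongrightarrow> 0) (at 0)" by (intro tendsto_rabs_zero tendsto_ident_at)
      show "\<forall>\<^sub>F h in at (0::real). norm ((min h 0)\<^sup>2 / h) \<le> \<bar>h\<bar>"
        by (auto intro!: always_eventually simp: min_def power2_eq_square)
    qed
    then show ?thesis using equal by (simp add: has_field_derivative_iff)
  next
    case greater
    have "((\<lambda>t. 0) has_real_derivative 0) (at t)" by simp
    then have "((\<lambda>t::real. (min t 0)\<^sup>2) has_real_derivative 0) (at t)"
      by (rule has_field_derivative_transform_within_open[where S = "{0<..}"]) (use greater in auto)
    then show ?thesis using greater by simp
  qed
  have "((\<lambda>t::real. 1 + t\<^sup>2) has_real_derivative 2 * t) (at t)"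
    by (auto intro!: derivative_eq_intros)
  from DERIV_divide[OF sq this] one_plus_square_pos[of t]
  have "(smooth_negpart has_real_derivative
      (2 * min t 0 * (1 + t\<^sup>2) - (min t 0)\<^sup>2 * (2 * t)) / ((1 + t\<^sup>2) * (1 + t\<^sup>2))) (at t)"
    by (simp add: smooth_negpart_def[abs_def])
  also have "2 * min t 0 * (1 + t\<^sup>2) - (min t 0)\<^sup>2 * (2 * t) = 2 * min t 0"
    by (auto simp: min_def power2_eq_square algebra_simps)
  finally show ?thesis by (simp add: smooth_negpart_deriv_def power2_eq_square)
qed

lemma smooth_negpart_deriv_bounds: "smooth_negpart_deriv t \<le> 0" "\<bar>smooth_negpart_deriv t\<bar> \<le> 1"
proof -
  show "smooth_negpart_deriv t \<le> 0"
    by (auto simp: smooth_negpart_deriv_def divide_nonpos_nonneg)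
  have "\<bar>2 * min t 0\<bar> \<le> 1 + t\<^sup>2"
    using sum_squares_bound[of t 1] sum_squares_bound[of "- t" 1] by (auto simp: min_def)
  also have "\<dots> \<le> (1 + t\<^sup>2)\<^sup>2"
    using self_le_power[of "1 + t\<^sup>2" 2] by simp
  finally have "\<bar>2 * min t 0\<bar> / (1 + t\<^sup>2)\<^sup>2 \<le> 1"
    using one_plus_square_pos[of t] by (subst divide_le_eq_1_pos) simp_all
  then show "\<bar>smooth_negpart_deriv t\<bar> \<le> 1"
    unfolding smooth_negpart_deriv_def abs_divide by simp
qed

lemma smooth_negpart_bounds:
  "0 \<le> smooth_negpart t" "smooth_negpart t \<le> \<bar>t\<bar>" "smooth_negpart t = 0 \<longleftrightarrow> 0 \<le> t"
proof -
  show "0 \<le> smooth_negpart t" by (simp add: smooth_negpart_def)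
  show "smooth_negpart t = 0 \<longleftrightarrow> 0 \<le> t"
    using one_plus_square_pos[of t] by (auto simp: smooth_negpart_def min_def)
  have "\<bar>smooth_negpart t - smooth_negpart 0\<bar> \<le> 1 * \<bar>t - 0\<bar>"
    using field_differentiable_bound[of UNIV smooth_negpart smooth_negpart_deriv 1 0 t]
      smooth_negpart_has_derivative smooth_negpart_deriv_bounds(2)
    by (auto intro: has_field_derivative_at_within)
  then show "smooth_negpart t \<le> \<bar>t\<bar>" by (simp add: smooth_negpart_def)
qed

lemma borel_measurable_smooth_negpart [measurable]:
  "smooth_negpart \<in> borel_measurable borel" "smooth_negpart_deriv \<in> borel_measurable borel"
  unfolding smooth_negpart_def[abs_def] smooth_negpart_deriv_def[abs_def] by measurable

text \<open>It vanishes exactly on the nonnegative reals, so a single test function detects both a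
  negative real part and a nonzero imaginary part.\<close>

definition defect :: "complex \<Rightarrow> complex" where
  "defect z = - complex_of_real (smooth_negpart (Re z)) + \<i> * complex_of_real (Im z)"

text \<open>The real differential of \<open>defect\<close> at \<open>z\<close> in direction
  \<open>w\<close>. It is real-linear in \<open>w\<close> but in general not multiplication by a
  complex number.\<close>

definition defect_deriv :: "complex \<Rightarrow> complex \<Rightarrow> complex" where
  "defect_deriv z w = - complex_of_real (smooth_negpart_deriv (Re z) * Re w) + \<i> * complex_of_real (Im w)"

lemma defect_norm_le: "cmod (defect z) \<le> cmod z"
proof -
  have "(smooth_negpart (Re z))\<^sup>2 \<le> (Re z)\<^sup>2"
    using smooth_negpart_bounds(1,2)[of "Re z"] by (simp add: abs_le_square_iff[symmetric])
  then show ?thesis by (simp add: defect_def cmod_def)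
qed

lemma defect_deriv_norm_le: "cmod (defect_deriv z w) \<le> cmod w"
proof -
  have "\<bar>smooth_negpart_deriv (Re z) * Re w\<bar> \<le> 1 * \<bar>Re w\<bar>"
    unfolding abs_mult using smooth_negpart_deriv_bounds(2) by (intro mult_mono) auto
  then have "(smooth_negpart_deriv (Re z) * Re w)\<^sup>2 \<le> (Re w)\<^sup>2"
    by (simp add: abs_le_square_iff[symmetric])
  then show ?thesis by (simp add: defect_deriv_def cmod_def)
qed

lemma borel_measurable_defect [measurable]: "defect \<in> borel_measurable borel"
  unfolding defect_def[abs_def] by measurable

lemma borel_measurable_defect_deriv [measurable]:
  assumes [measurable]: "u \<in> borel_measurable M" "w \<in> borel_measurable M"
  shows "(\<lambda>x. defect_deriv (u x) (w x)) \<in> borel_measurable M"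
  unfolding defect_deriv_def by measurable

text \<open>The chain rule handles the real part and linearity the imaginary part. Both are carried
  out on Borel representatives and then transported back.\<close>

lemma has_weak_pderiv_defect:
  assumes u: "u \<in> Lp 2" and g: "g \<in> Lp 2" and weak: "has_weak_pderiv u b g" and b: "b \<in> Basis"
  shows "has_weak_pderiv (\<lambda>x. defect (u x)) b (\<lambda>x. defect_deriv (u x) (g x))"
proof -
  obtain v where v: "v \<in> borel_measurable borel" "AE x in lebesgue. u x = v x" "v \<in> Lp 2"
    by (rule Lp_2_borel_representative[OF u]) (rule that)
  obtain k where k: "k \<in> borel_measurable borel" "AE x in lebesgue. g x = k x" "k \<in> Lp 2"
    by (rule Lp_2_borel_representative[OF g]) (rule that)
  note [measurable] = v(1) k(1) Lp_2_measurable[OF u] Lp_2_measurable[OF g]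
    borel_imp_lebesgue_measurable[OF v(1)] borel_imp_lebesgue_measurable[OF k(1)]
  have weak': "has_weak_pderiv v b k"
    using weak has_weak_pderiv_cong_AE[OF v(2) k(2) _ _ _ _ b] by simp
  have bl: "bounded_linear (\<lambda>z. - z :: complex)" "bounded_linear (\<lambda>z. \<i> * complex_of_real (Im z))"
    by (auto intro!: bounded_linear_intros bounded_linear_minus bounded_linear_ident
        bounded_linear_const_mult bounded_linear_compose[OF bounded_linear_of_real bounded_linear_Im])
  have L: "(\<lambda>x. complex_of_real (smooth_negpart (Re (v x)))) \<in> Lp 2"
  proof (rule Lp_2_bound[OF v(3)])
    have "cmod (complex_of_real (smooth_negpart (Re (v x)))) \<le> cmod (v x)" for x
      using order_trans[OF smooth_negpart_bounds(2) abs_Re_le_cmod] smooth_negpart_bounds(1)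
      by (simp add: abs_of_nonneg)
    then show "AE x in lebesgue. cmod (complex_of_real (smooth_negpart (Re (v x)))) \<le> cmod (v x)"
      by (rule AE_I2)
  qed measurable
  have L': "(\<lambda>x. complex_of_real (smooth_negpart_deriv (Re (v x)) * Re (k x))) \<in> Lp 2"
  proof (rule Lp_2_bound[OF k(3)])
    have "cmod (complex_of_real (smooth_negpart_deriv (Re (v x)) * Re (k x))) \<le> cmod (k x)" for x
    proof -
      have "\<bar>smooth_negpart_deriv (Re (v x)) * Re (k x)\<bar> \<le> 1 * cmod (k x)"
        unfolding abs_mult using smooth_negpart_deriv_bounds(2) abs_Re_le_cmod by (intro mult_mono) auto
      then show ?thesis by (simp only: norm_of_real mult_1_left)
    qed
    then show "AE x in lebesgue. cmod (complex_of_real (smooth_negpart_deriv (Re (v x)) * Re (k x))) \<le> cmod (k x)"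
      by (rule AE_I2)
  qed measurable
  have I: "(\<lambda>x. \<i> * complex_of_real (Im (w x))) \<in> Lp 2"
    if "w \<in> Lp 2" "w \<in> borel_measurable lebesgue" for w :: "'a \<Rightarrow> complex"
  proof (rule Lp_2_bound[OF that(1)])
    note [measurable] = that(2)
    show "(\<lambda>x. \<i> * complex_of_real (Im (w x))) \<in> borel_measurable lebesgue" by measurable
    show "AE x in lebesgue. cmod (\<i> * complex_of_real (Im (w x))) \<le> cmod (w x)"
      by (rule AE_I2) (simp add: norm_mult abs_Im_le_cmod)
  qed
  have neg: "(\<lambda>x. - w x) \<in> Lp 2" if "w \<in> Lp 2" for w :: "'a \<Rightarrow> complex"
    using that by (simp add: Lp_2_iff)
  have 1: "has_weak_pderiv (\<lambda>x. complex_of_real (smooth_negpart (Re (v x)))) b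
      (\<lambda>x. complex_of_real (smooth_negpart_deriv (Re (v x)) * Re (k x)))"
    by (rule has_weak_pderiv_compose_Re[OF b v(1) _ k(1) _ weak'])
       (auto intro!: locally_integrable_Lp_2 v k smooth_negpart_has_derivative smooth_negpart_deriv_bounds
         simp: smooth_negpart_bounds)
  have "has_weak_pderiv (\<lambda>x. defect (v x)) b (\<lambda>x. defect_deriv (v x) (k x))"
    unfolding defect_def defect_deriv_def
    by (intro has_weak_pderiv_add[OF b] has_weak_pderiv_bounded_linear[OF bl(1) b L L' 1]
        has_weak_pderiv_bounded_linear[OF bl(2) b v(3) k(3) weak'] neg L L' I v(3) k(3)) measurable
  moreover have "AE x in lebesgue. defect (v x) = defect (u x)"
    using v(2) by eventually_elim simp
  moreover have "AE x in lebesgue. defect_deriv (v x) (k x) = defect_deriv (u x) (g x)"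
    using v(2) k(2) by eventually_elim simp
  ultimately show ?thesis
    by (subst (asm) has_weak_pderiv_cong_AE[OF _ _ _ _ _ _ b]) measurable
qed

text \<open>Composition with \<open>defect\<close> increases neither the modulus nor the modulus of
  any partial derivative, which gives square integrability; uniqueness then identifies the chosen
  weak derivative.\<close>

lemma
  assumes u: "u \<in> H1"
  shows defect_H1: "(\<lambda>x. defect (u x)) \<in> H1"
    and weak_pderiv_defect: "b \<in> Basis \<Longrightarrow>
      AE x in lebesgue. weak_pderiv b (\<lambda>x. defect (u x)) x = defect_deriv (u x) (weak_pderiv b u x)"
proof -
  note [measurable] = Lp_2_measurable[OF H1_Lp_2[OF u]]
  have L: "(\<lambda>x. defect_deriv (u x) (weak_pderiv b u x)) \<in> Lp 2" if "b \<in> Basis" for b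
  proof (rule Lp_2_bound[OF weak_pderiv_spec(1)[OF u that]])
    note [measurable] = Lp_2_measurable[OF weak_pderiv_spec(1)[OF u that]]
    show "(\<lambda>x. defect_deriv (u x) (weak_pderiv b u x)) \<in> borel_measurable lebesgue" by measurable
    show "AE x in lebesgue. cmod (defect_deriv (u x) (weak_pderiv b u x)) \<le> cmod (weak_pderiv b u x)"
      by (rule AE_I2) (rule defect_deriv_norm_le)
  qed
  have w: "has_weak_pderiv (\<lambda>x. defect (u x)) b (\<lambda>x. defect_deriv (u x) (weak_pderiv b u x))" if "b \<in> Basis" for b
    by (rule has_weak_pderiv_defect[OF H1_Lp_2[OF u] weak_pderiv_spec[OF u that] that])
  have "(\<lambda>x. defect (u x)) \<in> Lp 2"
  proof (rule Lp_2_bound[OF H1_Lp_2[OF u]])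
    show "AE x in lebesgue. cmod (defect (u x)) \<le> cmod (u x)"
      by (rule AE_I2) (rule defect_norm_le)
  qed measurable
  then show H: "(\<lambda>x. defect (u x)) \<in> H1"
    unfolding H1_def using L w by blast
  show "AE x in lebesgue. weak_pderiv b (\<lambda>x. defect (u x)) x = defect_deriv (u x) (weak_pderiv b u x)"
    if "b \<in> Basis"
    by (rule weak_pderiv_unique[OF weak_pderiv_spec[OF H that] L[OF that] w[OF that] that])
qed

subsection \<open>The continuous representative in dimension one\<close>

text \<open>The sign convention of the oriented interval from \<open>0\<close> to \<open>s\<close>, valid for both signs of \<open>s\<close>.\<close>

definition signed_interval :: "real \<Rightarrow> real \<Rightarrow> real" where
  "signed_interval s t = indicator {..s} t - indicator {..0} t"

definition primitive :: "(real \<Rightarrow> complex) \<Rightarrow> real \<Rightarrow> complex" where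
  "primitive g s = (\<integral>t. signed_interval s t *\<^sub>R g t \<partial>lborel)"

context
  fixes g :: "real \<Rightarrow> complex"
  assumes g [measurable]: "g \<in> borel_measurable borel" and L2: "integrable lborel (\<lambda>t. (cmod (g t))\<^sup>2)"
begin

lemma locally_integrable_L2_real: "locally_integrable g"
  by (rule locally_integrable_Lp_2[OF g]) (simp add: borel_Lp_2_iff[OF g] L2)

lemma primitive_increment:
  assumes "s \<le> s'"
  shows "primitive g s' - primitive g s = (\<integral>t. indicator {s<..s'} t *\<^sub>R g t \<partial>lborel)"
proof -
  have "integrable lborel (\<lambda>t. signed_interval s t *\<^sub>R g t)" for s
    unfolding signed_interval_def
    by (rule locally_integrable_mult_bounded[OF locally_integrable_L2_real g, of _ 1 "\<bar>s\<bar>"], measurable)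
       (auto simp: indicator_def)
  then have "primitive g s' - primitive g s
      = (\<integral>t. signed_interval s' t *\<^sub>R g t - signed_interval s t *\<^sub>R g t \<partial>lborel)"
    by (simp add: primitive_def)
  also have "\<dots> = (\<integral>t. indicator {s<..s'} t *\<^sub>R g t \<partial>lborel)"
    using assms by (intro Bochner_Integration.integral_cong refl) (auto simp: signed_interval_def indicator_def)
  finally show ?thesis .
qed

text \<open>The pointwise bound of a by e a^2 + 1/e plays the role of the Cauchy-Schwarz inequality.
  Small \<open>e\<close> gives continuity, and \<open>e = 1\<close> the bound over unit distances
  used later.\<close>

lemma primitive_modulus:
  assumes "0 < e"
  shows "cmod (primitive g s' - primitive g s) \<le> e * (\<integral>t. (cmod (g t))\<^sup>2 \<partial>lborel) + \<bar>s' - s\<bar> / e"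
proof -
  have le: "cmod (primitive g s' - primitive g s) \<le> e * (\<integral>t. (cmod (g t))\<^sup>2 \<partial>lborel) + (s' - s) / e"
    if "s \<le> s'" for s s'
  proof -
    have *: "a \<le> e * a\<^sup>2 + 1 / e" for a :: real
    proof -
      have "e * a\<^sup>2 + 1 / e - 2 * a = (e * a - 1)\<^sup>2 / e"
        using assms by (simp add: field_simps power2_eq_square)
      moreover have "\<dots> \<ge> 0" using assms by simp
      moreover have "e * a\<^sup>2 + 1 / e \<ge> 0" using assms by simp
      ultimately show ?thesis by linarith
    qed
    have i: "integrable lborel (\<lambda>t. e * (cmod (g t))\<^sup>2 + indicator {s<..s'} t * (1 / e))"
      using L2 that by (intro Bochner_Integration.integrable_add integrable_mult_right integrable_mult_left
          integrable_real_indicator) auto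
    have "cmod (primitive g s' - primitive g s) \<le> (\<integral>t. cmod (indicator {s<..s'} t *\<^sub>R g t) \<partial>lborel)"
      unfolding primitive_increment[OF that] by (rule integral_norm_bound)
    also have "\<dots> \<le> (\<integral>t. e * (cmod (g t))\<^sup>2 + indicator {s<..s'} t * (1 / e) \<partial>lborel)"
      using i
    proof (rule integral_mono')
      show "cmod (indicator {s<..s'} t *\<^sub>R g t) \<le> e * (cmod (g t))\<^sup>2 + indicator {s<..s'} t * (1 / e)" for t
        using *[of "cmod (g t)"] assms by (auto simp: indicator_def)
    qed (use assms in auto)
    also have "\<dots> = e * (\<integral>t. (cmod (g t))\<^sup>2 \<partial>lborel) + (s' - s) / e"
      using L2 that by (subst Bochner_Integration.integral_add)
        (auto intro!: integrable_mult_left integrable_real_indicator)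
    finally show ?thesis .
  qed
  show ?thesis
  proof (cases "s \<le> s'")
    case True
    then show ?thesis using le[OF True] by simp
  next
    case False
    then have "s' \<le> s" by simp
    from le[OF this] show ?thesis using False by (simp add: norm_minus_commute)
  qed
qed

lemma continuous_on_primitive: "continuous_on UNIV (primitive g)"
proof (rule continuous_onI)
  fix s e :: real assume "0 < e"
  define N where "N = (\<integral>t. (cmod (g t))\<^sup>2 \<partial>lborel)"
  have N: "0 \<le> N" by (simp add: N_def)
  \<comment> \<open>Chosen so that \<open>k * N \<le> e / 3\<close>; points closer than
    \<open>k * e / 3\<close> then bring the other term below e/3 too.\<close>
  define k where "k = e / (3 * (N + 1))"
  have k: "0 < k" using \<open>0 < e\<close> N by (simp add: k_def)
  have "dist (primitive g s') (primitive g s) \<le> e" if "dist s' s < k * e / 3" for s'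
  proof -
    have "k * N \<le> e / 3"
    proof -
      have "k * N \<le> k * (N + 1)" using k by (intro mult_left_mono) auto
      also have "\<dots> = e / 3"
      proof -
        have "e / (3 * c) * c = e / 3" if "c \<noteq> 0" for c :: real using that by simp
        moreover have "N + 1 \<noteq> 0" using N by linarith
        ultimately show ?thesis unfolding k_def by blast
      qed
      finally show ?thesis .
    qed
    moreover have "\<bar>s' - s\<bar> / k \<le> e / 3"
      using that k by (simp add: dist_real_def divide_le_eq mult.commute)
    ultimately show ?thesis
      using primitive_modulus[OF k, of s' s] \<open>0 < e\<close> unfolding dist_norm N_def by linarith
  qed
  then show "\<exists>d>0. \<forall>s'\<in>UNIV. dist s' s < d \<longrightarrow> dist (primitive g s') (primitive g s) \<le> e"
    using k \<open>0 < e\<close> by (intro exI[of _ "k * e / 3"]) auto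
qed

end

section \<open>Transport between a one-dimensional space and the real line\<close>

lemma AE_translate:
  assumes "AE x in lborel. P (x :: 'a::euclidean_space)"
  shows "AE x in lborel. P (c + x)"
proof -
  have "AE x in distr lborel borel ((+) c). P x"
    unfolding lborel_distr_plus by (rule assms)
  then show ?thesis by (rule AE_distrD[rotated]) simp
qed

lemma lborel_one_dimensional:
  fixes b :: "'a::euclidean_space"
  assumes "Basis = {b}"
  shows "distr lborel borel (\<lambda>s::real. s *\<^sub>R b) = lborel" "distr lborel borel (\<lambda>x::'a. x \<bullet> b) = (lborel :: real measure)"
proof -
  have b: "b \<in> Basis" using assms by blast
  then have b: "b \<bullet> b = 1" "b \<in> Basis" by (simp_all add: inner_same_Basis)
  show 1: "distr lborel borel (\<lambda>s::real. s *\<^sub>R b) = lborel"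
  proof (rule lborel_eqI[symmetric])
    fix l u :: 'a assume le: "\<And>b. b \<in> Basis \<Longrightarrow> l \<bullet> b \<le> u \<bullet> b"
    have "emeasure (distr lborel borel (\<lambda>s. s *\<^sub>R b)) (box l u) = emeasure lborel ((\<lambda>s. s *\<^sub>R b) -` box l u)"
      by (subst emeasure_distr) auto
    also have "(\<lambda>s. s *\<^sub>R b) -` box l u = {l \<bullet> b <..< u \<bullet> b}"
      using b by (auto simp: mem_box assms)
    finally show "emeasure (distr lborel borel (\<lambda>s. s *\<^sub>R b)) (box l u) = (\<Prod>b\<in>Basis. (u - l) \<bullet> b)"
      using le[OF b(2)] by (simp add: assms inner_diff_left)
  qed simp
  have "distr lborel borel (\<lambda>x::'a. x \<bullet> b) = distr (distr lborel borel (\<lambda>s::real. s *\<^sub>R b)) borel (\<lambda>x. x \<bullet> b)"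
    by (simp add: 1)
  also have "\<dots> = distr lborel borel ((\<lambda>x. x \<bullet> b) \<circ> (\<lambda>s. s *\<^sub>R b))"
    by (rule distr_distr) auto
  also have "(\<lambda>x. x \<bullet> b) \<circ> (\<lambda>s. s *\<^sub>R b) = (\<lambda>s::real. s)"
    using b by (auto simp: o_def)
  also have "distr lborel borel (\<lambda>s::real. s) = lborel"
    by (rule distr_id2) simp
  finally show "distr lborel borel (\<lambda>x::'a. x \<bullet> b) = (lborel :: real measure)" .
qed

text \<open>The exceptional set of the hypothesis depends on \<open>h\<close>. Fubini interchanges
  the quantifiers and yields one base point whose translates satisfy the equation for almost every
  \<open>h\<close>; in dimension one these translates sweep out the whole space.\<close>

lemma AE_const_if_translation_invariant:
  fixes c :: "'a::euclidean_space \<Rightarrow> complex"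
  assumes Basis: "Basis = {b}" and c [measurable]: "c \<in> borel_measurable borel"
    and inv: "\<And>h. 0 \<le> h \<Longrightarrow> AE x in lborel. c (x + h *\<^sub>R b) = c x"
  obtains k where "AE x in lborel. c x = k"
proof -
  have "b \<in> Basis" using Basis by blast
  then have b: "b \<bullet> b = 1" by (simp add: inner_same_Basis)
  have inv': "AE x in lborel. c (x + h *\<^sub>R b) = c x" for h
  proof (cases "0 \<le> h")
    case False
    then have "AE x in lborel. c (x + (- h) *\<^sub>R b) = c x" by (intro inv) simp
    then have "AE x in lborel. c (h *\<^sub>R b + x + (- h) *\<^sub>R b) = c (h *\<^sub>R b + x)"
      by (rule AE_translate)
    then show ?thesis by eventually_elim (simp add: add.commute)
  qed (rule inv)
  have "AE x in lborel. AE h in lborel. c (x + h *\<^sub>R b) = c x"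
  proof (subst lborel_pair.AE_commute)
    have [measurable]: "(\<lambda>(x, h). c (x + h *\<^sub>R b)) \<in> borel_measurable (borel \<Otimes>\<^sub>M borel)" by measurable
    show "{x \<in> space (lborel \<Otimes>\<^sub>M lborel). c (fst x + snd x *\<^sub>R b) = c (fst x)} \<in> sets (lborel \<Otimes>\<^sub>M lborel)"
      by measurable
    show "AE h in lborel. AE x in lborel. c (x + h *\<^sub>R b) = c x"
      using inv' by (rule AE_I2)
  qed
  \<comment> \<open>Lebesgue measure is not zero, so a property that holds almost everywhere holds
    at some point.\<close>
  moreover have "ae_filter (lborel :: 'a measure) \<noteq> bot"
    by (simp add: ae_filter_eq_bot_iff)
  ultimately obtain x0 where x0: "AE h in lborel. c (x0 + h *\<^sub>R b) = c x0"
    using eventually_happens' by blast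
  have x0_eq: "x0 = (x0 \<bullet> b) *\<^sub>R b" using euclidean_representation[of x0] by (simp add: Basis)
  have "x0 + (- (x0 \<bullet> b) + s) *\<^sub>R b = s *\<^sub>R b" for s
    using x0_eq by (simp add: algebra_simps)
  then have "AE s in lborel. c (s *\<^sub>R b) = c x0"
    using AE_translate[OF x0, of "- (x0 \<bullet> b)"] by (simp only:)
  then have "AE s in distr lborel borel (\<lambda>x::'a. x \<bullet> b). c (s *\<^sub>R b) = c x0"
    unfolding lborel_one_dimensional(2)[OF Basis] .
  then have "AE x in lborel. c ((x \<bullet> b) *\<^sub>R b) = c x0"
    by (rule AE_distrD[rotated]) simp
  moreover have "(x \<bullet> b) *\<^sub>R b = x" for x :: 'a using euclidean_representation[of x] by (simp add: Basis)
  ultimately show thesis using that[of "c x0"] by simp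
qed

text \<open>The function and the continuous primitive of its weak derivative have the same
  increments almost everywhere, so they differ by a constant. Boundedness follows by comparing a
  value with the mean square over an adjacent unit interval.\<close>

lemma H1_continuous_bounded_representative:
  fixes u :: "'a::euclidean_space \<Rightarrow> complex"
  assumes dim: "DIM('a) = 1" and u: "u \<in> H1"
  obtains v C where "continuous_on UNIV v" "AE x in lebesgue. v x = u x" "\<And>x. cmod (v x) \<le> C"
proof -
  obtain b :: 'a where Basis: "Basis = {b}" using dim by (auto simp: card_1_singleton_iff)
  have b: "b \<in> Basis" using Basis by blast
  then have b: "b \<bullet> b = 1" "b \<in> Basis" by (simp_all add: inner_same_Basis)
  have x_eq: "(x \<bullet> b) *\<^sub>R b = x" for x :: 'a using euclidean_representation[of x] by (simp add: Basis)
  obtain f where f: "f \<in> borel_measurable borel" "AE x in lebesgue. u x = f x" "f \<in> Lp 2"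
    by (rule Lp_2_borel_representative[OF H1_Lp_2[OF u]]) (rule that)
  obtain g where g: "g \<in> borel_measurable borel" "AE x in lebesgue. weak_pderiv b u x = g x" "g \<in> Lp 2"
    by (rule Lp_2_borel_representative[OF weak_pderiv_spec(1)[OF u b(2)]]) (rule that)
  note [measurable] = f(1) g(1)
  have weak: "has_weak_pderiv f b g"
    using weak_pderiv_spec[OF u b(2)] has_weak_pderiv_cong_AE[OF f(2) g(2) _ _ _ _ b(2)]
      Lp_2_measurable[OF H1_Lp_2[OF u]] f g by (simp add: Lp_2_measurable)
  have L2: "integrable lborel (\<lambda>s::real. (cmod (k (s *\<^sub>R b)))\<^sup>2)"
    if [measurable]: "k \<in> borel_measurable borel" and "k \<in> Lp 2" for k :: "'a \<Rightarrow> complex"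
  proof -
    have "integrable (distr lborel borel (\<lambda>s::real. s *\<^sub>R b)) (\<lambda>x. (cmod (k x))\<^sup>2)"
      using that by (simp add: lborel_one_dimensional(1)[OF Basis] borel_Lp_2_iff)
    then show ?thesis by (rule integrable_distr[rotated]) simp
  qed
  define g1 where "g1 s = g (s *\<^sub>R b)" for s :: real
  have g1 [measurable]: "g1 \<in> borel_measurable borel" unfolding g1_def by measurable
  have g1_L2: "integrable lborel (\<lambda>s. (cmod (g1 s))\<^sup>2)" unfolding g1_def by (rule L2[OF g(1,3)])
  define F where "F = primitive g1"
  have F_cont: "continuous_on UNIV F" unfolding F_def by (rule continuous_on_primitive[OF g1 g1_L2])
  have [measurable]: "F \<in> borel_measurable borel" by (intro borel_measurable_continuous_onI F_cont)
  define c where "c x = f x - F (x \<bullet> b)" for x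
  have [measurable]: "c \<in> borel_measurable borel" unfolding c_def by measurable
  have inv: "AE x in lborel. c (x + h *\<^sub>R b) = c x" if h: "0 \<le> h" for h
    using AE_increment_eq_line_integral[OF b(2) f(1) locally_integrable_Lp_2[OF f(1,3)]
        g(1) locally_integrable_Lp_2[OF g(1,3)] weak h]
  proof eventually_elim
    case (elim x)
    have "(\<integral>t. indicator {0..h} t *\<^sub>R g (x + t *\<^sub>R b) \<partial>lborel) = (\<integral>t. indicator {0..h} t *\<^sub>R g1 (t + x \<bullet> b) \<partial>lborel)"
    proof -
      have "g (x + t *\<^sub>R b) = g1 (t + x \<bullet> b)" for t
        using x_eq[of x] by (simp add: g1_def scaleR_add_left add.commute)
      then show ?thesis by simp
    qed
    also have "\<dots> = (\<integral>t. indicator {0..h} (t - x \<bullet> b) *\<^sub>R g1 t \<partial>lborel)"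
      using integral_translate[of "\<lambda>t. indicator {0..h} (t - x \<bullet> b) *\<^sub>R g1 t" "x \<bullet> b"] by simp
    also have "\<dots> = (\<integral>t. indicator {x \<bullet> b<..x \<bullet> b + h} t *\<^sub>R g1 t \<partial>lborel)"
    proof (rule integral_cong_AE)
      \<comment> \<open>The line integral runs over a closed interval, the increment of
        \<open>primitive\<close> over a half-open one; they differ in one endpoint.\<close>
      have "AE t in lborel. t \<noteq> x \<bullet> b" by (rule AE_lborel_singleton)
      then show "AE t in lborel. indicator {0..h} (t - x \<bullet> b) *\<^sub>R g1 t = indicator {x \<bullet> b<..x \<bullet> b + h} t *\<^sub>R g1 t"
        by eventually_elim (auto simp: indicator_def)
    qed measurable
    also have "\<dots> = F (x \<bullet> b + h) - F (x \<bullet> b)"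
      unfolding F_def using h by (intro primitive_increment[OF g1 g1_L2, symmetric]) simp
    finally show ?case using elim b(1) by (simp add: c_def inner_add_left algebra_simps)
  qed
  obtain k where k: "AE x in lborel. c x = k"
    by (rule AE_const_if_translation_invariant[OF Basis \<open>c \<in> borel_measurable borel\<close> inv])
       (assumption | rule that)+
  define v1 where "v1 s = F s + k" for s
  have f_eq: "AE x in lborel. f x = v1 (x \<bullet> b)"
    using k by eventually_elim (auto simp: c_def v1_def algebra_simps)
  define N where "N = (\<integral>t. (cmod (g1 t))\<^sup>2 \<partial>lborel)"
  define M where "M = (\<integral>t. (cmod (f (t *\<^sub>R b)))\<^sup>2 \<partial>lborel)"
  \<comment> \<open>For t in \<open>{s..s+1}\<close> the modulus with \<open>e = 1\<close> bounds
    \<open>cmod (v1 s)\<close> by \<open>cmod (v1 t) + (N + 1)\<close>. Squaring and integrating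
    over this interval of length 1 gives a bound independent of \<open>s\<close>.\<close>
  have bound: "(cmod (v1 s))\<^sup>2 \<le> 2 * M + 2 * (N + 1)\<^sup>2" for s
  proof -
    have N: "0 \<le> N" by (simp add: N_def)
    have fL2: "integrable lborel (\<lambda>t. (cmod (f (t *\<^sub>R b)))\<^sup>2)" by (rule L2[OF f(1,3)])
    have "AE x in distr lborel borel (\<lambda>s::real. s *\<^sub>R b). f x = v1 (x \<bullet> b)"
      unfolding lborel_one_dimensional(1)[OF Basis] by (rule f_eq)
    then have "AE t in lborel. f (t *\<^sub>R b) = v1 (t *\<^sub>R b \<bullet> b)"
      by (rule AE_distrD[rotated]) simp
    then have ae: "AE t in lborel. indicator {s..s+1} t * (cmod (v1 s))\<^sup>2
        \<le> 2 * (cmod (f (t *\<^sub>R b)))\<^sup>2 + indicator {s..s+1} t * (2 * (N + 1)\<^sup>2)"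
    proof eventually_elim
      case (elim t)
      show ?case
      proof (cases "t \<in> {s..s+1}")
        case True
        have "cmod (v1 s - v1 t) \<le> N + 1"
          using primitive_modulus[OF g1 g1_L2, of 1 s t] True by (simp add: v1_def F_def N_def)
        then have "cmod (v1 s) \<le> cmod (f (t *\<^sub>R b)) + (N + 1)"
          using elim b(1) norm_triangle_ineq[of "v1 t" "v1 s - v1 t"] by simp
        then have "(cmod (v1 s))\<^sup>2 \<le> (cmod (f (t *\<^sub>R b)) + (N + 1))\<^sup>2"
          by (intro power_mono) auto
        also have "\<dots> \<le> 2 * (cmod (f (t *\<^sub>R b)))\<^sup>2 + 2 * (N + 1)\<^sup>2"
          using sum_squares_bound[of "cmod (f (t *\<^sub>R b))" "N + 1"] by (simp add: power2_sum)
        finally show ?thesis using True by simp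
      qed simp
    qed
    have "(cmod (v1 s))\<^sup>2 = (\<integral>t. indicator {s..s+1} t * (cmod (v1 s))\<^sup>2 \<partial>lborel)"
      by simp
    also have "\<dots> \<le> (\<integral>t. 2 * (cmod (f (t *\<^sub>R b)))\<^sup>2 + indicator {s..s+1} t * (2 * (N + 1)\<^sup>2) \<partial>lborel)"
      using fL2 by (intro integral_mono_AE ae Bochner_Integration.integrable_add integrable_mult_right
          integrable_mult_left integrable_real_indicator) auto
    also have "\<dots> = 2 * M + 2 * (N + 1)\<^sup>2"
      using fL2 by (subst Bochner_Integration.integral_add)
        (auto intro!: integrable_mult_left integrable_real_indicator simp: M_def)
    finally show ?thesis .
  qed
  show thesis
  proof (rule that)
    show "continuous_on UNIV (\<lambda>x. v1 (x \<bullet> b))"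
      unfolding v1_def by (intro continuous_intros continuous_on_compose2[OF F_cont]) auto
    show "AE x in lebesgue. v1 (x \<bullet> b) = u x"
      using AE_completion[OF f_eq] f(2) by eventually_elim simp
    show "cmod (v1 (x \<bullet> b)) \<le> sqrt (2 * M + 2 * (N + 1)\<^sup>2)" for x
      by (rule real_le_rsqrt) (rule bound)
  qed
qed

text \<open>Two continuous functions agree on a closed set; if that set has full Lebesgue measure,
  it is the whole space.\<close>

lemma cont_rep_eq:
  fixes g :: "'a::euclidean_space \<Rightarrow> 'b::{banach,second_countable_topology}"
  assumes g: "continuous_on UNIV g" "AE x in lebesgue. g x = f x"
  shows "cont_rep f = g"
proof -
  have "continuous_on UNIV (cont_rep f) \<and> (AE x in lebesgue. cont_rep f x = f x)"
    unfolding cont_rep_def by (rule someI[of _ g]) (use g in blast)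
  then have c: "continuous_on UNIV (cont_rep f)" "AE x in lebesgue. cont_rep f x = f x" by auto
  have "closed {x. cont_rep f x = g x}"
    using c(1) g(1) by (intro closed_Collect_eq)
  moreover have "AE x in lebesgue. x \<in> {x. cont_rep f x = g x}"
    using c(2) g(2) by eventually_elim simp
  ultimately have "x \<in> {x. cont_rep f x = g x}" for x
    by (rule mem_closed_if_AE_lebesgue)
  then show ?thesis by auto
qed

subsection \<open>The sign of the potential term\<close>

text \<open>
  No integrability is required, because a non-integrable function has integral \<open>0\<close>.  This is why
  no Sobolev embedding is needed for the nonlinearity and for function potentials.
\<close>

lemma Re_integral_nonneg:
  fixes X :: "'a \<Rightarrow> complex"
  assumes "AE x in M. 0 \<le> Re (X x)"
  shows "0 \<le> Re (\<integral>x. X x \<partial>M)"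
proof (cases "integrable M X")
  case True
  have "Re (\<integral>x. X x \<partial>M) = (\<integral>x. Re (X x) \<partial>M)"
    using integral_bounded_linear[OF bounded_linear_Re True] by simp
  then show ?thesis using integral_nonneg_AE[OF assms] by simp
qed (simp add: not_integrable_integral_eq)

lemma Re_integral_nonpos:
  fixes X :: "'a \<Rightarrow> complex"
  assumes "AE x in M. Re (X x) \<le> 0"
  shows "Re (\<integral>x. X x \<partial>M) \<le> 0"
  using Re_integral_nonneg[of "\<lambda>x. - X x" M] assms by simp

text \<open>Shaped for both kinds of potential: \<open>B\<close> is the power of the
  \<open>Lp\<close> part and \<open>C\<close> absorbs the bounded part, or \<open>B\<close> is 0 and
  \<open>C\<close> bounds the density that accompanies a measure.\<close>

lemma locally_integrable_of_lebesgue_bound: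
  fixes w' B :: "'a::euclidean_space \<Rightarrow> real"
  assumes [measurable]: "w' \<in> borel_measurable borel" and b: "integrable lebesgue B"
    and le: "AE x in lebesgue. \<bar>w' x\<bar> \<le> C + norm (B x)"
  shows "locally_integrable w'"
  unfolding locally_integrable_def
proof
  fix R
  have "integrable lborel (\<lambda>x::'a. indicator (cball 0 R) x *\<^sub>R C)"
    using locally_integrable_const[of C] unfolding locally_integrable_def by blast
  then have "integrable lebesgue (\<lambda>x::'a. indicator (cball 0 R) x *\<^sub>R C)"
    by (subst integrable_completion) auto
  then have "integrable lebesgue (\<lambda>x. indicator (cball 0 R) x *\<^sub>R C + norm (B x))"
    using b by (intro Bochner_Integration.integrable_add integrable_norm)
  then have "integrable lebesgue (\<lambda>x. indicator (cball 0 R) x *\<^sub>R w' x)"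
  proof (rule Bochner_Integration.integrable_bound)
    show "AE x in lebesgue. norm (indicator (cball 0 R) x *\<^sub>R w' x) \<le> norm (indicator (cball 0 R) x *\<^sub>R C + norm (B x))"
      using le by eventually_elim (auto simp: indicator_def)
    show "(\<lambda>x. indicator (cball 0 R) x *\<^sub>R w' x) \<in> borel_measurable lebesgue"
      by (rule borel_imp_lebesgue_measurable) measurable
  qed
  then show "integrable lborel (\<lambda>x. indicator (cball 0 R) x *\<^sub>R w' x)"
    by (subst (asm) integrable_completion) auto
qed

lemma pot_integral_test_square:
  assumes "nonpositive_potential V" "\<eta> \<in> test_functions"
  shows "pot_integral V (\<lambda>x. (\<eta> x)\<^sup>2) \<le> 0"
  using assms(1) of_real_test_function_H1[OF assms(2)]
  by (auto simp: nonpositive_potential_def dest!: bspec)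

lemma function_potential_AE_nonpos:
  fixes v :: "'a::euclidean_space \<Rightarrow> real"
  assumes "admissible_potential (Function_Pot v)"
  shows "AE x in lebesgue. v x \<le> 0"
proof -
  obtain q f g where q: "admissible_exponent DIM('a) q" and f: "f \<in> Lp q" and g: "g \<in> Linf"
    and v: "v = (\<lambda>x. f x + g x)"
    using assms by (auto simp: admissible_potential_def)
  \<comment> \<open>The exponent is 1, above 1 or at least 3/2 according to dimension. For q at
    least 1 the bound of t by 1 + t^q makes the \<open>Lp\<close> part locally integrable.\<close>
  have "1 \<le> q"
  proof (cases "3 \<le> DIM('a)")
    case True
    then have "3 \<le> real DIM('a)" by linarith
    then show ?thesis using q True by (auto simp: admissible_exponent_def)
  next
    case False
    then have "DIM('a) = 1 \<or> DIM('a) = 2" using DIM_positive[where 'a = 'a] by linarith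
    then show ?thesis using q by (auto simp: admissible_exponent_def)
  qed
  obtain C where C: "AE x in lebesgue. norm (g x) \<le> C" using g by (auto simp: Linf_def)
  have [measurable]: "v \<in> borel_measurable lebesgue"
    using f g unfolding v by (auto simp: Lp_def Linf_def)
  obtain v' where v' [measurable]: "v' \<in> borel_measurable lborel" and "AE x in lborel. v x = v' x"
    using completion_ex_borel_measurable_real[of v lborel] by auto
  then have eq: "AE x in lebesgue. v x = v' x" by (intro AE_completion)
  have v'b [measurable]: "v' \<in> borel_measurable borel" using v' by simp
  have "AE x in lborel. v' x \<le> 0"
  proof (rule AE_nonpos_if_test_squares_nonpos[OF v'b])
    have "t \<le> 1 + t powr q" if "0 \<le> t" for t :: real
    proof (cases "t \<le> 1")
      case False
      then have "t powr 1 \<le> t powr q" using \<open>1 \<le> q\<close> by (intro powr_mono) auto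
      then show ?thesis using False by simp
    qed (simp add: add_increasing2)
    then have f_le: "\<bar>f x\<bar> \<le> 1 + norm (norm (f x) powr q)" for x by simp
    show "locally_integrable v'"
    proof (rule locally_integrable_of_lebesgue_bound[OF v'b])
      show "integrable lebesgue (\<lambda>x. norm (f x) powr q)" using f by (simp add: Lp_def)
      show "AE x in lebesgue. \<bar>v' x\<bar> \<le> (1 + C) + norm (norm (f x) powr q)"
        using eq C
      proof eventually_elim
        case (elim x)
        then have "\<bar>v' x\<bar> \<le> \<bar>f x\<bar> + \<bar>g x\<bar>" using abs_triangle_ineq[of "f x" "g x"] by (simp add: v)
        then show ?case using f_le[of x] elim(2) by simp
      qed
    qed
    fix \<eta> :: "'a \<Rightarrow> real" assume \<eta>: "\<eta> \<in> test_functions"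
    note \<eta>b [measurable] = borel_measurable_test_function[OF \<eta>]
    note \<eta>l [measurable] = borel_imp_lebesgue_measurable[OF \<eta>b]
    note v'l [measurable] = borel_imp_lebesgue_measurable[OF v'b]
    have "(\<integral>x. v' x * (\<eta> x)\<^sup>2 \<partial>lborel) = (\<integral>x. v' x * (\<eta> x)\<^sup>2 \<partial>lebesgue)"
      by (intro integral_completion[symmetric]) measurable
    also have "\<dots> = (\<integral>x. v x * (\<eta> x)\<^sup>2 \<partial>lebesgue)"
    proof (rule integral_cong_AE)
      show "AE x in lebesgue. v' x * (\<eta> x)\<^sup>2 = v x * (\<eta> x)\<^sup>2"
        using eq by eventually_elim simp
    qed measurable
    also have "\<dots> \<le> 0"
      using pot_integral_test_square[OF _ \<eta>, of "Function_Pot v"] assms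
      by (simp add: admissible_potential_def)
    finally show "(\<integral>x. v' x * (\<eta> x)\<^sup>2 \<partial>lborel) \<le> 0" .
  qed
  then have "AE x in lebesgue. v' x \<le> 0" by (rule AE_completion)
  with eq show ?thesis by eventually_elim simp
qed

lemma continuous_AE_nonneg_imp_nonneg:
  fixes F :: "'a::euclidean_space \<Rightarrow> real"
  assumes "continuous_on UNIV F" "AE x in lebesgue. 0 \<le> F x"
  shows "0 \<le> F x"
proof -
  have "closed {x. 0 \<le> F x}" using assms(1) by (intro closed_Collect_le) auto
  moreover have "AE x in lebesgue. x \<in> {x. 0 \<le> F x}" using assms(2) by simp
  ultimately have "x \<in> {x. 0 \<le> F x}" by (rule mem_closed_if_AE_lebesgue)
  then show ?thesis by simp
qed

text \<open>Boundedness of \<open>F\<close> makes its integrals against the finite measures finite,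
  and integrability does so for the bounded density \<open>w\<close>. All four terms of the extended
  comparison are then finite and may be rearranged as real numbers.\<close>

lemma measure_potential_nonpos:
  fixes F :: "'a::euclidean_space \<Rightarrow> real"
  assumes adm: "admissible_potential (Measure_Pot \<mu> \<nu> w)"
    and cont: "continuous_on UNIV F" and nonneg: "\<And>x. 0 \<le> F x" and bounded: "\<And>x. F x \<le> C"
    and int: "integrable lborel F"
  shows "(\<integral>x. F x \<partial>\<mu>) - (\<integral>x. F x \<partial>\<nu>) + (\<integral>x. w x * F x \<partial>lebesgue) \<le> 0"
proof -
  have fin: "finite_measure \<mu>" "finite_measure \<nu>" and sets: "sets \<mu> = sets borel" "sets \<nu> = sets borel"
    and w: "w \<in> Linf"
    using adm by (auto simp: admissible_potential_def)
  have F [measurable]: "F \<in> borel_measurable borel" by (intro borel_measurable_continuous_onI cont)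
  have wl [measurable]: "w \<in> borel_measurable lebesgue" using w by (simp add: Linf_def)
  obtain K where K: "AE x in lebesgue. norm (w x) \<le> K" using w by (auto simp: Linf_def)
  obtain w' where w': "w' \<in> borel_measurable lborel" and "AE x in lborel. w x = w' x"
    using completion_ex_borel_measurable_real[of w lborel] by auto
  then have eq: "AE x in lebesgue. w x = w' x" by (intro AE_completion)
  have w'b [measurable]: "w' \<in> borel_measurable borel" using w' by simp
  note w'l [measurable] = borel_imp_lebesgue_measurable[OF w'b]
  have K': "AE x in lebesgue. \<bar>w' x\<bar> \<le> K" using eq K by eventually_elim simp
  have w_int: "(\<integral>x. w x * G x \<partial>lebesgue) = (\<integral>x. w' x * G x \<partial>lborel)"
    if Gb [measurable]: "G \<in> borel_measurable borel" for G
  proof -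
    note [measurable] = borel_imp_lebesgue_measurable[OF Gb]
    have "(\<integral>x. w x * G x \<partial>lebesgue) = (\<integral>x. w' x * G x \<partial>lebesgue)"
    proof (rule integral_cong_AE)
      show "AE x in lebesgue. w x * G x = w' x * G x" using eq by eventually_elim simp
    qed measurable
    also have "\<dots> = (\<integral>x. w' x * G x \<partial>lborel)" by (intro integral_completion) measurable
    finally show ?thesis .
  qed
  have loc: "locally_integrable w'"
    by (rule locally_integrable_of_lebesgue_bound[OF w'b, of "\<lambda>_. 0 :: real" K]) (use K' in auto)
  have main: "(\<integral>\<^sup>+x. ennreal (F x) \<partial>\<mu>) + (\<integral>\<^sup>+x. ennreal (F x) * ennreal (w' x) \<partial>lborel)
      \<le> (\<integral>\<^sup>+x. ennreal (F x) \<partial>\<nu>) + (\<integral>\<^sup>+x. ennreal (F x) * ennreal (- w' x) \<partial>lborel)"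
  proof (rule nn_integral_le_of_test_squares[OF fin(1) sets(1) fin(2) sets(2) w'b loc])
    fix \<eta> :: "'a \<Rightarrow> real" assume \<eta>: "\<eta> \<in> test_functions"
    have "cont_rep (\<lambda>x. (\<eta> x)\<^sup>2) = (\<lambda>x. (\<eta> x)\<^sup>2)"
      by (rule cont_rep_eq[OF continuous_on_test_function[OF test_functions_square[OF \<eta>]]]) simp
    moreover have "(\<integral>x. w x * (\<eta> x)\<^sup>2 \<partial>lebesgue) = (\<integral>x. w' x * (\<eta> x)\<^sup>2 \<partial>lborel)"
      by (rule w_int) (rule borel_measurable_test_function[OF test_functions_square[OF \<eta>]])
    ultimately show "(\<integral>x. (\<eta> x)\<^sup>2 \<partial>\<mu>) - (\<integral>x. (\<eta> x)\<^sup>2 \<partial>\<nu>) + (\<integral>x. w' x * (\<eta> x)\<^sup>2 \<partial>lborel) \<le> 0"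
      using pot_integral_test_square[OF _ \<eta>, of "Measure_Pot \<mu> \<nu> w"] adm
      by (simp add: admissible_potential_def)
  qed measurable
  have fin_int: "integrable M F" "(\<integral>\<^sup>+x. ennreal (F x) \<partial>M) = ennreal (\<integral>x. F x \<partial>M)"
    if "finite_measure M" "sets M = sets borel" for M
  proof -
    interpret finite_measure M by fact
    have FM: "F \<in> borel_measurable M" using F that(2) by (simp cong: measurable_cong_sets)
    show i: "integrable M F"
      by (rule integrable_const_bound[where B = C]) (use FM nonneg bounded in auto)
    show "(\<integral>\<^sup>+x. ennreal (F x) \<partial>M) = ennreal (\<integral>x. F x \<partial>M)"
      by (rule nn_integral_eq_integral[OF i]) (use nonneg in auto)
  qed
  have wF: "integrable lborel (\<lambda>x. w' x * F x)"
  proof (rule Bochner_Integration.integrable_bound)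
    show "integrable lborel (\<lambda>x. K * F x)" using int by simp
    have "AE x in lborel. \<bar>w' x\<bar> \<le> K" using K' by (simp add: AE_completion_iff)
    then show "AE x in lborel. norm (w' x * F x) \<le> norm (K * F x)"
      by eventually_elim (auto simp: abs_mult intro!: mult_right_mono)
  qed measurable
  have swap: "(\<integral>\<^sup>+x. ennreal (F x) * ennreal (w' x) \<partial>lborel) = (\<integral>\<^sup>+x. ennreal (w' x * F x) \<partial>lborel)"
    "(\<integral>\<^sup>+x. ennreal (F x) * ennreal (- w' x) \<partial>lborel) = (\<integral>\<^sup>+x. ennreal (- (w' x * F x)) \<partial>lborel)"
    by (simp_all add: ennreal_mult'[OF nonneg, symmetric] mult.commute)
  define a where "a = enn2real (\<integral>\<^sup>+x. ennreal (w' x * F x) \<partial>lborel)"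
  define b where "b = enn2real (\<integral>\<^sup>+x. ennreal (- (w' x * F x)) \<partial>lborel)"
  have ab: "(\<integral>\<^sup>+x. ennreal (w' x * F x) \<partial>lborel) = ennreal a"
    "(\<integral>\<^sup>+x. ennreal (- (w' x * F x)) \<partial>lborel) = ennreal b" "0 \<le> a" "0 \<le> b"
    using wF unfolding a_def b_def by (auto simp: real_integrable_def less_top)
  have "0 \<le> (\<integral>x. F x \<partial>\<mu>)" "0 \<le> (\<integral>x. F x \<partial>\<nu>)"
    using nonneg by (auto intro: integral_nonneg_AE)
  with main have "(\<integral>x. F x \<partial>\<mu>) + a \<le> (\<integral>x. F x \<partial>\<nu>) + b"
    unfolding swap ab(1,2) fin_int(2)[OF fin(1) sets(1)] fin_int(2)[OF fin(2) sets(2)]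
    using ab(3,4) by (simp add: ennreal_le_iff flip: ennreal_plus)
  then show ?thesis
    unfolding w_int[OF F] using real_lebesgue_integral_def[OF wF] by (simp add: a_def b_def)
qed

text \<open>For a function potential the sign is pointwise. For a measure potential the product is
  replaced by its continuous representative, whose real part is nonpositive everywhere and not
  merely almost everywhere; singular measures see such a difference.\<close>

lemma pot_integral_sign:
  fixes V :: "'a::euclidean_space potential"
  assumes adm: "admissible_potential V" and p: "p \<in> H1" and \<psi>: "\<psi> \<in> H1"
    and neg: "AE x in lebesgue. Re (p x * cnj (\<psi> x)) \<le> 0"
  shows "0 \<le> Re (pot_integral V (\<lambda>x. p x * cnj (\<psi> x)))"
proof (cases V)
  case (Function_Pot v)
  have "AE x in lebesgue. v x \<le> 0"
    using function_potential_AE_nonpos adm Function_Pot by blast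
  with neg have "AE x in lebesgue. 0 \<le> Re (v x *\<^sub>R (p x * cnj (\<psi> x)))"
    by eventually_elim (simp add: mult_nonpos_nonpos)
  from Re_integral_nonneg[OF this] show ?thesis using Function_Pot by simp
next
  case (Measure_Pot \<mu> \<nu> w)
  have dim: "DIM('a) = 1" and fin: "finite_measure \<mu>" "finite_measure \<nu>"
    and sets: "sets \<mu> = sets borel" "sets \<nu> = sets borel" and w: "w \<in> Linf"
    using adm Measure_Pot by (auto simp: admissible_potential_def)
  obtain p' Cp where p': "continuous_on UNIV p'" "AE x in lebesgue. p' x = p x" "\<And>x. cmod (p' x) \<le> Cp"
    by (rule H1_continuous_bounded_representative[OF dim p]) (rule that)
  obtain q Cq where q: "continuous_on UNIV q" "AE x in lebesgue. q x = \<psi> x" "\<And>x. cmod (q x) \<le> Cq"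
    by (rule H1_continuous_bounded_representative[OF dim \<psi>]) (rule that)
  define f where "f x = p' x * cnj (q x)" for x
  have f_cont: "continuous_on UNIV f" unfolding f_def by (intro continuous_intros p' q)
  have f_eq: "AE x in lebesgue. f x = p x * cnj (\<psi> x)"
    using p'(2) q(2) by eventually_elim (simp add: f_def)
  have rep: "cont_rep (\<lambda>x. p x * cnj (\<psi> x)) = f" by (rule cont_rep_eq[OF f_cont f_eq])
  have f_bound: "cmod (f x) \<le> Cp * Cq" for x
    unfolding f_def norm_mult complex_mod_cnj
    using p'(3)[of x] q(3)[of x] norm_ge_zero[of "p' x"] norm_ge_zero[of "q x"]
    by (intro mult_mono) linarith+
  have fb [measurable]: "f \<in> borel_measurable borel" by (intro borel_measurable_continuous_onI f_cont)
  have int: "integrable lebesgue (\<lambda>x. p x * cnj (\<psi> x))"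
    by (rule integrable_Lp_2_mult[OF H1_Lp_2[OF p] cnj_Lp_2[OF H1_Lp_2[OF \<psi>]]])
  have f_int: "integrable lebesgue f"
    by (rule integrable_cong_AE_imp[OF int borel_imp_lebesgue_measurable[OF fb]])
       (use f_eq in \<open>auto elim: eventually_mono\<close>)
  define F where "F x = - Re (f x)" for x
  have F_cont: "continuous_on UNIV F" unfolding F_def by (intro continuous_intros f_cont)
  have F_nonneg: "0 \<le> F x" for x
    by (rule continuous_AE_nonneg_imp_nonneg[OF F_cont])
       (use f_eq neg in \<open>eventually_elim, simp add: F_def\<close>)
  have F_bound: "F x \<le> Cp * Cq" for x
    using f_bound[of x] abs_Re_le_cmod[of "f x"] by (simp add: F_def)
  have F_int: "integrable lborel F"
  proof -
    have "integrable lborel f" using f_int by (simp add: integrable_completion)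
    then show ?thesis unfolding F_def by (intro Bochner_Integration.integrable_minus integrable_Re)
  qed
  have sign: "(\<integral>x. F x \<partial>\<mu>) - (\<integral>x. F x \<partial>\<nu>) + (\<integral>x. w x * F x \<partial>lebesgue) \<le> 0"
    by (rule measure_potential_nonpos[OF _ F_cont F_nonneg F_bound F_int]) (use adm Measure_Pot in simp)
  have Re_fin: "Re (\<integral>x. f x \<partial>M) = - (\<integral>x. F x \<partial>M)" if "finite_measure M" "sets M = sets borel" for M
  proof -
    interpret finite_measure M by fact
    have "f \<in> borel_measurable M" using fb that(2) by (simp cong: measurable_cong_sets)
    then have "integrable M f"
      by (intro integrable_const_bound[where B = "Cp * Cq"]) (use f_bound in auto)
    then show ?thesis by (simp add: F_def[abs_def] integral_Re)
  qed
  obtain K where K: "AE x in lebesgue. norm (w x) \<le> K" using w by (auto simp: Linf_def)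
  have wl [measurable]: "w \<in> borel_measurable lebesgue" using w by (simp add: Linf_def)
  have Re_w: "Re (\<integral>x. w x *\<^sub>R (p x * cnj (\<psi> x)) \<partial>lebesgue) = - (\<integral>x. w x * F x \<partial>lebesgue)"
  proof -
    note [measurable] = borel_imp_lebesgue_measurable[OF fb]
    have wf: "integrable lebesgue (\<lambda>x. w x *\<^sub>R f x)"
    proof (rule Bochner_Integration.integrable_bound)
      show "integrable lebesgue (\<lambda>x. K *\<^sub>R f x)" using f_int by simp
      show "AE x in lebesgue. norm (w x *\<^sub>R f x) \<le> norm (K *\<^sub>R f x)"
        using K by eventually_elim (auto intro!: mult_right_mono)
    qed measurable
    have "(\<integral>x. w x *\<^sub>R (p x * cnj (\<psi> x)) \<partial>lebesgue) = (\<integral>x. w x *\<^sub>R f x \<partial>lebesgue)"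
    proof (rule integral_cong_AE)
      show "(\<lambda>x. w x *\<^sub>R (p x * cnj (\<psi> x))) \<in> borel_measurable lebesgue"
        using int by (intro borel_measurable_scaleR wl) auto
      show "AE x in lebesgue. w x *\<^sub>R (p x * cnj (\<psi> x)) = w x *\<^sub>R f x"
        using f_eq by eventually_elim simp
    qed measurable
    also have "Re \<dots> = (\<integral>x. Re (w x *\<^sub>R f x) \<partial>lebesgue)"
      using wf by (rule integral_Re[symmetric])
    also have "\<dots> = - (\<integral>x. w x * F x \<partial>lebesgue)" by (simp add: F_def)
    finally show ?thesis .
  qed
  show ?thesis
    using sign unfolding Measure_Pot
    by (simp add: rep Re_fin[OF fin(1) sets(1)] Re_fin[OF fin(2) sets(2)] Re_w)
qed

subsection \<open>Nonnegativity of the scheme\<close>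

lemma Re_mult_cnj_defect:
  "Re (z * cnj (defect z)) = - Re z * smooth_negpart (Re z) + (Im z)\<^sup>2"
  "0 \<le> - Re z * smooth_negpart (Re z)"
proof -
  show "Re (z * cnj (defect z)) = - Re z * smooth_negpart (Re z) + (Im z)\<^sup>2"
    by (simp add: defect_def power2_eq_square)
  show "0 \<le> - Re z * smooth_negpart (Re z)"
  proof (cases "0 \<le> Re z")
    case True
    then have "smooth_negpart (Re z) = 0" by (simp add: smooth_negpart_bounds(3))
    then show ?thesis by simp
  next
    case False
    then show ?thesis by (intro mult_nonneg_nonneg smooth_negpart_bounds(1)) simp
  qed
qed

lemma Re_mult_cnj_defect_deriv_nonneg: "0 \<le> Re (w * cnj (defect_deriv z w))"
proof -
  have eq: "Re (w * cnj (defect_deriv z w)) = - smooth_negpart_deriv (Re z) * (Re w)\<^sup>2 + (Im w)\<^sup>2"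
    by (simp add: defect_deriv_def power2_eq_square)
  have "smooth_negpart_deriv (Re z) * (Re w)\<^sup>2 \<le> 0"
    by (intro mult_nonpos_nonneg smooth_negpart_deriv_bounds(1)) simp
  then show ?thesis unfolding eq using zero_le_power2[of "Im w"] by linarith
qed

lemma BF_step_nonneg:
  fixes V :: "'a::euclidean_space potential"
  assumes adm: "admissible_potential V" and "0 < \<omega>" "0 < \<tau>"
    and p: "p \<in> H1" "nonneg_ae p" and step: "BF_step V \<alpha> \<omega> \<tau> p u"
  shows "nonneg_ae u"
proof -
  have u: "u \<in> H1" using step by (simp add: BF_step_def)
  define \<psi> where "\<psi> x = defect (u x)" for x
  have \<psi>: "\<psi> \<in> H1" using defect_H1[OF u] by (simp add: \<psi>_def[abs_def])
  have p_Reals: "AE x in lebesgue. 0 \<le> Re (p x) \<and> Im (p x) = 0"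
    using p(2) unfolding nonneg_ae_def by eventually_elim (auto simp: complex_nonneg_Reals_iff)
  have p_neg: "AE x in lebesgue. Re (p x * cnj (\<psi> x)) \<le> 0"
    using p_Reals
  proof eventually_elim
    case (elim x)
    then show ?case
      using mult_nonneg_nonneg[OF conjunct1[OF elim] smooth_negpart_bounds(1)[of "Re (u x)"]]
      by (simp add: \<psi>_def defect_def)
  qed
  \<comment> \<open>The left side of the equation is split by linearity into these two pairings,
    which calls for integrability; the gradient, potential and nonlinear terms enter through their
    signs.\<close>
  have int_u: "integrable lebesgue (\<lambda>x. u x * cnj (\<psi> x))"
    and int_p: "integrable lebesgue (\<lambda>x. p x * cnj (\<psi> x))"
    using u p(1) \<psi> by (simp_all add: integrable_Lp_2_mult cnj_Lp_2 H1_Lp_2)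
  define S where "S = (\<integral>x. Re (u x * cnj (\<psi> x)) \<partial>lebesgue)"
  have S_Re: "Re (\<integral>x. u x * cnj (\<psi> x) \<partial>lebesgue) = S"
    unfolding S_def by (rule integral_Re[OF int_u, symmetric])
  have P: "Re (\<integral>x. p x * cnj (\<psi> x) \<partial>lebesgue) \<le> 0"
    by (rule Re_integral_nonpos[OF p_neg])
  have "Re (\<integral>x. of_real (cmod (p x) powr (2 * \<alpha>)) * p x * cnj (\<psi> x) \<partial>lebesgue) \<le> 0"
  proof (rule Re_integral_nonpos)
    show "AE x in lebesgue. Re (of_real (cmod (p x) powr (2 * \<alpha>)) * p x * cnj (\<psi> x)) \<le> 0"
      using p_neg
    proof eventually_elim
      case (elim x)
      have "Re (of_real (cmod (p x) powr (2 * \<alpha>)) * p x * cnj (\<psi> x))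
          = cmod (p x) powr (2 * \<alpha>) * Re (p x * cnj (\<psi> x))"
        by (simp add: algebra_simps)
      then show ?case using mult_nonneg_nonpos[OF powr_ge_zero elim] by simp
    qed
  qed
  moreover have "0 \<le> Re (\<integral>x. (\<Sum>b\<in>Basis. weak_pderiv b u x * cnj (weak_pderiv b \<psi> x)) \<partial>lebesgue)"
  proof (rule Re_integral_nonneg)
    have "AE x in lebesgue. \<forall>b\<in>Basis. weak_pderiv b \<psi> x = defect_deriv (u x) (weak_pderiv b u x)"
      using weak_pderiv_defect[OF u] unfolding \<psi>_def[abs_def] by (intro AE_finite_allI) auto
    then show "AE x in lebesgue. 0 \<le> Re (\<Sum>b\<in>Basis. weak_pderiv b u x * cnj (weak_pderiv b \<psi> x))"
      \<comment> \<open>The real part of the product must stay unexpanded for the sign of each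
        summand to be recognised.\<close>
      by eventually_elim (auto simp del: times_complex.sel intro!: sum_nonneg Re_mult_cnj_defect_deriv_nonneg)
  qed
  moreover have "0 \<le> Re (pot_integral V (\<lambda>x. p x * cnj (\<psi> x)))"
    by (rule pot_integral_sign[OF adm p(1) \<psi> p_neg])
  moreover have "Re (\<integral>x. (u x - p x) / of_real \<tau> * cnj (\<psi> x) \<partial>lebesgue)
      = (S - Re (\<integral>x. p x * cnj (\<psi> x) \<partial>lebesgue)) / \<tau>"
  proof -
    have "(u x - p x) / of_real \<tau> * cnj (\<psi> x) = (u x * cnj (\<psi> x) - p x * cnj (\<psi> x)) / of_real \<tau>" for x
      by (simp add: algebra_simps)
    then have "(\<integral>x. (u x - p x) / of_real \<tau> * cnj (\<psi> x) \<partial>lebesgue)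
        = ((\<integral>x. u x * cnj (\<psi> x) \<partial>lebesgue) - (\<integral>x. p x * cnj (\<psi> x) \<partial>lebesgue)) / of_real \<tau>"
      by (simp only: integral_divide_zero Bochner_Integration.integral_diff[OF int_u int_p])
    then show ?thesis by (simp only: Re_divide_of_real minus_complex.sel S_Re)
  qed
  moreover have "Re (of_real \<omega> * (\<integral>x. u x * cnj (\<psi> x) \<partial>lebesgue)) = \<omega> * S"
    using S_Re by simp
  moreover have "(\<integral>x. (u x - p x) / of_real \<tau> * cnj (\<psi> x) \<partial>lebesgue) =
      - (\<integral>x. (\<Sum>b\<in>Basis. weak_pderiv b u x * cnj (weak_pderiv b \<psi> x)) \<partial>lebesgue)
      - of_real \<omega> * (\<integral>x. u x * cnj (\<psi> x) \<partial>lebesgue)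
      - pot_integral V (\<lambda>x. p x * cnj (\<psi> x))
      + (\<integral>x. of_real (cmod (p x) powr (2 * \<alpha>)) * p x * cnj (\<psi> x) \<partial>lebesgue)"
    using step \<psi> unfolding BF_step_def by blast
  then have "Re (\<integral>x. (u x - p x) / of_real \<tau> * cnj (\<psi> x) \<partial>lebesgue) =
      - Re (\<integral>x. (\<Sum>b\<in>Basis. weak_pderiv b u x * cnj (weak_pderiv b \<psi> x)) \<partial>lebesgue)
      - Re (of_real \<omega> * (\<integral>x. u x * cnj (\<psi> x) \<partial>lebesgue))
      - Re (pot_integral V (\<lambda>x. p x * cnj (\<psi> x)))
      + Re (\<integral>x. of_real (cmod (p x) powr (2 * \<alpha>)) * p x * cnj (\<psi> x) \<partial>lebesgue)"
    by (simp only: minus_complex.sel plus_complex.sel uminus_complex.sel)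
  ultimately have "(S - Re (\<integral>x. p x * cnj (\<psi> x) \<partial>lebesgue)) / \<tau> \<le> - (\<omega> * S)"
    by linarith
  \<comment> \<open>The pairing with \<open>p\<close> is nonpositive, so omitting it lowers the
    quotient.\<close>
  moreover have "S / \<tau> \<le> (S - Re (\<integral>x. p x * cnj (\<psi> x) \<partial>lebesgue)) / \<tau>"
    using P \<open>0 < \<tau>\<close> by (intro divide_right_mono) auto
  ultimately have "S / \<tau> + \<omega> * S \<le> 0" by linarith
  then have "S * (1 / \<tau> + \<omega>) \<le> 0" by (simp add: algebra_simps)
  moreover have "0 < 1 / \<tau> + \<omega>" using \<open>0 < \<omega>\<close> \<open>0 < \<tau>\<close> by (simp add: add_pos_pos)
  ultimately have "S \<le> 0" by (simp add: mult_le_0_iff)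
  have nonneg: "0 \<le> Re (u x * cnj (\<psi> x))" for x
    using Re_mult_cnj_defect[of "u x"] zero_le_power2[of "Im (u x)"] unfolding \<psi>_def by linarith
  have "S = 0" using \<open>S \<le> 0\<close> nonneg unfolding S_def by (intro antisym integral_nonneg_AE) auto
  then have "AE x in lebesgue. Re (u x * cnj (\<psi> x)) = 0"
    unfolding S_def using nonneg integrable_Re[OF int_u]
    by (subst (asm) integral_nonneg_eq_0_iff_AE) auto
  then show ?thesis
    unfolding nonneg_ae_def
  proof eventually_elim
    case (elim x)
    \<comment> \<open>Two nonnegative terms with sum 0 both vanish: the first gives a nonnegative
      real part, the second a zero imaginary part.\<close>
    then have "- Re (u x) * smooth_negpart (Re (u x)) = 0" "(Im (u x))\<^sup>2 = 0"
      using Re_mult_cnj_defect[of "u x"] zero_le_power2[of "Im (u x)"] unfolding \<psi>_def by linarith+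
    then show ?case
      by (auto simp: complex_nonneg_Reals_iff smooth_negpart_bounds(3))
  qed
qed

lemma H1_scale:
  assumes u: "u \<in> H1"
  shows "(\<lambda>x. of_real c * u x) \<in> H1"
proof -
  have L: "(\<lambda>x. of_real c * f x) \<in> Lp 2" if "f \<in> Lp 2" for f :: "'a \<Rightarrow> complex"
    using that by (auto simp: Lp_2_iff norm_mult power_mult_distrib)
  show ?thesis
    unfolding H1_def using L[OF H1_Lp_2[OF u]] L[OF weak_pderiv_spec(1)[OF u]]
      has_weak_pderiv_bounded_linear[OF bounded_linear_mult_right _ H1_Lp_2[OF u] weak_pderiv_spec[OF u]]
    by blast
qed

theorem proposition4p4:
  fixes V :: "'a::euclidean_space potential"
    and \<alpha> \<omega> \<tau> :: real
    and \<phi>0 :: "'a \<Rightarrow> complex"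
    and \<phi> \<phi>t :: "nat \<Rightarrow> 'a \<Rightarrow> complex"
  assumes "subcritical DIM('a) \<alpha>"
    and "admissible_potential V"
    and "\<omega> > omega0 V" and "omega0 V \<ge> 0"
    and "\<tau> > 0"
    and "\<phi>0 \<in> nehari V \<alpha> \<omega>"
    and "GFDN_BF V \<alpha> \<omega> \<tau> \<phi>0 \<phi> \<phi>t"
    and "nonneg_ae \<phi>0"
  shows "\<forall>n. nonneg_ae (\<phi> n)"
proof -
  \<comment> \<open>Initial datum and normalisation are equations almost everywhere, so regularity
    and sign are passed on along such equalities.\<close>
  have transfer: "g \<in> H1 \<and> nonneg_ae g" if "f \<in> H1" "nonneg_ae f" "AE x in lebesgue. g x = f x" for f g :: "'a \<Rightarrow> complex"
  proof
    have eq: "AE x in lebesgue. f x = g x" using that(3) by eventually_elim simp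
    show "g \<in> H1"
      by (rule H1_cong_AE[OF that(1) eq lebesgue_measurable_cong_AE[OF Lp_2_measurable[OF H1_Lp_2[OF that(1)]] eq]])
    show "nonneg_ae g"
      using that(2) eq unfolding nonneg_ae_def by eventually_elim simp
  qed
  \<comment> \<open>Membership in \<open>H1\<close> belongs to the induction statement because the
    next step pairs the current iterate with an \<open>H1\<close> function.\<close>
  have "\<phi> n \<in> H1 \<and> nonneg_ae (\<phi> n)" for n
  proof (induction n)
    case 0
    show ?case
      by (rule transfer[of \<phi>0]) (use assms in \<open>auto simp: nehari_def GFDN_BF_def\<close>)
  next
    case (Suc n)
    define l where "l = BF_lambda V \<alpha> \<omega> (\<phi>t (Suc n))"
    \<comment> \<open>A real \<open>powr\<close> is never negative, whatever the sign of its
      base.\<close>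
    have "0 \<le> l" by (simp add: l_def BF_lambda_def)
    have step: "BF_step V \<alpha> \<omega> \<tau> (\<phi> n) (\<phi>t (Suc n))"
      and eq: "AE x in lebesgue. \<phi> (Suc n) x = of_real l * \<phi>t (Suc n) x"
      using assms(7) by (auto simp: GFDN_BF_def l_def)
    have "nonneg_ae (\<phi>t (Suc n))"
      by (rule BF_step_nonneg[OF assms(2) _ assms(5) _ _ step]) (use assms(3,4) Suc in auto)
    then have "nonneg_ae (\<lambda>x. of_real l * \<phi>t (Suc n) x)"
      unfolding nonneg_ae_def
      by eventually_elim (use \<open>0 \<le> l\<close> in \<open>auto simp: complex_nonneg_Reals_iff\<close>)
    moreover have "(\<lambda>x. of_real l * \<phi>t (Suc n) x) \<in> H1"
      using step by (intro H1_scale) (simp add: BF_step_def)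
    ultimately show ?case using transfer eq by blast
  qed
  then show ?thesis by blast
qed

end
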